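(* Let $p\ge2$ be an integer, $\mathfrak q=e^{i\pi/p}$, let $\overline{\mathscr U}_{\mathfrak q}s\ell(2)$ be the $2p^3$-dimensional quantum group with generators $E,K,F$, and let $\mathbb C_{2p}[\lambda]=\mathbb C[\lambda]/(\lambda^{2p}-1)$. For $X=(x_{ij})\in\mathrm{Mat}_p(\mathbb C_{2p}[\lambda])$ set $$(K\triangleright X)_{ij}=\mathfrak q^{2(i-j)}\,x_{ij}\big|_{\lambda\to\mathfrak q^{-1}\lambda},$$ $$E\triangleright X=\frac{1}{\mathfrak q-\mathfrak q^{-1}}\bigl(XZ-Z\,(K\triangleright X)\bigr),\qquad F\triangleright X=\frac{1}{\mathfrak q-\mathfrak q^{-1}}\bigl(DX-(K^{-1}\triangleright X)D\bigr),$$ where $Z,D\in\mathrm{Mat}_p(\mathbb C)$ are the $p\times p$ matrices whose only nonzero entries are $Z_{n+1,n}=1$ and $D_{n,n+1}=(\mathfrak q-\mathfrak q^{-1})\,\mathfrak q^{1-n}[n]$ for $n=1,\dots,p-1$. Let $\delta:\mathrm{Mat}_p(\mathbb C_{2p}[\lambda])\to\overline{\mathscr U}_{\mathfrak q}s\ell(2)\otimes\mathrm{Mat}_p(\mathbb C_{2p}[\lambda])$ be the algebra homomorphism determined by $\delta(\lambda)=1\otimes\lambda$ and $$\delta(Z)=K^{-1}\otimes Z-(\mathfrak q-\mathfrak q^{-1})\,EK^{-1}\otimes1,\qquad \delta(D)=K^{-1}\otimes D+(\mathfrak q-\mathfrak q^{-1})\,F\otimes1.$$ With this $\overline{\mathscr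 U}_{\mathfrak q}s\ell(2)$ action and coaction, $\mathrm{Mat}_p(\mathbb C_{2p}[\lambda])$ and (by restriction to $\lambda$-independent matrices) $\mathrm{Mat}_p(\mathbb C)$ are braided commutative left--left Yetter--Drinfeld $\overline{\mathscr U}_{\mathfrak q}s\ell(2)$-module algebras.
   Context: $[n]=\frac{\mathfrak q^n-\mathfrak q^{-n}}{\mathfrak q-\mathfrak q^{-1}}$. The matrices $Z$ and $D$ generate $\mathrm{Mat}_p(\mathbb C)$ as an algebra. $\overline{\mathscr U}_{\mathfrak q}s\ell(2)$ is the complex Hopf algebra with generators $E,K,F$ and relations $KEK^{-1}=\mathfrak q^2E$, $KFK^{-1}=\mathfrak q^{-2}F$, $[E,F]=\frac{K-K^{-1}}{\mathfrak q-\mathfrak q^{-1}}$, $E^p=F^p=0$, $K^{2p}=1$, and $\Delta(E)=E\otimes K+1\otimes E$, $\Delta(K)=K\otimes K$, $\Delta(F)=F\otimes1+K^{-1}\otimes F$, $\varepsilon(E)=\varepsilon(F)=0$, $\varepsilon(K)=1$, $S(E)=-EK^{-1}$, $S(K)=K^{-1}$, $S(F)=-KF$. Primes denote Sweedler components of the coproduct. A left--left Yetter--Drinfeld $H$-module algebra is an algebra $X$ that is a left $H$-module algebra (action $\triangleright$) and a left $H$-comodule algebra (coaction $\delta:X\to H\otimes X$, $\delta(x)=x_{(-1)}\otimes x_{(0)}$, an algebra homomorphism) such that $(h'\triangleright x)_{(-1)}h''\otimes(h'\triangleright x)_{(0)}=h'x_{(-1)}\otimes(h''\triangleright x_{(0)})$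 for all $h\in H$, $x\in X$. It is braided commutative if $yx=(y_{(-1)}\triangleright x)\,y_{(0)}$ for all $x,y\in X$. *)

theory Defs
  imports "HOL-Library.Cardinality" "HOL-Library.Poly_Mapping"
    "HOL-Computational_Algebra.Polynomial" "Jordan_Normal_Form.Matrix"
begin

section \<open>Complex vector spaces and algebras\<close>

class complex_space = ab_group_add +
  fixes scaleC :: "complex \<Rightarrow> 'a \<Rightarrow> 'a"  (infixr \<open>*\<^sub>C\<close> 75)
  assumes scaleC_add_right: "a *\<^sub>C (x + y) = a *\<^sub>C x + a *\<^sub>C y"
    and scaleC_add_left: "(a + b) *\<^sub>C x = a *\<^sub>C x + b *\<^sub>C x"
    and scaleC_scaleC: "a *\<^sub>C (b *\<^sub>C x) = (a * b) *\<^sub>C x"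
    and scaleC_one: "1 *\<^sub>C x = x"

global_interpretation complex_space: vector_space "scaleC :: complex \<Rightarrow> 'a \<Rightarrow> 'a::complex_space"
  by unfold_locales (simp_all add: scaleC_add_right scaleC_add_left scaleC_scaleC scaleC_one)

class complex_algebra_1 = complex_space + ring_1 +
  assumes mult_scaleC_left: "(a *\<^sub>C x) * y = a *\<^sub>C (x * y)"
    and mult_scaleC_right: "x * (a *\<^sub>C y) = a *\<^sub>C (x * y)"

abbreviation clinear :: "('a::complex_space \<Rightarrow> 'b::complex_space) \<Rightarrow> bool" where
  "clinear \<equiv> Vector_Spaces.linear scaleC scaleC"

lemma clinearI:
  assumes "\<And>x y. f (x + y) = f x + f y" "\<And>c x. f (c *\<^sub>C x) = c *\<^sub>C f x"
  shows "clinear f"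
  by unfold_locales (simp_all add: assms)

lemma clinear_add: "clinear f \<Longrightarrow> f (x + y) = f x + f y"
  by (simp add: Vector_Spaces.linear_def module_hom_def module_hom_axioms_def)

lemma clinear_scale: "clinear f \<Longrightarrow> f (c *\<^sub>C x) = c *\<^sub>C f x"
  by (simp add: Vector_Spaces.linear_def module_hom_def module_hom_axioms_def)

lemma clinear_diff: "clinear f \<Longrightarrow> f (x - y) = f x - f y"
  by (metis add_diff_cancel clinear_add diff_add_cancel)

lemma clinear_zero: "clinear f \<Longrightarrow> f 0 = 0"
  by (metis clinear_diff diff_self)

instantiation complex :: complex_algebra_1
begin

definition scaleC_complex :: "complex \<Rightarrow> complex \<Rightarrow> complex" where
  "scaleC_complex = (*)"

instance
  by standard (simp_all add: scaleC_complex_def algebra_simps)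

end

lemma exists_functional:
  fixes x :: "'a::complex_space"
  assumes "x \<noteq> 0"
  shows "\<exists>f :: 'a \<Rightarrow> complex. clinear f \<and> f x = 1"
proof -
  interpret vector_space_pair "scaleC :: complex \<Rightarrow> 'a \<Rightarrow> 'a" "scaleC :: complex \<Rightarrow> complex \<Rightarrow> complex" ..
  have "complex_space.independent {x}"
    using assms by simp
  from linear_independent_extend[OF this, of "\<lambda>_. 1"] show ?thesis
    by auto
qed

definition cbilinear :: "('a::complex_space \<Rightarrow> 'b::complex_space \<Rightarrow> 'c::complex_space) \<Rightarrow> bool" where
  "cbilinear f \<longleftrightarrow> (\<forall>x. clinear (f x)) \<and> (\<forall>y. clinear (\<lambda>x. f x y))"

definition algebra_hom :: "('a::complex_algebra_1 \<Rightarrow> 'b::complex_algebra_1) \<Rightarrow> bool" where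
  "algebra_hom f \<longleftrightarrow> clinear f \<and> f 1 = 1 \<and> (\<forall>x y. f (x * y) = f x * f y)"

definition algebra_antihom :: "('a::complex_algebra_1 \<Rightarrow> 'b::complex_algebra_1) \<Rightarrow> bool" where
  "algebra_antihom f \<longleftrightarrow> clinear f \<and> f 1 = 1 \<and> (\<forall>x y. f (x * y) = f y * f x)"

definition two_sided_ideal :: "'a::complex_algebra_1 set \<Rightarrow> 'a set" where
  "two_sided_ideal R = complex_space.span {a * r * b | a r b. r \<in> R}"

section \<open>Free vector spaces and free algebras\<close>

instantiation poly_mapping :: (type, complex_space) complex_space
begin

lift_definition scaleC_poly_mapping :: "complex \<Rightarrow> ('a \<Rightarrow>\<^sub>0 'b) \<Rightarrow> 'a \<Rightarrow>\<^sub>0 'b"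
  is "\<lambda>c f x. c *\<^sub>C f x"
proof -
  fix c :: complex and f :: "'a \<Rightarrow> 'b"
  assume "finite {x. f x \<noteq> 0}"
  moreover have "{x. c *\<^sub>C f x \<noteq> 0} \<subseteq> {x. f x \<noteq> 0}" by auto
  ultimately show "finite {x. c *\<^sub>C f x \<noteq> 0}" by (rule finite_subset[rotated])
qed

instance
  by standard (transfer, simp add: fun_eq_iff scaleC_add_right scaleC_add_left scaleC_scaleC scaleC_one)+

end

lemma poly_mapping_single_induct [case_names single add]:
  fixes r :: "'k \<Rightarrow>\<^sub>0 'b::comm_monoid_add"
  assumes single: "\<And>k c. P (Poly_Mapping.single k c)" and add: "\<And>x y. P x \<Longrightarrow> P y \<Longrightarrow> P (x + y)"
  shows "P r"
proof -
  have "P (\<Sum>k\<in>A. Poly_Mapping.single k (Poly_Mapping.lookup r k))" if "finite A" for A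
    using that
  proof induction
    case empty
    from single[of undefined 0] show ?case by simp
  next
    case (insert k A)
    then show ?case by (simp add: single add)
  qed
  moreover have "(\<Sum>k\<in>Poly_Mapping.keys r. Poly_Mapping.single k (Poly_Mapping.lookup r k)) = r"
    by (rule poly_mapping_eqI)
      (simp add: lookup_sum lookup_single when_def in_keys_iff)
  ultimately show ?thesis
    using finite_keys[of r] by metis
qed

definition lin_ext :: "('k \<Rightarrow> 'c::complex_space) \<Rightarrow> ('k \<Rightarrow>\<^sub>0 complex) \<Rightarrow> 'c" where
  "lin_ext f r = (\<Sum>k\<in>Poly_Mapping.keys r. Poly_Mapping.lookup r k *\<^sub>C f k)"

lemma lin_ext_superset:
  assumes "finite A" "Poly_Mapping.keys r \<subseteq> A"
  shows "lin_ext f r = (\<Sum>k\<in>A. Poly_Mapping.lookup r k *\<^sub>C f k)"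
  unfolding lin_ext_def
  by (rule sum.mono_neutral_left) (use assms in \<open>auto simp: in_keys_iff\<close>)

lemma clinear_lin_ext: "clinear (lin_ext f)"
proof (rule clinearI)
  fix x y :: "'a \<Rightarrow>\<^sub>0 complex"
  let ?A = "Poly_Mapping.keys x \<union> Poly_Mapping.keys y"
  have "lin_ext f (x + y) = (\<Sum>k\<in>?A. Poly_Mapping.lookup (x + y) k *\<^sub>C f k)"
    by (rule lin_ext_superset) (use Poly_Mapping.keys_add[of x y] in auto)
  also have "\<dots> = (\<Sum>k\<in>?A. Poly_Mapping.lookup x k *\<^sub>C f k) + (\<Sum>k\<in>?A. Poly_Mapping.lookup y k *\<^sub>C f k)"
    by (simp add: lookup_add scaleC_add_left sum.distrib)
  also have "\<dots> = lin_ext f x + lin_ext f y"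
    by (simp add: lin_ext_superset[of ?A])
  finally show "lin_ext f (x + y) = lin_ext f x + lin_ext f y" .
next
  fix c and x :: "'a \<Rightarrow>\<^sub>0 complex"
  have "lin_ext f (c *\<^sub>C x) = (\<Sum>k\<in>Poly_Mapping.keys x. Poly_Mapping.lookup (c *\<^sub>C x) k *\<^sub>C f k)"
    by (rule lin_ext_superset) (auto simp: in_keys_iff scaleC_poly_mapping.rep_eq)
  also have "\<dots> = c *\<^sub>C lin_ext f x"
    by (simp add: lin_ext_def scaleC_poly_mapping.rep_eq scaleC_complex_def complex_space.scale_sum_right)
  finally show "lin_ext f (c *\<^sub>C x) = c *\<^sub>C lin_ext f x" .
qed

lemma lin_ext_single [simp]: "lin_ext f (Poly_Mapping.single k c) = c *\<^sub>C f k"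
  by (subst lin_ext_superset[of "{k}"]) auto

instance poly_mapping :: (monoid_add, complex_algebra_1) complex_algebra_1
proof
  fix a and x y :: "'a \<Rightarrow>\<^sub>0 'b"
  have c: "c *\<^sub>C z = Poly_Mapping.single 0 (c *\<^sub>C 1) * z" "c *\<^sub>C z = z * Poly_Mapping.single 0 (c *\<^sub>C 1)"
    for c and z :: "'a \<Rightarrow>\<^sub>0 'b"
  proof -
    have "c *\<^sub>C Poly_Mapping.single k b = Poly_Mapping.single k (c *\<^sub>C b)" for k :: 'a and b :: 'b
      by (rule poly_mapping_eqI) (simp add: scaleC_poly_mapping.rep_eq lookup_single when_def)
    then show "c *\<^sub>C z = Poly_Mapping.single 0 (c *\<^sub>C 1) * z" "c *\<^sub>C z = z * Poly_Mapping.single 0 (c *\<^sub>C 1)"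
      by (induction z rule: poly_mapping_single_induct)
        (simp_all add: mult_single mult_scaleC_left mult_scaleC_right distrib_left distrib_right scaleC_add_right)
  qed
  show "(a *\<^sub>C x) * y = a *\<^sub>C (x * y)"
    by (simp add: c(1) mult.assoc)
  show "x * (a *\<^sub>C y) = a *\<^sub>C (x * y)"
    by (simp add: c(2) mult.assoc)
qed

text \<open>Words form the free monoid, written additively so that \<open>'g word \<Rightarrow>\<^sub>0 complex\<close> is the free
  complex algebra on \<open>'g\<close>: its product is the convolution product of the monoid algebra.\<close>

datatype 'g word = Word (letters: "'g list")

instantiation word :: (type) monoid_add
begin

definition "0 = Word []"
definition "u + v = Word (letters u @ letters v)"

instance
  by standard (simp_all add: zero_word_def plus_word_def)

end

type_synonym 'g free_algebra = "'g word \<Rightarrow>\<^sub>0 complex"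

definition free_gen :: "'g \<Rightarrow> 'g free_algebra" where
  "free_gen g = Poly_Mapping.single (Word [g]) 1"

definition free_eval :: "('g \<Rightarrow> 'a::complex_algebra_1) \<Rightarrow> 'g free_algebra \<Rightarrow> 'a" where
  "free_eval f = lin_ext (\<lambda>w. prod_list (map f (letters w)))"

lemma free_eval_gen [simp]: "free_eval f (free_gen g) = f g"
  by (simp add: free_eval_def free_gen_def scaleC_one)

lemma clinear_free_eval: "clinear (free_eval f)"
  unfolding free_eval_def by (rule clinear_lin_ext)

lemma free_eval_mult: "free_eval f (x * y) = free_eval f x * free_eval f y"
proof -
  have *: "free_eval f (Poly_Mapping.single k c) = c *\<^sub>C prod_list (map f (letters k))" for k c
    by (simp add: free_eval_def)
  have **: "free_eval f (Poly_Mapping.single k c * y) = free_eval f (Poly_Mapping.single k c) * free_eval f y" for k c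
    by (induction y rule: poly_mapping_single_induct)
      (simp_all add: * mult_single clinear_add[OF clinear_free_eval] distrib_left plus_word_def
        mult_scaleC_left mult_scaleC_right scaleC_scaleC)
  show ?thesis
    by (induction x rule: poly_mapping_single_induct)
      (simp_all add: ** distrib_right clinear_add[OF clinear_free_eval])
qed

lemma algebra_hom_free_eval: "algebra_hom (free_eval f)"
proof -
  have "free_eval f 1 = 1"
    by (simp add: free_eval_def zero_word_def scaleC_one flip: single_one)
  then show ?thesis
    by (simp add: algebra_hom_def free_eval_mult clinear_free_eval)
qed

section \<open>Tensor products\<close>

definition tensor_null :: "('a::complex_space \<times> 'b::complex_space \<Rightarrow>\<^sub>0 complex) set" where
  "tensor_null = complex_space.span (
     {Poly_Mapping.single (x + x', y) 1 - Poly_Mapping.single (x, y) 1 - Poly_Mapping.single (x', y) 1 | x x' y. True} \<union>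
     {Poly_Mapping.single (x, y + y') 1 - Poly_Mapping.single (x, y) 1 - Poly_Mapping.single (x, y') 1 | x y y'. True} \<union>
     {Poly_Mapping.single (c *\<^sub>C x, y) 1 - c *\<^sub>C Poly_Mapping.single (x, y) 1 | c x y. True} \<union>
     {Poly_Mapping.single (x, c *\<^sub>C y) 1 - c *\<^sub>C Poly_Mapping.single (x, y) 1 | c x y. True})"

lemma span_equivp: "equivp (\<lambda>x y. x - y \<in> complex_space.span S)"
proof (rule equivpI)
  show "reflp (\<lambda>x y. x - y \<in> complex_space.span S)"
    by (simp add: reflp_def complex_space.span_zero)
  show "symp (\<lambda>x y. x - y \<in> complex_space.span S)"
    by (rule sympI) (metis complex_space.span_neg minus_diff_eq)
  show "transp (\<lambda>x y. x - y \<in> complex_space.span S)"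
    by (rule transpI) (use complex_space.span_add in fastforce)
qed

quotient_type (overloaded) ('a, 'b) tensor =
  "('a::complex_space \<times> 'b::complex_space) \<Rightarrow>\<^sub>0 complex" / "\<lambda>r s. r - s \<in> tensor_null"
  unfolding tensor_null_def by (rule span_equivp)

lift_definition tensor :: "'a::complex_space \<Rightarrow> 'b::complex_space \<Rightarrow> ('a, 'b) tensor"  (infixl \<open>\<otimes>\<^sub>t\<close> 72)
  is "\<lambda>x y. Poly_Mapping.single (x, y) 1" .

lemma diff_in_span_add:
  assumes "x - x' \<in> complex_space.span S" "y - y' \<in> complex_space.span S"
  shows "(x + y) - (x' + y') \<in> complex_space.span S"
  using complex_space.span_add[OF assms] by (simp add: add_diff_add)

lemma diff_in_span_diff:
  assumes "x - x' \<in> complex_space.span S" "y - y' \<in> complex_space.span S"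
  shows "(x - y) - (x' - y') \<in> complex_space.span S"
  using complex_space.span_diff[OF assms] by (simp add: algebra_simps)

lemma diff_in_span_neg:
  assumes "x - x' \<in> complex_space.span S"
  shows "- x - - x' \<in> complex_space.span S"
  using complex_space.span_neg[OF assms] by simp

lemma diff_in_span_scale:
  assumes "x - x' \<in> complex_space.span S"
  shows "c *\<^sub>C x - c *\<^sub>C x' \<in> complex_space.span S"
  using complex_space.span_scale[OF assms, of c] by (simp add: complex_space.scale_right_diff_distrib)

instantiation tensor :: (complex_space, complex_space) complex_space
begin

lift_definition zero_tensor :: "('a, 'b) tensor" is 0 .
lift_definition plus_tensor :: "('a, 'b) tensor \<Rightarrow> ('a, 'b) tensor \<Rightarrow> ('a, 'b) tensor" is "(+)"
  unfolding tensor_null_def by (rule diff_in_span_add)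
lift_definition minus_tensor :: "('a, 'b) tensor \<Rightarrow> ('a, 'b) tensor \<Rightarrow> ('a, 'b) tensor" is "(-)"
  unfolding tensor_null_def by (rule diff_in_span_diff)
lift_definition uminus_tensor :: "('a, 'b) tensor \<Rightarrow> ('a, 'b) tensor" is uminus
  unfolding tensor_null_def by (rule diff_in_span_neg)
lift_definition scaleC_tensor :: "complex \<Rightarrow> ('a, 'b) tensor \<Rightarrow> ('a, 'b) tensor" is scaleC
  unfolding tensor_null_def by (rule diff_in_span_scale)

instance
  by standard
    (transfer, simp add: algebra_simps scaleC_add_right scaleC_add_left scaleC_scaleC scaleC_one
      tensor_null_def complex_space.span_zero)+

end

lemma cbilinear_tensor: "cbilinear (\<otimes>\<^sub>t)"
  unfolding cbilinear_def
proof (intro conjI allI clinearI)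
  fix x x' :: 'a and y y' :: 'b and c
  show "x \<otimes>\<^sub>t (y + y') = x \<otimes>\<^sub>t y + x \<otimes>\<^sub>t y'"
    by (transfer, unfold tensor_null_def diff_diff_eq[symmetric], rule complex_space.span_base) blast
  show "(x + x') \<otimes>\<^sub>t y = x \<otimes>\<^sub>t y + x' \<otimes>\<^sub>t y"
    by (transfer, unfold tensor_null_def diff_diff_eq[symmetric], rule complex_space.span_base) blast
  show "x \<otimes>\<^sub>t (c *\<^sub>C y) = c *\<^sub>C (x \<otimes>\<^sub>t y)"
    by (transfer, unfold tensor_null_def, rule complex_space.span_base) blast
  show "(c *\<^sub>C x) \<otimes>\<^sub>t y = c *\<^sub>C (x \<otimes>\<^sub>t y)"
    by (transfer, unfold tensor_null_def, rule complex_space.span_base) blast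
qed

lemma tensor_add_left: "(x + x') \<otimes>\<^sub>t y = x \<otimes>\<^sub>t y + x' \<otimes>\<^sub>t y"
  and tensor_add_right: "x \<otimes>\<^sub>t (y + y') = x \<otimes>\<^sub>t y + x \<otimes>\<^sub>t y'"
  and tensor_scale_left: "(c *\<^sub>C x) \<otimes>\<^sub>t y = c *\<^sub>C (x \<otimes>\<^sub>t y)"
  and tensor_scale_right: "x \<otimes>\<^sub>t (c *\<^sub>C y) = c *\<^sub>C (x \<otimes>\<^sub>t y)"
  using cbilinear_tensor clinear_add clinear_scale unfolding cbilinear_def by blast+

lemma tensor_induct [case_names tensor add]:
  fixes P :: "('a::complex_space, 'b::complex_space) tensor \<Rightarrow> bool"
  assumes pure: "\<And>x y. P (x \<otimes>\<^sub>t y)" and add: "\<And>s t. P s \<Longrightarrow> P t \<Longrightarrow> P (s + t)"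
  shows "P t"
proof -
  have sc: "P (c *\<^sub>C (x \<otimes>\<^sub>t y))" for c x y
    using pure[of "c *\<^sub>C x" y] by (simp add: tensor_scale_left)
  have "P (abs_tensor r)" for r
  proof (induction r rule: poly_mapping_single_induct)
    case (single k c)
    obtain x y where k: "k = (x, y)" by force
    have "Poly_Mapping.single (x, y) c = c *\<^sub>C (Poly_Mapping.single (x, y) 1 :: _ \<Rightarrow>\<^sub>0 complex)"
      by (rule poly_mapping_eqI) (simp add: scaleC_poly_mapping.rep_eq lookup_single when_def scaleC_complex_def)
    then show ?case
      using sc[of c x y] by (simp add: k tensor.abs_eq scaleC_tensor.abs_eq)
  next
    case (add f g)
    then show ?case
      unfolding plus_tensor.abs_eq[symmetric] by (rule assms(2))
  qed
  from this[of "rep_tensor t"] show ?thesis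
    by (simp add: Quotient3_abs_rep[OF Quotient3_tensor])
qed

text \<open>The linear map on the tensor product induced by a bilinear map \<open>f\<close>; in Sweedler notation
  \<open>tensor_lift f t\<close> is \<open>f t' t''\<close>. It is only meaningful for bilinear \<open>f\<close>.\<close>

definition tensor_lift :: "('a::complex_space \<Rightarrow> 'b::complex_space \<Rightarrow> 'c::complex_space) \<Rightarrow> ('a, 'b) tensor \<Rightarrow> 'c" where
  "tensor_lift f t = lin_ext (\<lambda>(x, y). f x y) (rep_tensor t)"

lemma lin_ext_tensor_null:
  assumes "cbilinear f" "r \<in> tensor_null"
  shows "lin_ext (\<lambda>(x, y). f x y) r = 0"
proof -
  note [simp] = clinear_diff[OF clinear_lin_ext] clinear_add[OF clinear_lin_ext]
    clinear_scale[OF clinear_lin_ext] clinear_zero[OF clinear_lin_ext]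
  have f: "f (x + x') y = f x y + f x' y" "f x (y + y') = f x y + f x y'"
    "f (c *\<^sub>C x) y = c *\<^sub>C f x y" "f x (c *\<^sub>C y) = c *\<^sub>C f x y" for x x' y y' c
    using assms(1) clinear_add[of "\<lambda>x. f x y"] clinear_add[of "f x"]
      clinear_scale[of "\<lambda>x. f x y"] clinear_scale[of "f x"]
    by (auto simp: cbilinear_def)
  show ?thesis
    using assms(2) unfolding tensor_null_def
    by (induction rule: complex_space.span_induct_alt) (auto simp: f scaleC_one)
qed

lemma tensor_lift_abs:
  assumes "cbilinear f"
  shows "tensor_lift f (abs_tensor r) = lin_ext (\<lambda>(x, y). f x y) r"
proof -
  have "rep_tensor (abs_tensor r) - r \<in> tensor_null"
    by (rule Quotient3_rep_abs[OF Quotient3_tensor]) (simp add: tensor_null_def complex_space.span_zero)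
  from lin_ext_tensor_null[OF assms this] show ?thesis
    by (simp add: tensor_lift_def clinear_diff[OF clinear_lin_ext])
qed

lemma tensor_lift_tensor:
  assumes "cbilinear f"
  shows "tensor_lift f (x \<otimes>\<^sub>t y) = f x y"
  by (simp add: tensor.abs_eq tensor_lift_abs[OF assms] scaleC_one)

lemma clinear_tensor_lift:
  assumes "cbilinear f"
  shows "clinear (tensor_lift f)"
proof (rule clinearI)
  fix s t :: "('a, 'b) tensor" and c
  obtain r where r: "s = abs_tensor r"
    using Quotient3_abs_rep[OF Quotient3_tensor, of s] by metis
  obtain r' where r': "t = abs_tensor r'"
    using Quotient3_abs_rep[OF Quotient3_tensor, of t] by metis
  show "tensor_lift f (s + t) = tensor_lift f s + tensor_lift f t"
    by (simp add: r r' plus_tensor.abs_eq tensor_lift_abs[OF assms] clinear_add[OF clinear_lin_ext])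
  show "tensor_lift f (c *\<^sub>C s) = c *\<^sub>C tensor_lift f s"
    by (simp add: r scaleC_tensor.abs_eq tensor_lift_abs[OF assms] clinear_scale[OF clinear_lin_ext])
qed



definition tensor_lmult :: "'a \<Rightarrow> 'b \<Rightarrow> ('a::complex_algebra_1, 'b::complex_algebra_1) tensor \<Rightarrow> ('a, 'b) tensor" where
  "tensor_lmult a b t = tensor_lift (\<lambda>c d. (a * c) \<otimes>\<^sub>t (b * d)) t"

lemma cbilinear_tensor_lmult_aux:
  fixes a :: "'a::complex_algebra_1" and b :: "'b::complex_algebra_1"
  shows "cbilinear (\<lambda>c d. (a * c) \<otimes>\<^sub>t (b * d))"
  unfolding cbilinear_def
  by (intro conjI allI clinearI)
    (simp_all add: distrib_left mult_scaleC_right tensor_add_left tensor_add_right tensor_scale_left tensor_scale_right)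

lemma tensor_lmult_tensor: "tensor_lmult a b (c \<otimes>\<^sub>t d) = (a * c) \<otimes>\<^sub>t (b * d)"
  by (simp add: tensor_lmult_def tensor_lift_tensor[OF cbilinear_tensor_lmult_aux])

lemma clinear_tensor_lmult: "clinear (tensor_lmult a b)"
  unfolding tensor_lmult_def by (rule clinear_tensor_lift[OF cbilinear_tensor_lmult_aux])

lemmas tensor_lmult_simps = tensor_lmult_tensor clinear_add[OF clinear_tensor_lmult] clinear_scale[OF clinear_tensor_lmult]

lemma cbilinear_tensor_lmult: "cbilinear (\<lambda>a b. tensor_lmult a b t)"
  unfolding cbilinear_def
proof (intro conjI allI clinearI)
  show "tensor_lmult a (b + b') t = tensor_lmult a b t + tensor_lmult a b' t" for a b b'
    by (induction t rule: tensor_induct) (simp_all add: tensor_lmult_simps distrib_right tensor_add_right)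
  show "tensor_lmult (a + a') b t = tensor_lmult a b t + tensor_lmult a' b t" for a a' b
    by (induction t rule: tensor_induct) (simp_all add: tensor_lmult_simps distrib_right tensor_add_left)
  show "tensor_lmult a (c *\<^sub>C b) t = c *\<^sub>C tensor_lmult a b t" for a b c
    by (induction t rule: tensor_induct)
      (simp_all add: tensor_lmult_simps mult_scaleC_left tensor_scale_right scaleC_add_right)
  show "tensor_lmult (c *\<^sub>C a) b t = c *\<^sub>C tensor_lmult a b t" for a b c
    by (induction t rule: tensor_induct)
      (simp_all add: tensor_lmult_simps mult_scaleC_left tensor_scale_left scaleC_add_right)
qed

lemma tensor_one_neq_zero: "(1::'a::complex_algebra_1) \<otimes>\<^sub>t (1::'b::complex_algebra_1) \<noteq> 0"
proof
  assume *: "(1::'a) \<otimes>\<^sub>t (1::'b) = 0"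
  obtain f :: "'a \<Rightarrow> complex" where f: "clinear f" "f 1 = 1"
    using exists_functional[of "1::'a"] by auto
  obtain g :: "'b \<Rightarrow> complex" where g: "clinear g" "g 1 = 1"
    using exists_functional[of "1::'b"] by auto
  have fg: "cbilinear (\<lambda>x y. f x * g y)"
    unfolding cbilinear_def
    by (intro conjI allI clinearI)
      (simp_all add: clinear_add[OF f(1)] clinear_add[OF g(1)] clinear_scale[OF f(1)]
        clinear_scale[OF g(1)] scaleC_complex_def algebra_simps)
  have "tensor_lift (\<lambda>x y. f x * g y) (1 \<otimes>\<^sub>t 1) = 1"
    by (simp add: tensor_lift_tensor[OF fg] f g)
  then show False
    by (simp add: * clinear_zero[OF clinear_tensor_lift[OF fg]])
qed

instantiation tensor :: (complex_algebra_1, complex_algebra_1) complex_algebra_1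
begin

definition one_tensor :: "('a, 'b) tensor" where
  "1 = 1 \<otimes>\<^sub>t 1"

definition times_tensor :: "('a, 'b) tensor \<Rightarrow> ('a, 'b) tensor \<Rightarrow> ('a, 'b) tensor" where
  "s * t = tensor_lift (\<lambda>a b. tensor_lift (\<lambda>c d. (a * c) \<otimes>\<^sub>t (b * d)) t) s"

lemma mult_tensor_left: "(a \<otimes>\<^sub>t b) * t = tensor_lmult a b t"
  by (simp only: times_tensor_def tensor_lmult_def[symmetric] tensor_lift_tensor[OF cbilinear_tensor_lmult])

lemma clinear_tensor_mult_left: "clinear (\<lambda>s :: ('a, 'b) tensor. s * t)"
  unfolding times_tensor_def tensor_lmult_def[symmetric] by (rule clinear_tensor_lift[OF cbilinear_tensor_lmult])

lemmas tensor_mult_simps = tensor_lmult_simps mult_tensor_left clinear_add[OF clinear_tensor_mult_left]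
  clinear_scale[OF clinear_tensor_mult_left]

lemma clinear_tensor_mult_right: "clinear (\<lambda>t :: ('a, 'b) tensor. s * t)"
  by (rule clinearI; induction s rule: tensor_induct) (simp_all add: tensor_mult_simps scaleC_add_right)

instance
proof
  fix r s t :: "('a, 'b) tensor" and c
  note [simp] = tensor_mult_simps clinear_add[OF clinear_tensor_mult_right] clinear_scale[OF clinear_tensor_mult_right]
  show "(r + s) * t = r * t + s * t" "r * (s + t) = r * s + r * t"
    "(c *\<^sub>C r) * s = c *\<^sub>C (r * s)" "r * (c *\<^sub>C s) = c *\<^sub>C (r * s)"
    by simp_all
  show "1 * r = r" "r * 1 = r"
    by (induction r rule: tensor_induct) (simp_all add: one_tensor_def)
  have 1: "tensor_lmult a b (tensor_lmult a' b' t) = tensor_lmult (a * a') (b * b') t" for a b a' b'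
    by (induction t rule: tensor_induct) (simp_all add: mult.assoc)
  have 2: "tensor_lmult a b (s * t) = tensor_lmult a b s * t" for a b
    by (induction s rule: tensor_induct) (simp_all add: 1)
  show "r * s * t = r * (s * t)"
    by (induction r rule: tensor_induct) (simp_all add: 2)
  show "(0::('a, 'b) tensor) \<noteq> 1"
    using tensor_one_neq_zero[where 'a='a and 'b='b] by (simp add: one_tensor_def)
qed

end

lemma tensor_mult: "(a \<otimes>\<^sub>t b) * (c \<otimes>\<^sub>t d) = (a * c) \<otimes>\<^sub>t (b * d)"
  by (simp add: mult_tensor_left tensor_lmult_tensor)


definition tensor_map ::
  "('a::complex_space \<Rightarrow> 'c::complex_space) \<Rightarrow> ('b::complex_space \<Rightarrow> 'd::complex_space) \<Rightarrow> ('a, 'b) tensor \<Rightarrow> ('c, 'd) tensor"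
  where "tensor_map f g = tensor_lift (\<lambda>x y. f x \<otimes>\<^sub>t g y)"

definition tensor_assoc ::
  "(('a::complex_space, 'b::complex_space) tensor, 'c::complex_space) tensor \<Rightarrow> ('a, ('b, 'c) tensor) tensor"
  where "tensor_assoc = tensor_lift (\<lambda>s z. tensor_lift (\<lambda>x y. x \<otimes>\<^sub>t (y \<otimes>\<^sub>t z)) s)"

section \<open>Hopf algebras and Yetter--Drinfeld module algebras\<close>

locale hopf_algebra =
  fixes comult :: "'h::complex_algebra_1 \<Rightarrow> ('h, 'h) tensor"
    and counit :: "'h \<Rightarrow> complex"
    and antipode :: "'h \<Rightarrow> 'h"
  assumes comult_hom: "algebra_hom comult"
    and counit_hom: "algebra_hom counit"
    and antipode_linear: "clinear antipode"
    and coassoc: "tensor_assoc (tensor_map comult id (comult h)) = tensor_map id comult (comult h)"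
    and counit_left: "tensor_lift (\<lambda>h' h''. counit h' *\<^sub>C h'') (comult h) = h"
    and counit_right: "tensor_lift (\<lambda>h' h''. counit h'' *\<^sub>C h') (comult h) = h"
    and antipode_left: "tensor_lift (\<lambda>h' h''. antipode h' * h'') (comult h) = counit h *\<^sub>C 1"
    and antipode_right: "tensor_lift (\<lambda>h' h''. h' * antipode h'') (comult h) = counit h *\<^sub>C 1"

definition is_module_action :: "('h::complex_algebra_1 \<Rightarrow> 'x::complex_space \<Rightarrow> 'x) \<Rightarrow> bool" where
  "is_module_action act \<longleftrightarrow> cbilinear act \<and> (\<forall>x. act 1 x = x) \<and> (\<forall>g h x. act (g * h) x = act g (act h x))"

locale yetter_drinfeld_module_algebra = hopf_algebra comult counit antipode
  for comult :: "'h::complex_algebra_1 \<Rightarrow> ('h, 'h) tensor"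
    and counit :: "'h \<Rightarrow> complex"
    and antipode :: "'h \<Rightarrow> 'h" +
  fixes act :: "'h \<Rightarrow> 'x::complex_algebra_1 \<Rightarrow> 'x"
    and coact :: "'x \<Rightarrow> ('h, 'x) tensor"
  assumes act_module: "is_module_action act"
    and act_mult: "act h (x * y) = tensor_lift (\<lambda>h' h''. act h' x * act h'' y) (comult h)"
    and act_one: "act h 1 = counit h *\<^sub>C 1"
    and coact_hom: "algebra_hom coact"
    and coact_coassoc: "tensor_assoc (tensor_map comult id (coact x)) = tensor_map id coact (coact x)"
    and coact_counit: "tensor_lift (\<lambda>g z. counit g *\<^sub>C z) (coact x) = x"
    and yetter_drinfeld:
      "tensor_lift (\<lambda>h' h''. tensor_lift (\<lambda>g z. (g * h'') \<otimes>\<^sub>t z) (coact (act h' x))) (comult h) =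
       tensor_lift (\<lambda>h' h''. tensor_lift (\<lambda>g z. (h' * g) \<otimes>\<^sub>t act h'' z) (coact x)) (comult h)"

locale braided_commutative_yetter_drinfeld_module_algebra = yetter_drinfeld_module_algebra +
  assumes braided_commutative: "y * x = tensor_lift (\<lambda>g z. act g x * z) (coact y)"

section \<open>The restricted quantum group\<close>

text \<open>The integer \<open>p\<close> is the cardinality \<open>CARD('p)\<close> of an arbitrary finite type \<open>'p\<close>; only the
  cardinality of \<open>'p\<close> matters, and every positive integer is the cardinality of some type.\<close>

definition \<qq> :: "'p::finite itself \<Rightarrow> complex" where
  "\<qq> _ = exp (\<i> * of_real pi / of_nat CARD('p))"

definition qint :: "'p::finite itself \<Rightarrow> nat \<Rightarrow> complex" where
  "qint p n = (\<qq> p ^ n - inverse (\<qq> p) ^ n) / (\<qq> p - inverse (\<qq> p))"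

lemma qq_nonzero [simp]: "\<qq> p \<noteq> 0"
  by (simp add: \<qq>_def)

lemma qq_power: "\<qq> TYPE('p::finite) ^ (2 * CARD('p)) = 1"
proof -
  have "of_nat (2 * CARD('p)) * (\<i> * complex_of_real pi / of_nat CARD('p)) = 2 * of_real pi * \<i>"
    by (simp add: field_simps)
  then show ?thesis
    unfolding \<qq>_def by (metis exp_of_nat_mult exp_two_pi_i)
qed

datatype uq_gen = Gen_E | Gen_K | Gen_F

text \<open>Because of \<open>K\<^sup>2\<^sup>p = 1\<close>, the inverse of \<open>K\<close> is written as \<open>K\<close> to the power \<open>2p - 1\<close>.\<close>

definition uq_relations :: "'p::finite itself \<Rightarrow> uq_gen free_algebra set" where
  "uq_relations p =
    (let E = free_gen Gen_E; K = free_gen Gen_K; F = free_gen Gen_F;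
         K' = K ^ (2 * CARD('p) - 1); q = \<qq> p
     in {K * E * K' - q\<^sup>2 *\<^sub>C E,
         K * F * K' - (inverse q)\<^sup>2 *\<^sub>C F,
         E * F - F * E - inverse (q - inverse q) *\<^sub>C (K - K'),
         E ^ CARD('p), F ^ CARD('p), K ^ (2 * CARD('p)) - 1})"

quotient_type (overloaded) 'p uq = "uq_gen free_algebra" /
  "\<lambda>x y. x - y \<in> two_sided_ideal (uq_relations TYPE('p::finite))"
  unfolding two_sided_ideal_def by (rule span_equivp)

lemma two_sided_ideal_mult:
  assumes "x \<in> two_sided_ideal R"
  shows "y * x \<in> two_sided_ideal R" "x * y \<in> two_sided_ideal R"
proof -
  have "clinear ((*) y)" "clinear (\<lambda>x. x * y)"
    by (auto intro!: clinearI simp: distrib_left distrib_right mult_scaleC_left mult_scaleC_right)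
  have "y * x \<in> two_sided_ideal R \<and> x * y \<in> two_sided_ideal R"
    using assms unfolding two_sided_ideal_def
  proof (induction rule: complex_space.span_induct_alt)
    case base
    show ?case by (simp add: complex_space.span_zero)
  next
    case (step c x z)
    then obtain a b r where x: "x = a * r * b" "r \<in> R" by blast
    have "y * x = (y * a) * r * b" "x * y = a * r * (b * y)"
      by (simp_all add: x mult.assoc)
    then have "y * x \<in> complex_space.span {a * r * b | a r b. r \<in> R}"
      "x * y \<in> complex_space.span {a * r * b | a r b. r \<in> R}"
      using x(2) by (blast intro: complex_space.span_base)+
    with step show ?case
      by (simp add: distrib_left distrib_right mult_scaleC_left mult_scaleC_right
          complex_space.span_add complex_space.span_scale)
  qed
  then show "y * x \<in> two_sided_ideal R" "x * y \<in> two_sided_ideal R"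
    by auto
qed

lemma two_sided_ideal_diff_mult:
  assumes "x - x' \<in> two_sided_ideal R" "y - y' \<in> two_sided_ideal R"
  shows "x * y - x' * y' \<in> two_sided_ideal R"
proof -
  have "x * y - x' * y' = (x - x') * y + x' * (y - y')"
    by (simp add: algebra_simps)
  then show ?thesis
    using two_sided_ideal_mult[OF assms(1)] two_sided_ideal_mult[OF assms(2)]
    by (simp add: two_sided_ideal_def complex_space.span_add)
qed

lemma algebra_hom_ideal:
  assumes f: "algebra_hom f" and R: "\<And>r. r \<in> R \<Longrightarrow> f r = 0" and x: "x \<in> two_sided_ideal R"
  shows "f x = 0"
proof -
  have lin: "clinear f" and mult: "f (x * y) = f x * f y" for x y
    using f by (auto simp: algebra_hom_def)
  show ?thesis
    using x unfolding two_sided_ideal_def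
    by (induction rule: complex_space.span_induct_alt)
      (auto simp: clinear_zero[OF lin] clinear_add[OF lin] clinear_scale[OF lin] mult R)
qed

lemma algebra_hom_power:
  assumes "algebra_hom f"
  shows "f (x ^ n) = f x ^ n"
  by (induction n) (use assms in \<open>auto simp: algebra_hom_def\<close>)

lemma one_notin_uq_ideal: "1 \<notin> two_sided_ideal (uq_relations TYPE('p::finite))"
proof
  let ?f = "free_eval (\<lambda>g. if g = Gen_K then 1 else (0 :: complex))"
  assume "1 \<in> two_sided_ideal (uq_relations TYPE('p))"
  moreover have hom: "algebra_hom ?f" by (rule algebra_hom_free_eval)
  moreover have "?f r = 0" if "r \<in> uq_relations TYPE('p)" for r
  proof -
    have lin: "clinear ?f" and mult: "?f (x * y) = ?f x * ?f y" and one: "?f 1 = 1" for x y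
      using hom by (auto simp: algebra_hom_def)
    show ?thesis
      using that unfolding uq_relations_def Let_def
      by (auto simp: clinear_diff[OF lin] clinear_scale[OF lin] mult one algebra_hom_power[OF hom])
  qed
  ultimately have "?f 1 = 0"
    by (rule algebra_hom_ideal[rotated 2])
  then show False
    using hom by (simp add: algebra_hom_def)
qed

instantiation uq :: (finite) complex_algebra_1
begin

lift_definition zero_uq :: "'a uq" is 0 .
lift_definition one_uq :: "'a uq" is 1 .
lift_definition plus_uq :: "'a uq \<Rightarrow> 'a uq \<Rightarrow> 'a uq" is "(+)"
  unfolding two_sided_ideal_def by (rule diff_in_span_add)
lift_definition minus_uq :: "'a uq \<Rightarrow> 'a uq \<Rightarrow> 'a uq" is "(-)"
  unfolding two_sided_ideal_def by (rule diff_in_span_diff)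
lift_definition uminus_uq :: "'a uq \<Rightarrow> 'a uq" is uminus
  unfolding two_sided_ideal_def by (rule diff_in_span_neg)
lift_definition scaleC_uq :: "complex \<Rightarrow> 'a uq \<Rightarrow> 'a uq" is scaleC
  unfolding two_sided_ideal_def by (rule diff_in_span_scale)
lift_definition times_uq :: "'a uq \<Rightarrow> 'a uq \<Rightarrow> 'a uq" is "(*)"
  by (rule two_sided_ideal_diff_mult)

instance
proof
  show "(0::'a uq) \<noteq> 1"
    by transfer (use one_notin_uq_ideal complex_space.span_neg in \<open>fastforce simp: two_sided_ideal_def\<close>)
qed (transfer, simp add: algebra_simps scaleC_add_right scaleC_add_left scaleC_scaleC scaleC_one
      mult_scaleC_left mult_scaleC_right two_sided_ideal_def complex_space.span_zero)+

end

lift_definition uq_E :: "'p::finite uq" is "free_gen Gen_E" .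
lift_definition uq_K :: "'p::finite uq" is "free_gen Gen_K" .
lift_definition uq_F :: "'p::finite uq" is "free_gen Gen_F" .

definition uq_Kinv :: "'p::finite uq" where
  "uq_Kinv = uq_K ^ (2 * CARD('p) - 1)"

text \<open>That the generator values below determine unique (anti)homomorphisms is not assumed; in
  particular any statement that these three maps form a Hopf algebra structure depends on it.\<close>

definition uq_comult :: "'p::finite uq \<Rightarrow> ('p uq, 'p uq) tensor" where
  "uq_comult = (THE f. algebra_hom f \<and>
     f uq_E = uq_E \<otimes>\<^sub>t uq_K + 1 \<otimes>\<^sub>t uq_E \<and>
     f uq_K = uq_K \<otimes>\<^sub>t uq_K \<and>
     f uq_F = uq_F \<otimes>\<^sub>t 1 + uq_Kinv \<otimes>\<^sub>t uq_F)"

definition uq_counit :: "'p::finite uq \<Rightarrow> complex" where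
  "uq_counit = (THE f. algebra_hom f \<and> f uq_E = 0 \<and> f uq_K = 1 \<and> f uq_F = 0)"

definition uq_antipode :: "'p::finite uq \<Rightarrow> 'p uq" where
  "uq_antipode = (THE f. algebra_antihom f \<and>
     f uq_E = - (uq_E * uq_Kinv) \<and> f uq_K = uq_Kinv \<and> f uq_F = - (uq_K * uq_F))"

section \<open>Matrices over the algebra of polynomials modulo \<open>\<lambda>\<^sup>2\<^sup>p - 1\<close>\<close>

quotient_type (overloaded) 'p lam_poly = "complex poly" /
  "\<lambda>f g. (monom 1 (2 * CARD('p::finite)) - 1) dvd (f - g)"
proof (rule equivpI)
  let ?m = "monom 1 (2 * CARD('p)) - 1 :: complex poly"
  show "reflp (\<lambda>f g. ?m dvd f - g)"
    by (simp add: reflp_def)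
  show "symp (\<lambda>f g. ?m dvd f - g)"
    by (rule sympI) (metis dvd_minus_iff minus_diff_eq)
  show "transp (\<lambda>f g. ?m dvd f - g)"
    by (rule transpI) (use dvd_add in fastforce)
qed

instantiation lam_poly :: (finite) "{comm_ring_1, complex_algebra_1}"
begin

lift_definition zero_lam_poly :: "'a lam_poly" is 0 .
lift_definition one_lam_poly :: "'a lam_poly" is 1 .
lift_definition plus_lam_poly :: "'a lam_poly \<Rightarrow> 'a lam_poly \<Rightarrow> 'a lam_poly" is "(+)"
  by (metis add_diff_add dvd_add)
lift_definition minus_lam_poly :: "'a lam_poly \<Rightarrow> 'a lam_poly \<Rightarrow> 'a lam_poly" is "(-)"
  by (drule (1) dvd_diff) (simp add: algebra_simps)
lift_definition uminus_lam_poly :: "'a lam_poly \<Rightarrow> 'a lam_poly" is uminus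
  by (metis dvd_minus_iff minus_diff_minus)
lift_definition scaleC_lam_poly :: "complex \<Rightarrow> 'a lam_poly \<Rightarrow> 'a lam_poly" is Polynomial.smult
  by (metis dvd_smult smult_diff_right)
lift_definition times_lam_poly :: "'a lam_poly \<Rightarrow> 'a lam_poly \<Rightarrow> 'a lam_poly" is "(*)"
proof -
  fix f f' g g' :: "complex poly"
  let ?m = "monom 1 (2 * CARD('a)) - 1 :: complex poly"
  assume "?m dvd f - f'" "?m dvd g - g'"
  moreover have "f * g - f' * g' = (f - f') * g + f' * (g - g')"
    by (simp add: algebra_simps)
  ultimately show "?m dvd f * g - f' * g'"
    by simp
qed

instance
proof
  show "(0::'a lam_poly) \<noteq> 1"
  proof transfer
    let ?m = "monom 1 (2 * CARD('a)) - 1 :: complex poly"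
    have "degree ?m = 2 * CARD('a)"
      by (subst diff_conv_add_uminus, subst degree_add_eq_left) (simp_all add: degree_monom_eq)
    then have "\<not> ?m dvd 1"
      using dvd_imp_degree_le[of ?m 1] by auto
    then show "\<not> ?m dvd 0 - 1"
      by simp
  qed
qed (transfer, simp add: algebra_simps smult_add_left smult_add_right)+

end

lift_definition lam :: "'p::finite lam_poly" is "[:0, 1:]" .

lift_definition lam_shift :: "'p::finite lam_poly \<Rightarrow> 'p lam_poly"
  is "\<lambda>f. f \<circ>\<^sub>p [:0, inverse (\<qq> TYPE('p)):]"
proof -
  fix f g :: "complex poly"
  let ?m = "monom 1 (2 * CARD('p)) - 1 :: complex poly" and ?l = "[:0, inverse (\<qq> TYPE('p)):]"
  have pow: "(p ^ n) \<circ>\<^sub>p ?l = (p \<circ>\<^sub>p ?l) ^ n" for p n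
    by (induction n) (simp_all add: pcompose_1 pcompose_mult)
  have "?m = [:0, 1:] ^ (2 * CARD('p)) - 1"
    by (simp add: monom_altdef)
  then have "?m \<circ>\<^sub>p ?l = ?l ^ (2 * CARD('p)) - 1"
    by (simp add: pcompose_diff pcompose_1 pow pcompose_pCons)
  also have "?l ^ (2 * CARD('p)) = monom (inverse (\<qq> TYPE('p))) 1 ^ (2 * CARD('p))"
    by (simp add: monom_altdef)
  also have "\<dots> = monom 1 (2 * CARD('p))"
    by (simp add: monom_power power_inverse qq_power)
  finally have m: "?m \<circ>\<^sub>p ?l = ?m" .
  assume "?m dvd f - g"
  then obtain h where "f - g = ?m * h" ..
  then have "f \<circ>\<^sub>p ?l - g \<circ>\<^sub>p ?l = ?m * (h \<circ>\<^sub>p ?l)"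
    by (metis m pcompose_diff pcompose_mult)
  then show "?m dvd f \<circ>\<^sub>p ?l - g \<circ>\<^sub>p ?l"
    by simp
qed

typedef ('a, 'p) smat = "carrier_mat CARD('p::finite) CARD('p) :: 'a mat set"
  by (rule exI[of _ "mat CARD('p) CARD('p) (\<lambda>_. undefined)"]) simp

setup_lifting type_definition_smat

lift_definition smat :: "(nat \<Rightarrow> nat \<Rightarrow> 'a) \<Rightarrow> ('a, 'p::finite) smat"
  is "\<lambda>f. mat CARD('p) CARD('p) (\<lambda>(i, j). f i j)" by simp

lift_definition smat_nth :: "('a, 'p::finite) smat \<Rightarrow> nat \<Rightarrow> nat \<Rightarrow> 'a"
  is "\<lambda>A i j. A $$ (i, j)" .

lift_definition map_smat :: "('a \<Rightarrow> 'b) \<Rightarrow> ('a, 'p::finite) smat \<Rightarrow> ('b, 'p) smat"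
  is map_mat by simp

instantiation smat :: (complex_algebra_1, finite) complex_algebra_1
begin

lift_definition zero_smat :: "('a, 'b) smat" is "0\<^sub>m CARD('b) CARD('b)" by simp
lift_definition one_smat :: "('a, 'b) smat" is "1\<^sub>m CARD('b)" by simp
lift_definition plus_smat :: "('a, 'b) smat \<Rightarrow> ('a, 'b) smat \<Rightarrow> ('a, 'b) smat" is "(+)" by simp
lift_definition minus_smat :: "('a, 'b) smat \<Rightarrow> ('a, 'b) smat \<Rightarrow> ('a, 'b) smat" is "(-)"
  by (simp add: minus_carrier_mat)
lift_definition uminus_smat :: "('a, 'b) smat \<Rightarrow> ('a, 'b) smat" is uminus by simp
lift_definition times_smat :: "('a, 'b) smat \<Rightarrow> ('a, 'b) smat \<Rightarrow> ('a, 'b) smat" is "(*)" by simp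
lift_definition scaleC_smat :: "complex \<Rightarrow> ('a, 'b) smat \<Rightarrow> ('a, 'b) smat"
  is "\<lambda>c. map_mat (scaleC c)" by simp

instance
proof
  fix A B C :: "('a, 'b) smat" and c d :: complex
  show "A + B + C = A + (B + C)" by transfer (rule assoc_add_mat)
  show "A + B = B + A" by transfer (rule comm_add_mat)
  show "0 + A = A" by transfer simp
  show "- A + A = 0" by transfer simp
  show "A - B = A + - B" by transfer (rule minus_add_uminus_mat)
  show "A * B * C = A * (B * C)" by transfer (rule assoc_mult_mat)
  show "1 * A = A" by transfer (rule left_mult_one_mat)
  show "A * 1 = A" by transfer (rule right_mult_one_mat)
  show "(A + B) * C = A * C + B * C" by transfer (rule add_mult_distrib_mat)
  show "A * (B + C) = A * B + A * C" by transfer (rule mult_add_distrib_mat)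
  show "(0 :: ('a, 'b) smat) \<noteq> 1"
  proof transfer
    have "(0\<^sub>m CARD('b) CARD('b) :: 'a mat) $$ (0, 0) \<noteq> 1\<^sub>m CARD('b) $$ (0, 0)" by simp
    then show "(0\<^sub>m CARD('b) CARD('b) :: 'a mat) \<noteq> 1\<^sub>m CARD('b)" by metis
  qed
  show "c *\<^sub>C (A + B) = c *\<^sub>C A + c *\<^sub>C B" by transfer (auto simp: scaleC_add_right)
  show "(c + d) *\<^sub>C A = c *\<^sub>C A + d *\<^sub>C A" by transfer (auto simp: scaleC_add_left)
  show "c *\<^sub>C d *\<^sub>C A = (c * d) *\<^sub>C A" by transfer (auto simp: scaleC_scaleC)
  show "1 *\<^sub>C A = A" by transfer (auto simp: scaleC_one)
  show "(c *\<^sub>C A) * B = c *\<^sub>C (A * B)"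
    by transfer (auto simp: scalar_prod_def complex_space.scale_sum_right mult_scaleC_left)
  show "A * (c *\<^sub>C B) = c *\<^sub>C (A * B)"
    by transfer (auto simp: scalar_prod_def complex_space.scale_sum_right mult_scaleC_right)
qed

end

text \<open>Matrix indices start at \<open>0\<close> here, so that entry \<open>(i, j)\<close> is the usual entry \<open>(i + 1, j + 1)\<close>.
  In particular \<open>i = n - 1\<close> for the \<open>n\<close> occurring in the entries \<open>D\<^sub>n\<^sub>,\<^sub>n\<^sub>+\<^sub>1\<close>.\<close>

definition mat_Z :: "('a::complex_algebra_1, 'p::finite) smat" where
  "mat_Z = smat (\<lambda>i j. if i = j + 1 then 1 else 0)"

definition mat_D :: "('a::complex_algebra_1, 'p::finite) smat" where
  "mat_D = smat (\<lambda>i j. if j = i + 1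
     then ((\<qq> TYPE('p) - inverse (\<qq> TYPE('p))) * inverse (\<qq> TYPE('p)) ^ i * qint TYPE('p) (i + 1)) *\<^sub>C 1
     else 0)"

definition mat_lam :: "('p lam_poly, 'p::finite) smat" where
  "mat_lam = smat (\<lambda>i j. if i = j then lam else 0)"

text \<open>The generator formulas below determine the whole action and coaction, since \<open>E\<close>, \<open>K\<close>, \<open>F\<close>
  generate the quantum group and \<open>Z\<close>, \<open>D\<close>, \<open>\<lambda>\<close> generate the matrix algebra.\<close>

definition is_uq_action :: "('p::finite uq \<Rightarrow> ('p lam_poly, 'p) smat \<Rightarrow> ('p lam_poly, 'p) smat) \<Rightarrow> bool" where
  "is_uq_action act \<longleftrightarrow> is_module_action act \<and>
    (let q = \<qq> TYPE('p); c = inverse (q - inverse q) in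
     \<forall>X. act uq_K X = smat (\<lambda>i j. (q powi (2 * (int i - int j))) *\<^sub>C lam_shift (smat_nth X i j)) \<and>
         act uq_E X = c *\<^sub>C (X * mat_Z - mat_Z * act uq_K X) \<and>
         act uq_F X = c *\<^sub>C (mat_D * X - act uq_Kinv X * mat_D))"

definition is_uq_coaction :: "(('p lam_poly, 'p) smat \<Rightarrow> ('p::finite uq, ('p lam_poly, 'p) smat) tensor) \<Rightarrow> bool" where
  "is_uq_coaction \<delta> \<longleftrightarrow> algebra_hom \<delta> \<and>
    (let q = \<qq> TYPE('p) in
     \<delta> mat_lam = 1 \<otimes>\<^sub>t mat_lam \<and>
     \<delta> mat_Z = uq_Kinv \<otimes>\<^sub>t mat_Z - (q - inverse q) *\<^sub>C ((uq_E * uq_Kinv) \<otimes>\<^sub>t 1) \<and>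
     \<delta> mat_D = uq_Kinv \<otimes>\<^sub>t mat_D + (q - inverse q) *\<^sub>C (uq_F \<otimes>\<^sub>t 1))"

definition const_mat :: "(complex, 'p::finite) smat \<Rightarrow> ('p lam_poly, 'p) smat" where
  "const_mat = map_smat (\<lambda>c. c *\<^sub>C 1)"

end

theory Submission
  imports Defs "HOL-Analysis.Complex_Transcendental"
begin

text \<open>
  Braided commutativity with \<open>y = Z\<close> and \<open>y = D\<close> is a restatement of the formulas for \<open>E\<close> and \<open>F\<close>, so
  it extends multiplicatively from the generators, as do all the other axioms. What remains is that
  action and coaction are well defined. The relations \<open>E\<^sup>p = F\<^sup>p = 0\<close> (and \<open>\<delta>(Z)\<^sup>p = \<delta>(D)\<^sup>p = 0\<close>) hold because
  the two summands \<open>a\<close>, \<open>b\<close> satisfy \<open>b a = q\<^sup>2 a b\<close>, and at a primitive \<open>p\<close>-th root of unity the quantum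
  binomial formula collapses to \<open>(a + b)\<^sup>p = a\<^sup>p + b\<^sup>p\<close>. The coaction exists because \<open>Mat\<^sub>p\<close> is presented by
  \<open>Z\<^sup>p = D\<^sup>p = 0\<close> and \<open>D Z = q\<^sup>-\<^sup>2 Z D + (q - q\<^sup>-\<^sup>1)\<close>: from any such pair the matrix units are recovered as
  \<open>z\<^sup>i \<pi> d\<^sup>j\<close> with \<open>\<pi> = \<Sum> c\<^sub>k z\<^sup>k d\<^sup>k\<close> chosen so that \<open>d \<pi> = 0\<close>. The argument works for coefficients in
  a commutative algebra with an automorphism \<open>\<sigma>\<close>, which is \<open>\<lambda> \<mapsto> q\<^sup>-\<^sup>1 \<lambda>\<close> for \<open>\<complex>\<^sub>2\<^sub>p[\<lambda>]\<close> and
  the identity for the constant matrices.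
\<close>

section \<open>Linear maps and algebra homomorphisms\<close>

text \<open>No basis or normal form of the quantum group is ever computed. Every map out of it is a
  homomorphism given by generators and relations into a suitable target: the tensor square for
  \<Delta>, the endomorphisms of the matrix algebra for the action, right multiplications for the
  antipode. Agreement on generators is what makes the \<open>THE\<close> definitions meaningful. The
  axioms are of two kinds. Coassociativity and the counit laws equate algebra homomorphisms, so
  generators suffice. The antipode laws, the module algebra law, the Yetter--Drinfeld condition and
  braided commutativity do not have this form. There \<Delta>(h) or \<delta>(y) is replaced by an
  arbitrary tensor t, and one determines how multiplying t from the left by \<Delta>(g) or
  \<delta>(g), for a generator g, affects each side. Such steps only multiply from the left, and so
  both algebras get an induction rule over left multiplication by generators.\<close>

lemma algebra_homI:
  assumes "clinear f" "f 1 = 1" "\<And>x y. f (x * y) = f x * f y"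
  shows "algebra_hom f"
  using assms by (simp add: algebra_hom_def)

lemma algebra_homD:
  assumes "algebra_hom f"
  shows "clinear f" "f 1 = 1" "f (x * y) = f x * f y"
  using assms by (auto simp: algebra_hom_def)

lemma cbilinearI:
  assumes "\<And>x x' y. f (x + x') y = f x y + f x' y" "\<And>x y y'. f x (y + y') = f x y + f x y'"
    and "\<And>c x y. f (c *\<^sub>C x) y = c *\<^sub>C f x y" "\<And>c x y. f x (c *\<^sub>C y) = c *\<^sub>C f x y"
  shows "cbilinear f"
  unfolding cbilinear_def by (intro conjI allI clinearI) (simp_all add: assms)

lemma cbilinearD:
  assumes "cbilinear f"
  shows "f (x + x') y = f x y + f x' y" "f x (y + y') = f x y + f x y'"
    "f (c *\<^sub>C x) y = c *\<^sub>C f x y" "f x (c *\<^sub>C y) = c *\<^sub>C f x y"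
    "f (x - x') y = f x y - f x' y" "f x (y - y') = f x y - f x y'" "f 0 y = 0" "f x 0 = 0"
  using assms clinear_add[of "\<lambda>x. f x y"] clinear_add[of "f x"] clinear_scale[of "\<lambda>x. f x y"]
    clinear_scale[of "f x"] clinear_diff[of "\<lambda>x. f x y"] clinear_diff[of "f x"]
    clinear_zero[of "\<lambda>x. f x y"] clinear_zero[of "f x"]
  by (auto simp: cbilinear_def)

lemma cbilinear_times: "cbilinear ((*) :: 'a::complex_algebra_1 \<Rightarrow> _)"
  by (rule cbilinearI) (simp_all add: distrib_left distrib_right mult_scaleC_left mult_scaleC_right)

lemmas alg_simps = scaleC_add_right scaleC_add_left complex_space.scale_right_diff_distrib
  complex_space.scale_left_diff_distrib complex_space.scale_zero_left complex_space.scale_zero_right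
  cbilinearD[OF cbilinear_times]
  cbilinearD[OF cbilinear_tensor] scaleC_scaleC scaleC_one tensor_mult

lemma clinear_id: "clinear (\<lambda>x. x)"
  by (rule clinearI) auto

lemma clinear_comp: "clinear f \<Longrightarrow> clinear g \<Longrightarrow> clinear (\<lambda>x. g (f x))"
  by (rule clinearI) (simp_all add: clinear_add clinear_scale)

lemma clinear_plus: "clinear f \<Longrightarrow> clinear g \<Longrightarrow> clinear (\<lambda>x. f x + g x)"
  by (rule clinearI) (simp_all add: clinear_add clinear_scale alg_simps)

lemma clinear_minus: "clinear f \<Longrightarrow> clinear g \<Longrightarrow> clinear (\<lambda>x. f x - g x)"
  by (rule clinearI) (simp_all add: clinear_add clinear_scale alg_simps)

lemma clinear_scaleC: "clinear f \<Longrightarrow> clinear (\<lambda>x. c *\<^sub>C f x)"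
  by (rule clinearI) (simp_all add: clinear_add clinear_scale alg_simps mult.commute)

lemma clinear_mult_left: "clinear f \<Longrightarrow> clinear (\<lambda>x. a * f x)" for a :: "'a::complex_algebra_1"
  by (rule clinearI) (simp_all add: clinear_add clinear_scale alg_simps)

lemma clinear_mult_right: "clinear f \<Longrightarrow> clinear (\<lambda>x. f x * a)" for a :: "'a::complex_algebra_1"
  by (rule clinearI) (simp_all add: clinear_add clinear_scale alg_simps)

lemma clinear_cbilinear1: "cbilinear f \<Longrightarrow> clinear g \<Longrightarrow> clinear (\<lambda>x. f (g x) y)"
  by (rule clinearI) (simp_all add: clinear_add clinear_scale cbilinearD)

lemma clinear_cbilinear2: "cbilinear f \<Longrightarrow> clinear g \<Longrightarrow> clinear (\<lambda>x. f y (g x))"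
  by (rule clinearI) (simp_all add: clinear_add clinear_scale cbilinearD)

lemma clinear_sum_apply: "clinear f \<Longrightarrow> f (\<Sum>i\<in>A. g i) = (\<Sum>i\<in>A. f (g i))"
  by (induction A rule: infinite_finite_induct) (simp_all add: clinear_zero clinear_add)

lemma algebra_hom_id: "algebra_hom (\<lambda>x. x)" "algebra_hom id"
  by (auto intro!: algebra_homI clinearI)

lemma algebra_hom_comp: "algebra_hom f \<Longrightarrow> algebra_hom g \<Longrightarrow> algebra_hom (\<lambda>x. g (f x))"
  by (rule algebra_homI) (simp_all add: algebra_homD clinear_comp)

lemma algebra_hom_scalar: "algebra_hom (\<lambda>c. c *\<^sub>C 1)"
  by (rule algebra_homI) (auto intro!: clinearI simp: alg_simps scaleC_complex_def)

section \<open>Tensor products\<close>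

text \<open>Pure tensors span. Tensors have no canonical expansion, so nearly every identity between
  them below is reduced to this.\<close>

lemma clinear_tensor_ext:
  assumes "clinear f" "clinear g" "\<And>x y. f (x \<otimes>\<^sub>t y) = g (x \<otimes>\<^sub>t y)"
  shows "f t = g t"
  by (induction t rule: tensor_induct) (simp_all add: assms(3) clinear_add[OF assms(1)] clinear_add[OF assms(2)])

lemma clinear_tensor_ext3:
  assumes "clinear f" "clinear g" "\<And>x y z. f ((x \<otimes>\<^sub>t y) \<otimes>\<^sub>t z) = g ((x \<otimes>\<^sub>t y) \<otimes>\<^sub>t z)"
  shows "f t = g t"
proof (rule clinear_tensor_ext[OF assms(1,2)])
  fix s z
  show "f (s \<otimes>\<^sub>t z) = g (s \<otimes>\<^sub>t z)"
    by (rule clinear_tensor_ext[where t = s])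
      (intro clinear_comp[OF _ assms(1)] clinear_comp[OF _ assms(2)]
        clinear_cbilinear1[OF cbilinear_tensor] clinear_id assms(3))+
qed

lemma tensor_lift_simps:
  assumes "cbilinear f"
  shows "tensor_lift f (s + t) = tensor_lift f s + tensor_lift f t"
    "tensor_lift f (s - t) = tensor_lift f s - tensor_lift f t"
    "tensor_lift f (c *\<^sub>C t) = c *\<^sub>C tensor_lift f t"
    "tensor_lift f 0 = 0"
    "tensor_lift f (x \<otimes>\<^sub>t y) = f x y"
  using clinear_tensor_lift[OF assms]
  by (simp_all add: clinear_add clinear_diff clinear_scale clinear_zero tensor_lift_tensor[OF assms])

lemma cbilinear_tensor_map:
  assumes "clinear f" "clinear g"
  shows "cbilinear (\<lambda>x y. f x \<otimes>\<^sub>t g y)"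
  by (rule cbilinearI) (simp_all add: alg_simps clinear_add[OF assms(1)] clinear_add[OF assms(2)]
    clinear_scale[OF assms(1)] clinear_scale[OF assms(2)])

lemma tensor_map_tensor: "clinear f \<Longrightarrow> clinear g \<Longrightarrow> tensor_map f g (x \<otimes>\<^sub>t y) = f x \<otimes>\<^sub>t g y"
  unfolding tensor_map_def by (simp add: tensor_lift_tensor cbilinear_tensor_map)

lemma clinear_tensor_map: "clinear f \<Longrightarrow> clinear g \<Longrightarrow> clinear (tensor_map f g)"
  unfolding tensor_map_def by (simp add: clinear_tensor_lift cbilinear_tensor_map)

text \<open>Two rounds of extensionality: the right factor varies while the left one is pure, then
  the left one varies.\<close>

lemma algebra_hom_tensorI:
  assumes "clinear f" "f (1 \<otimes>\<^sub>t 1) = 1"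
    and "\<And>a b c d. f ((a * c) \<otimes>\<^sub>t (b * d)) = f (a \<otimes>\<^sub>t b) * f (c \<otimes>\<^sub>t d)"
  shows "algebra_hom f"
proof (rule algebra_homI)
  show "f 1 = 1" using assms(2) by (simp add: one_tensor_def)
  fix s t
  have 1: "f ((a \<otimes>\<^sub>t b) * t) = f (a \<otimes>\<^sub>t b) * f t" for a b
    by (rule clinear_tensor_ext[where t = t],
      intro clinear_comp[OF _ assms(1)] clinear_mult_left clinear_id, simp_all add: tensor_mult assms(1,3) clinear_mult_left)
  show "f (s * t) = f s * f t"
    by (rule clinear_tensor_ext[where t = s],
      intro clinear_comp[OF _ assms(1)] clinear_mult_right clinear_id, simp_all add: 1 assms(1) clinear_mult_right)
qed (rule assms)

lemma algebra_hom_tensor_map: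
  assumes "algebra_hom f" "algebra_hom g"
  shows "algebra_hom (tensor_map f g)"
  using assms
  by (intro algebra_hom_tensorI)
    (auto simp: tensor_map_tensor clinear_tensor_map tensor_mult one_tensor_def algebra_hom_def)

lemma cbilinear_assoc_inner: "cbilinear (\<lambda>x y. x \<otimes>\<^sub>t (y \<otimes>\<^sub>t z))"
  by (rule cbilinearI) (simp_all add: alg_simps)

text \<open>Linearity in the tensor s comes with \<open>tensor_lift\<close>; linearity in z does
  not, and is proved by induction over s.\<close>

lemma cbilinear_assoc:
  "cbilinear (\<lambda>s (z :: 'c::complex_space). tensor_lift (\<lambda>(x :: 'a::complex_space) (y :: 'b::complex_space). x \<otimes>\<^sub>t (y \<otimes>\<^sub>t z)) s)"
proof -
  define T where "T z = tensor_lift (\<lambda>(x :: 'a) (y :: 'b). x \<otimes>\<^sub>t (y \<otimes>\<^sub>t z))" for z :: 'c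
  have lin: "clinear (T z)" and pure: "T z (x \<otimes>\<^sub>t y) = x \<otimes>\<^sub>t (y \<otimes>\<^sub>t z)" for x y z
    unfolding T_def by (rule clinear_tensor_lift tensor_lift_tensor, rule cbilinear_assoc_inner)+
  have "cbilinear (\<lambda>s z. T z s)"
    unfolding cbilinear_def
  proof (intro conjI allI lin)
    show "clinear (\<lambda>z. T z s)" for s
      by (rule clinearI; induction s rule: tensor_induct)
        (simp_all add: pure clinear_add[OF lin] alg_simps)
  qed
  then show ?thesis by (simp add: T_def)
qed

lemma tensor_assoc_tensor: "tensor_assoc ((x \<otimes>\<^sub>t y) \<otimes>\<^sub>t z) = x \<otimes>\<^sub>t (y \<otimes>\<^sub>t z)"
  unfolding tensor_assoc_def
  by (simp add: tensor_lift_simps[OF cbilinear_assoc] tensor_lift_simps[OF cbilinear_assoc_inner])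

lemma clinear_tensor_assoc: "clinear tensor_assoc"
  unfolding tensor_assoc_def by (rule clinear_tensor_lift[OF cbilinear_assoc])

lemma algebra_hom_tensor_assoc: "algebra_hom tensor_assoc"
proof (rule algebra_homI[OF clinear_tensor_assoc])
  show "tensor_assoc 1 = (1 :: ('a, ('b, 'c) tensor) tensor)"
    by (simp add: one_tensor_def tensor_assoc_tensor)
  fix s t :: "(('a, 'b) tensor, 'c) tensor"
  have 1: "tensor_assoc (((x \<otimes>\<^sub>t y) \<otimes>\<^sub>t z) * t) = tensor_assoc ((x \<otimes>\<^sub>t y) \<otimes>\<^sub>t z) * tensor_assoc t" for x y z
    by (rule clinear_tensor_ext3[where t = t], intro clinear_comp[OF _ clinear_tensor_assoc] clinear_mult_left clinear_id)
      (simp_all add: tensor_mult tensor_assoc_tensor clinear_mult_left clinear_tensor_assoc)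
  show "tensor_assoc (s * t) = tensor_assoc s * tensor_assoc t"
    by (rule clinear_tensor_ext3[where t = s], intro clinear_comp[OF _ clinear_tensor_assoc] clinear_mult_right clinear_id)
      (simp_all add: 1 clinear_mult_right clinear_tensor_assoc)
qed

lemma tensor_power: "(a \<otimes>\<^sub>t b) ^ n = (a ^ n) \<otimes>\<^sub>t (b ^ n)"
  by (induction n) (simp_all add: one_tensor_def tensor_mult)

section \<open>The quantum binomial formula at a root of unity\<close>

lemma power_scaleC: "(c *\<^sub>C x) ^ n = c ^ n *\<^sub>C x ^ n" for x :: "'a::complex_algebra_1"
  by (induction n) (simp_all add: alg_simps)

lemma power_uminus_scaleC: "(- x) ^ n = (-1) ^ n *\<^sub>C x ^ n" for x :: "'a::complex_algebra_1"
  using power_scaleC[of "-1" x n] by (simp add: scaleC_one)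

lemma scale_commute_power:
  fixes a b :: "'a::complex_algebra_1"
  assumes "b * a = c *\<^sub>C (a * b)"
  shows "b * a ^ n = c ^ n *\<^sub>C (a ^ n * b)"
proof (induction n)
  case (Suc n)
  have "b * a ^ Suc n = (b * a) * a ^ n" by (simp add: mult.assoc)
  also have "\<dots> = c *\<^sub>C (a * (b * a ^ n))" by (simp add: assms alg_simps mult.assoc)
  also have "\<dots> = c ^ Suc n *\<^sub>C (a ^ Suc n * b)" by (simp add: Suc alg_simps mult.assoc)
  finally show ?case .
qed (simp add: alg_simps)

text \<open>The scalar is c^(n(n-1)/2). It stays existential because only the vanishing of (a b)^n
  for nilpotent a or b matters.\<close>

lemma scale_commute_power_mult:
  fixes a b :: "'a::complex_algebra_1"
  assumes "b * a = c *\<^sub>C (a * b)"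
  shows "\<exists>d. (a * b) ^ n = d *\<^sub>C (a ^ n * b ^ n)"
proof (induction n)
  case (Suc n)
  then obtain d where d: "(a * b) ^ n = d *\<^sub>C (a ^ n * b ^ n)" by blast
  have "(a * b) ^ Suc n = d *\<^sub>C (a * (b * a ^ n) * b ^ n)" by (simp add: d alg_simps mult.assoc)
  also have "\<dots> = (d * c ^ n) *\<^sub>C (a ^ Suc n * b ^ Suc n)"
    by (simp add: scale_commute_power[OF assms] alg_simps mult.assoc power_commutes)
  finally show ?case by blast
qed (auto simp: alg_simps intro: exI[of _ 1])

text \<open>Pascal's recursion serves as definition because the quotient of q-factorials degenerates
  to 0/0 at a root of unity, already for n = p and k = 0.\<close>

fun gauss_binomial :: "complex \<Rightarrow> nat \<Rightarrow> nat \<Rightarrow> complex" where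
  "gauss_binomial w n 0 = 1"
| "gauss_binomial w 0 (Suc k) = 0"
| "gauss_binomial w (Suc n) (Suc k) = gauss_binomial w n k + w ^ Suc k * gauss_binomial w n (Suc k)"

lemma gauss_binomial_gt: "n < k \<Longrightarrow> gauss_binomial w n k = 0"
proof (induction n arbitrary: k)
  case 0 then show ?case by (cases k) auto
next
  case (Suc n) then show ?case by (cases k) auto
qed

lemma gauss_binomial_n_n: "gauss_binomial w n n = 1"
  by (induction n) (auto simp: gauss_binomial_gt)

text \<open>The q-Pochhammer symbol (w;w)_n.\<close>

definition qfact :: "complex \<Rightarrow> nat \<Rightarrow> complex" where
  "qfact w n = (\<Prod>i<n. 1 - w ^ Suc i)"

lemma qfact_0: "qfact w 0 = 1" and qfact_Suc: "qfact w (Suc n) = qfact w n * (1 - w ^ Suc n)"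
  by (simp_all add: qfact_def)

text \<open>The factorial formula without division, so that it survives at roots of unity. Pascal's
  rule together with (1 - w^k) + w^k (1 - w^m) = 1 - w^(k+m) drives the induction on k + m.\<close>

lemma gauss_binomial_qfact:
  "gauss_binomial w (k + m) k * qfact w k * qfact w m = qfact w (k + m)"
proof (induction "k + m" arbitrary: k m)
  case 0
  then show ?case by (simp add: qfact_0)
next
  case (Suc n)
  show ?case
  proof (cases k)
    case 0
    then show ?thesis by (simp add: qfact_0)
  next
    case k: (Suc k')
    show ?thesis
    proof (cases m)
      case 0
      then show ?thesis by (simp add: qfact_0 gauss_binomial_n_n)
    next
      case m: (Suc m')
      have 1: "gauss_binomial w (k' + Suc m') k' * qfact w k' * qfact w (Suc m') = qfact w (k' + Suc m')"
        using Suc k m by (intro Suc(1)) auto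
      have 2: "gauss_binomial w (Suc k' + m') (Suc k') * qfact w (Suc k') * qfact w m' = qfact w (Suc k' + m')"
        using Suc k m by (intro Suc(1)) auto
      \<comment> \<open>A and B stand for the two smaller binomials, P and Q for the factorials of
        k' and m', W for w^k and V for w^m.\<close>
      have alg: "(A + W * B) * (P * (1 - W)) * (Q * (1 - V)) =
          (A * P * (Q * (1 - V))) * (1 - W) + W * ((B * (P * (1 - W)) * Q) * (1 - V))" for A B P Q V W :: complex
        by (simp add: algebra_simps)
      have "gauss_binomial w (k + m) k =
          gauss_binomial w (k' + Suc m') k' + w ^ Suc k' * gauss_binomial w (Suc k' + m') (Suc k')"
        by (simp add: k m)
      moreover have "qfact w k = qfact w k' * (1 - w ^ Suc k')" "qfact w m = qfact w m' * (1 - w ^ Suc m')"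
        unfolding k m by (rule qfact_Suc)+
      ultimately have "gauss_binomial w (k + m) k * qfact w k * qfact w m =
          (gauss_binomial w (k' + Suc m') k' * qfact w k' * qfact w (Suc m')) * (1 - w ^ Suc k') +
          w ^ Suc k' * ((gauss_binomial w (Suc k' + m') (Suc k') * qfact w (Suc k') * qfact w m') * (1 - w ^ Suc m'))"
        unfolding qfact_Suc[of w k'] qfact_Suc[of w m'] by (simp only: alg)
      also have "\<dots> = qfact w (k' + Suc m') * ((1 - w ^ Suc k') + w ^ Suc k' * (1 - w ^ Suc m'))"
        unfolding 1 2 by (simp add: algebra_simps)
      also have "(1 - w ^ Suc k') + w ^ Suc k' * (1 - w ^ Suc m') = 1 - w ^ (k + m)"
        unfolding k m power_add by (simp only: right_diff_distrib mult_1_right) simp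
      also have "qfact w (k' + Suc m') * (1 - w ^ (k + m)) = qfact w (k + m)"
        by (simp add: k m qfact_Suc)
      finally show ?thesis .
    qed
  qed
qed

text \<open>Multiply by a + b from the left: moving b past a^k costs w^k, which is the weight in
  Pascal's rule.\<close>

lemma quantum_binomial:
  fixes a b :: "'a::complex_algebra_1"
  assumes "b * a = w *\<^sub>C (a * b)"
  shows "(a + b) ^ n = (\<Sum>k\<le>n. gauss_binomial w n k *\<^sub>C (a ^ k * b ^ (n - k)))"
proof (induction n)
  case 0
  then show ?case by (simp add: scaleC_one)
next
  case (Suc n)
  let ?g = "gauss_binomial w"
  have "b * (\<Sum>k\<le>n. ?g n k *\<^sub>C (a ^ k * b ^ (n - k))) = (\<Sum>k\<le>n. (w ^ k * ?g n k) *\<^sub>C (a ^ k * b ^ (Suc n - k)))"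
    unfolding sum_distrib_left
  proof (rule sum.cong, simp)
    fix k assume k: "k \<in> {..n}"
    have "b * (?g n k *\<^sub>C (a ^ k * b ^ (n - k))) = ?g n k *\<^sub>C ((b * a ^ k) * b ^ (n - k))"
      by (simp add: alg_simps mult.assoc)
    also have "\<dots> = (w ^ k * ?g n k) *\<^sub>C (a ^ k * (b * b ^ (n - k)))"
      by (simp add: scale_commute_power[OF assms] alg_simps mult.assoc mult.commute)
    also have "b * b ^ (n - k) = b ^ (Suc n - k)"
      using k by (simp add: Suc_diff_le)
    finally show "b * (?g n k *\<^sub>C (a ^ k * b ^ (n - k))) = (w ^ k * ?g n k) *\<^sub>C (a ^ k * b ^ (Suc n - k))" .
  qed
  also have "\<dots> = (\<Sum>k\<le>Suc n. (w ^ k * ?g n k) *\<^sub>C (a ^ k * b ^ (Suc n - k)))"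
    by (simp add: gauss_binomial_gt)
  also have "\<dots> = b ^ Suc n + (\<Sum>k\<le>n. (w ^ Suc k * ?g n (Suc k)) *\<^sub>C (a ^ Suc k * b ^ (n - k)))"
    by (subst sum.atMost_Suc_shift) (simp add: scaleC_one)
  finally have b: "b * (\<Sum>k\<le>n. ?g n k *\<^sub>C (a ^ k * b ^ (n - k))) = \<dots>" .
  have "a * (\<Sum>k\<le>n. ?g n k *\<^sub>C (a ^ k * b ^ (n - k))) = (\<Sum>k\<le>n. ?g n k *\<^sub>C (a ^ Suc k * b ^ (n - k)))"
    by (simp add: sum_distrib_left alg_simps mult.assoc)
  with b have "(a + b) ^ Suc n =
     b ^ Suc n + (\<Sum>k\<le>n. ?g (Suc n) (Suc k) *\<^sub>C (a ^ Suc k * b ^ (n - k)))"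
    by (simp add: Suc distrib_right scaleC_add_left sum.distrib add_ac)
  also have "\<dots> = (\<Sum>k\<le>Suc n. ?g (Suc n) k *\<^sub>C (a ^ k * b ^ (Suc n - k)))"
    by (subst sum.atMost_Suc_shift) (simp add: scaleC_one)
  finally show ?case .
qed

text \<open>For 0 < k < n the factorial of n vanishes because w^n = 1, while those of k and n - k do
  not. So the k-th Gaussian binomial is 0, and only a^n and b^n remain.\<close>

lemma quantum_binomial_nilpotent:
  fixes a b :: "'a::complex_algebra_1"
  assumes ba: "b * a = w *\<^sub>C (a * b)" and "w ^ n = 1" and w: "\<And>k. 0 < k \<Longrightarrow> k < n \<Longrightarrow> w ^ k \<noteq> 1"
    and "a ^ n = 0" "b ^ n = 0"
  shows "(a + b) ^ n = 0"
proof -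
  have "n \<noteq> 0" using assms(4) by (metis power_0 one_neq_zero)
  have "gauss_binomial w n k *\<^sub>C (a ^ k * b ^ (n - k)) = 0" if "k \<le> n" for k
  proof (cases "k = 0 \<or> k = n")
    case True
    then show ?thesis using assms(4,5) by auto
  next
    case False
    with that have k: "0 < k" "k < n" by auto
    have nz: "qfact w m \<noteq> 0" if "m < n" for m
      using that w by (auto simp: qfact_def simp del: power_Suc) 
    obtain n' where n': "n = Suc n'" using \<open>n \<noteq> 0\<close> by (cases n) auto
    have "qfact w n = 0" using \<open>w ^ n = 1\<close> unfolding n' qfact_Suc by simp
    with gauss_binomial_qfact[of w k "n - k"] k nz[of k] nz[of "n - k"] show ?thesis
      by simp
  qed
  then show ?thesis
    unfolding quantum_binomial[OF ba] by (intro sum.neutral) blast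
qed

section \<open>The algebra of linear endomorphisms\<close>

text \<open>A type of its own, so that endomorphisms are an instance of
  \<open>complex_algebra_1\<close> and a module structure becomes a homomorphism into it. The
  instance below asks for an algebra as underlying space because 0 \<noteq> 1 needs a nonzero
  space.\<close>

typedef (overloaded) 'x endo = "{f :: 'x::complex_space \<Rightarrow> 'x. clinear f}"
  morphisms endo_apply Endo
  using clinear_id by auto

setup_lifting type_definition_endo

instantiation endo :: (complex_algebra_1) complex_algebra_1
begin

lift_definition zero_endo :: "'a endo" is "\<lambda>_. 0" by (rule clinearI) simp_all
lift_definition one_endo :: "'a endo" is "\<lambda>x. x" by (rule clinear_id)
lift_definition plus_endo :: "'a endo \<Rightarrow> 'a endo \<Rightarrow> 'a endo" is "\<lambda>f g x. f x + g x" by (rule clinear_plus)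
lift_definition minus_endo :: "'a endo \<Rightarrow> 'a endo \<Rightarrow> 'a endo" is "\<lambda>f g x. f x - g x" by (rule clinear_minus)
lift_definition uminus_endo :: "'a endo \<Rightarrow> 'a endo" is "\<lambda>f x. - f x"
  by (rule clinearI) (simp_all add: clinear_add clinear_scale)
lift_definition scaleC_endo :: "complex \<Rightarrow> 'a endo \<Rightarrow> 'a endo" is "\<lambda>c f x. c *\<^sub>C f x" by (rule clinear_scaleC)
lift_definition times_endo :: "'a endo \<Rightarrow> 'a endo \<Rightarrow> 'a endo" is "\<lambda>f g x. f (g x)" by (rule clinear_comp)

instance
proof
  show "(0 :: 'a endo) \<noteq> 1"
    by transfer (metis one_neq_zero)
  fix a b c :: "'a endo" and x y :: complex
  show "a * b * c = a * (b * c)" by transfer simp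
  show "1 * a = a" by transfer simp
  show "a * 1 = a" by transfer simp
  show "(a + b) * c = a * c + b * c" by transfer simp
  show "a * (b + c) = a * b + a * c" by transfer (simp add: clinear_add)
  show "x *\<^sub>C (a + b) = x *\<^sub>C a + x *\<^sub>C b" by transfer (simp add: scaleC_add_right)
  show "(x + y) *\<^sub>C a = x *\<^sub>C a + y *\<^sub>C a" by transfer (simp add: scaleC_add_left)
  show "x *\<^sub>C (y *\<^sub>C a) = (x * y) *\<^sub>C a" by transfer (simp add: scaleC_scaleC)
  show "1 *\<^sub>C a = a" by transfer (simp add: scaleC_one)
  show "(x *\<^sub>C a) * b = x *\<^sub>C (a * b)" by transfer simp
  show "a * (x *\<^sub>C b) = x *\<^sub>C (a * b)" by transfer (simp add: clinear_scale)
  show "a + b + c = a + (b + c)" by transfer (simp add: add.assoc)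
  show "a + b = b + a" by transfer (simp add: add.commute)
  show "0 + a = a" by transfer simp
  show "- a + a = 0" by transfer simp
  show "a - b = a + - b" by transfer simp
qed

end

lemma clinear_endo_apply: "clinear (endo_apply f)"
  using endo_apply by auto

lemma endo_eqI: "(\<And>x. endo_apply f x = endo_apply g x) \<Longrightarrow> f = g"
  by transfer auto

lemmas endo_apply_simps = zero_endo.rep_eq one_endo.rep_eq plus_endo.rep_eq minus_endo.rep_eq
  uminus_endo.rep_eq scaleC_endo.rep_eq times_endo.rep_eq

lemma endo_apply_power: "endo_apply (f ^ n) = endo_apply f ^^ n"
  by (induction n) (auto simp: endo_apply_simps fun_eq_iff)

lemma endo_apply_Endo: "clinear f \<Longrightarrow> endo_apply (Endo f) = f"
  by (simp add: Endo_inverse)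

section \<open>The restricted quantum group\<close>

text \<open>The exponential is 1 exactly on the multiples of 2 pi i, so q is a primitive 2p-th root
  of unity.\<close>

lemma qq_power_eq_1_iff: "\<qq> TYPE('p::finite) ^ n = 1 \<longleftrightarrow> 2 * CARD('p) dvd n"
proof -
  have "\<qq> TYPE('p) ^ n = exp (of_nat n * (\<i> * of_real pi / of_nat CARD('p)))"
    by (simp add: \<qq>_def flip: exp_of_nat_mult)
  also have "\<dots> = 1 \<longleftrightarrow> (\<exists>k::int. of_nat n * pi / of_nat CARD('p) = of_int (2 * k) * pi)"
    by (subst exp_eq_1) simp
  also have "\<dots> \<longleftrightarrow> (\<exists>k::int. int n = int (2 * CARD('p)) * k)"
  proof (rule ex_cong1)
    fix k :: int
    have "of_nat n * pi / of_nat CARD('p) = of_int (2 * k) * pi \<longleftrightarrow>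
      real n = of_int (2 * k) * real CARD('p)"
      by (simp add: field_simps)
    also have "\<dots> \<longleftrightarrow> real_of_int (int n) = real_of_int (int (2 * CARD('p)) * k)"
      by (simp add: mult_ac)
    also have "\<dots> \<longleftrightarrow> int n = int (2 * CARD('p)) * k"
      by (rule of_int_eq_iff)
    finally show "of_nat n * pi / of_nat CARD('p) = of_int (2 * k) * pi \<longleftrightarrow> int n = int (2 * CARD('p)) * k" .
  qed
  also have "\<dots> \<longleftrightarrow> int (2 * CARD('p)) dvd int n"
    by (simp add: dvd_def)
  also have "\<dots> \<longleftrightarrow> 2 * CARD('p) dvd n"
    by (rule int_dvd_int_iff)
  finally show ?thesis .
qed

text \<open>q^2 is a primitive p-th root of unity, which is what
  \<open>quantum_binomial_nilpotent\<close> asks for at n = p.\<close>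

lemma qq_square_power_eq_1_iff: "(\<qq> TYPE('p::finite))\<^sup>2 ^ n = 1 \<longleftrightarrow> CARD('p) dvd n"
  by (simp add: qq_power_eq_1_iff flip: power_mult)

lemma qq_inverse_square_power_eq_1_iff: "(inverse (\<qq> TYPE('p::finite)))\<^sup>2 ^ n = 1 \<longleftrightarrow> CARD('p) dvd n"
  using qq_square_power_eq_1_iff[where 'p='p, of n] by (simp add: power_inverse)

lemma qq_diff_nonzero:
  assumes "CARD('p::finite) \<ge> 2"
  shows "\<qq> TYPE('p) - inverse (\<qq> TYPE('p)) \<noteq> 0"
proof
  assume "\<qq> TYPE('p) - inverse (\<qq> TYPE('p)) = 0"
  then have "\<qq> TYPE('p) * \<qq> TYPE('p) = 1"
    by (simp add: field_simps)
  then have "\<qq> TYPE('p) ^ 2 = 1"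
    by (simp add: power2_eq_square)
  with assms show False
    by (auto simp: qq_power_eq_1_iff dest: dvd_imp_le)
qed

text \<open>The defining relations cleared of conjugation: both become commutation rules with the
  same scalar q^2, which is why f stands to the left of k in the second one.\<close>

definition uq_rep :: "'p::finite itself \<Rightarrow> 'a::complex_algebra_1 \<Rightarrow> 'a \<Rightarrow> 'a \<Rightarrow> bool" where
  "uq_rep p e k f \<longleftrightarrow> k ^ (2 * CARD('p)) = 1 \<and>
     k * e = (\<qq> p)\<^sup>2 *\<^sub>C (e * k) \<and> f * k = (\<qq> p)\<^sup>2 *\<^sub>C (k * f) \<and>
     e * f - f * e = inverse (\<qq> p - inverse (\<qq> p)) *\<^sub>C (k - k ^ (2 * CARD('p) - 1)) \<and>
     e ^ CARD('p) = 0 \<and> f ^ CARD('p) = 0"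

lemma power_card_inverse:
  fixes k :: "'a::monoid_mult"
  assumes "k ^ (2 * CARD('p::finite)) = 1"
  shows "k * k ^ (2 * CARD('p) - 1) = 1" "k ^ (2 * CARD('p) - 1) * k = 1"
proof -
  have "k ^ (2 * CARD('p)) = k ^ Suc (2 * CARD('p) - 1)"
    by (rule arg_cong[where f = "\<lambda>n. k ^ n"]) (use zero_less_card_finite[where 'a='p] in simp)
  with assms show "k * k ^ (2 * CARD('p) - 1) = 1" by (simp only: power_Suc)
  then show "k ^ (2 * CARD('p) - 1) * k = 1" by (simp only: power_commutes)
qed

text \<open>Lets a concretely given inverse replace the power k^(2p-1) in the relations.\<close>

lemma power_card_inverse_unique:
  fixes k :: "'a::monoid_mult"
  assumes "k ^ (2 * CARD('p::finite)) = 1" "k * k' = 1"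
  shows "k ^ (2 * CARD('p) - 1) = k'"
proof -
  have "k ^ (2 * CARD('p) - 1) = k ^ (2 * CARD('p) - 1) * (k * k')"
    by (simp only: assms(2) mult_1_right)
  also have "\<dots> = k'"
    by (simp only: mult.assoc[symmetric] power_card_inverse(2)[OF assms(1)] mult_1_left)
  finally show ?thesis .
qed

section \<open>The universal property of the quantum group\<close>

definition uq_lift :: "'a::complex_algebra_1 \<Rightarrow> 'a \<Rightarrow> 'a \<Rightarrow> 'p::finite uq \<Rightarrow> 'a" where
  "uq_lift e k f x = free_eval (case_uq_gen e k f) (rep_uq x)"

text \<open>Evaluation kills the relations, hence the ideal they generate; so the representative
  chosen in \<open>uq_lift\<close> is immaterial.\<close>

lemma uq_lift_abs:
  assumes "uq_rep TYPE('p::finite) e k f"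
  shows "uq_lift e k f (abs_uq r :: 'p uq) = free_eval (case_uq_gen e k f) r"
proof -
  let ?h = "free_eval (case_uq_gen e k f)"
  let ?q = "\<qq> TYPE('p)" and ?k' = "k ^ (2 * CARD('p) - 1)"
  have hom: "algebra_hom ?h" by (rule algebra_hom_free_eval)
  note [simp] = algebra_homD[OF hom] clinear_diff[OF algebra_homD(1)[OF hom]]
    clinear_scale[OF algebra_homD(1)[OF hom]] algebra_hom_power[OF hom]
  have k: "k ^ (2 * CARD('p)) = 1" and ke: "k * e = ?q\<^sup>2 *\<^sub>C (e * k)" and fk: "f * k = ?q\<^sup>2 *\<^sub>C (k * f)"
    and rest: "e * f - f * e = inverse (?q - inverse ?q) *\<^sub>C (k - ?k')" "e ^ CARD('p) = 0" "f ^ CARD('p) = 0"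
    using assms by (auto simp: uq_rep_def)
  have kk: "k * ?k' = 1" by (rule power_card_inverse[OF k])
  have "k * e * ?k' = ?q\<^sup>2 *\<^sub>C e"
    by (simp only: ke mult_scaleC_left mult.assoc kk mult_1_right)
  moreover have "k * f * ?k' = (inverse ?q)\<^sup>2 *\<^sub>C f"
  proof -
    have "k * f = (inverse ?q)\<^sup>2 *\<^sub>C (f * k)"
      by (simp add: fk scaleC_scaleC scaleC_one field_simps)
    then show ?thesis by (simp only: mult_scaleC_left mult.assoc kk mult_1_right)
  qed
  ultimately have rel: "?h r = 0" if "r \<in> uq_relations TYPE('p)" for r
    using that rest k unfolding uq_relations_def Let_def by auto
  have "rep_uq (abs_uq r :: 'p uq) - r \<in> two_sided_ideal (uq_relations TYPE('p))"
    by (rule Quotient3_rep_abs[OF Quotient3_uq]) (simp add: two_sided_ideal_def complex_space.span_zero)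
  from algebra_hom_ideal[OF hom rel this] show ?thesis
    by (simp add: uq_lift_def)
qed

lemma uq_abs_cases: obtains r where "x = abs_uq r"
  using Quotient3_abs_rep[OF Quotient3_uq, of x] by metis

lemma uq_lift:
  assumes "uq_rep TYPE('p::finite) e k f"
  shows "algebra_hom (uq_lift e k f :: 'p uq \<Rightarrow> _)"
    "uq_lift e k f (uq_E :: 'p uq) = e" "uq_lift e k f (uq_K :: 'p uq) = k" "uq_lift e k f (uq_F :: 'p uq) = f"
proof -
  let ?h = "free_eval (case_uq_gen e k f)"
  have hom: "algebra_hom ?h" by (rule algebra_hom_free_eval)
  note [simp] = uq_lift_abs[OF assms] algebra_homD[OF hom] clinear_add[OF algebra_homD(1)[OF hom]]
    clinear_scale[OF algebra_homD(1)[OF hom]]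
  show "algebra_hom (uq_lift e k f :: 'p uq \<Rightarrow> _)"
  proof (intro algebra_homI clinearI)
    fix x y :: "'p uq" and c
    obtain r s where [simp]: "x = abs_uq r" "y = abs_uq s" by (metis uq_abs_cases)
    show "uq_lift e k f (x + y) = uq_lift e k f x + uq_lift e k f y"
      by (simp add: plus_uq.abs_eq)
    show "uq_lift e k f (x * y) = uq_lift e k f x * uq_lift e k f y"
      by (simp add: times_uq.abs_eq)
    show "uq_lift e k f (c *\<^sub>C x) = c *\<^sub>C uq_lift e k f x"
      by (simp add: scaleC_uq.abs_eq)
    show "uq_lift e k f (1 :: 'p uq) = 1"
      by (simp add: one_uq.abs_eq)
  qed
  show "uq_lift e k f (uq_E :: 'p uq) = e" "uq_lift e k f (uq_K :: 'p uq) = k" "uq_lift e k f (uq_F :: 'p uq) = f"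
    by (simp_all add: uq_E.abs_eq uq_K.abs_eq uq_F.abs_eq)
qed

text \<open>Words span, and each word arises from 1 by left multiplication with generators. There is
  no case for general products: a property only has to be stable under left multiplication by E, K
  and F.\<close>

lemma uq_induct [case_names one add scale E K F]:
  fixes x :: "'p::finite uq"
  assumes "P 1" "\<And>x y. P x \<Longrightarrow> P y \<Longrightarrow> P (x + y)" "\<And>c x. P x \<Longrightarrow> P (c *\<^sub>C x)"
    and E: "\<And>x. P x \<Longrightarrow> P (uq_E * x)" and K: "\<And>x. P x \<Longrightarrow> P (uq_K * x)" and F: "\<And>x. P x \<Longrightarrow> P (uq_F * x)"
  shows "P x"
proof -
  have word: "P (abs_uq (Poly_Mapping.single (Word w) 1))" for w
  proof (induction w)
    case Nil
    then show ?case using assms(1) by (simp add: one_uq.abs_eq zero_word_def flip: single_one)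
  next
    case (Cons g w)
    have "Poly_Mapping.single (Word (g # w)) (1::complex) = free_gen g * Poly_Mapping.single (Word w) 1"
      by (simp add: free_gen_def mult_single plus_word_def)
    then have "abs_uq (Poly_Mapping.single (Word (g # w)) 1) =
        abs_uq (free_gen g) * (abs_uq (Poly_Mapping.single (Word w) 1) :: 'p uq)"
      by (simp add: times_uq.abs_eq)
    then show ?case
      using E[OF Cons] K[OF Cons] F[OF Cons]
      by (cases g) (simp_all add: uq_E.abs_eq uq_K.abs_eq uq_F.abs_eq)
  qed
  have "P (abs_uq r)" for r
  proof (induction r rule: poly_mapping_single_induct)
    case (single k c)
    have "Poly_Mapping.single k c = c *\<^sub>C (Poly_Mapping.single k 1 :: _ \<Rightarrow>\<^sub>0 complex)"
      by (rule poly_mapping_eqI) (simp add: scaleC_poly_mapping.rep_eq lookup_single when_def scaleC_complex_def)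
    then have "abs_uq (Poly_Mapping.single k c) = c *\<^sub>C (abs_uq (Poly_Mapping.single k 1) :: 'p uq)"
      by (simp add: scaleC_uq.abs_eq)
    with word[of "letters k"] assms(3) show ?case
      by simp
  next
    case (add r s)
    then show ?case
      unfolding plus_uq.abs_eq[symmetric] by (rule assms(2))
  qed
  then show ?thesis by (metis uq_abs_cases)
qed

lemma abs_uq_zero: "r \<in> uq_relations TYPE('p::finite) \<Longrightarrow> (abs_uq r :: 'p uq) = 0"
proof -
  assume "r \<in> uq_relations TYPE('p)"
  then have "1 * r * 1 \<in> two_sided_ideal (uq_relations TYPE('p))"
    unfolding two_sided_ideal_def by (intro complex_space.span_base) blast
  then show ?thesis
    unfolding zero_uq_def map_fun_def by (simp add: uq.abs_eq_iff)
qed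

lemma abs_uq_power: "abs_uq (r ^ n) = (abs_uq r :: 'p::finite uq) ^ n"
  by (induction n) (simp_all flip: one_uq.abs_eq times_uq.abs_eq)

lemma uq_rep_generators: "uq_rep TYPE('p::finite) (uq_E :: 'p uq) uq_K uq_F"
proof -
  let ?q = "\<qq> TYPE('p)"
  let ?k' = "(uq_K :: 'p uq) ^ (2 * CARD('p) - 1)"
  have rel: "uq_K * uq_E * ?k' - ?q\<^sup>2 *\<^sub>C uq_E = 0" "uq_K * uq_F * ?k' - (inverse ?q)\<^sup>2 *\<^sub>C uq_F = 0"
     "uq_E * uq_F - uq_F * uq_E - inverse (?q - inverse ?q) *\<^sub>C (uq_K - ?k') = 0"
     "(uq_E :: 'p uq) ^ CARD('p) = 0" "(uq_F :: 'p uq) ^ CARD('p) = 0" "(uq_K :: 'p uq) ^ (2 * CARD('p)) - 1 = 0"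
    unfolding uq_E.abs_eq uq_K.abs_eq uq_F.abs_eq times_uq.abs_eq minus_uq.abs_eq scaleC_uq.abs_eq one_uq.abs_eq abs_uq_power[symmetric]
    by (rule abs_uq_zero; simp only: uq_relations_def Let_def insert_iff simp_thms)+
  have K: "(uq_K :: 'p uq) ^ (2 * CARD('p)) = 1" using rel(6) by simp
  note kk = power_card_inverse(2)[OF K]
  have "uq_K * uq_E = (uq_K * uq_E * ?k') * uq_K"
    by (simp only: mult.assoc kk mult_1_right)
  also have "\<dots> = ?q\<^sup>2 *\<^sub>C (uq_E * uq_K)"
    using rel(1) by (simp only: right_minus_eq mult_scaleC_left)
  finally have KE: "uq_K * uq_E = ?q\<^sup>2 *\<^sub>C (uq_E * uq_K :: 'p uq)" .
  have "uq_K * uq_F = (uq_K * uq_F * ?k') * uq_K"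
    by (simp only: mult.assoc kk mult_1_right)
  also have "\<dots> = (inverse ?q)\<^sup>2 *\<^sub>C (uq_F * uq_K)"
    using rel(2) by (simp only: right_minus_eq mult_scaleC_left)
  finally have "uq_F * uq_K = ?q\<^sup>2 *\<^sub>C (uq_K * uq_F :: 'p uq)"
    by (simp add: scaleC_scaleC scaleC_one field_simps)
  with KE rel K show ?thesis
    by (simp only: uq_rep_def right_minus_eq simp_thms)
qed

lemma uq_K_Kinv: "uq_K * uq_Kinv = (1 :: 'p::finite uq)" "uq_Kinv * uq_K = (1 :: 'p uq)"
proof -
  have "(uq_K :: 'p uq) ^ (2 * CARD('p)) = 1"
    using uq_rep_generators unfolding uq_rep_def by blast
  from power_card_inverse[OF this] show "uq_K * uq_Kinv = (1 :: 'p uq)" "uq_Kinv * uq_K = (1 :: 'p uq)"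
    by (simp_all only: uq_Kinv_def)
qed

text \<open>The image of \<open>uq_Kinv\<close> is a left inverse of the image of K, hence equal to
  any right inverse; no power has to be computed.\<close>

lemma uq_hom_Kinv_unique:
  assumes "algebra_hom \<phi>" "\<phi> (uq_K :: 'p::finite uq) * k' = 1"
  shows "\<phi> (uq_Kinv :: 'p uq) = k'"
proof -
  have "\<phi> uq_Kinv * \<phi> uq_K = 1"
    using algebra_homD(2,3)[OF assms(1)] by (metis uq_K_Kinv(2))
  then show ?thesis
    by (metis assms(2) mult.assoc mult_1_left mult_1_right)
qed

lemma uq_hom_ext:
  fixes \<phi> \<psi> :: "'p::finite uq \<Rightarrow> 'a::complex_algebra_1"
  assumes "algebra_hom \<phi>" "algebra_hom \<psi>" "\<phi> uq_E = \<psi> uq_E" "\<phi> uq_K = \<psi> uq_K" "\<phi> uq_F = \<psi> uq_F"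
  shows "\<phi> = \<psi>"
proof
  fix x
  show "\<phi> x = \<psi> x"
    by (induction x rule: uq_induct)
      (simp_all add: algebra_homD[OF assms(1)] algebra_homD[OF assms(2)] assms(3-5)
        clinear_add[OF algebra_homD(1)[OF assms(1)]] clinear_add[OF algebra_homD(1)[OF assms(2)]]
        clinear_scale[OF algebra_homD(1)[OF assms(1)]] clinear_scale[OF algebra_homD(1)[OF assms(2)]])
qed

lemma scale_commute_inverse:
  fixes a k k' :: "'a::complex_algebra_1"
  assumes "k * a = c *\<^sub>C (a * k)" "k * k' = 1" "k' * k = 1"
  shows "a * k' = c *\<^sub>C (k' * a)"
proof -
  have "a * k' = k' * (k * a) * k'" by (metis assms(3) mult.assoc mult_1_left)
  also have "\<dots> = c *\<^sub>C (k' * a * (k * k'))" by (simp add: assms(1) alg_simps mult.assoc)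
  finally show ?thesis by (simp add: assms(2))
qed

lemma uq_rep_Kinv:
  assumes "uq_rep TYPE('p::finite) e k f" "k * k' = 1"
  shows "k' * k = 1" "e * k' = (\<qq> TYPE('p))\<^sup>2 *\<^sub>C (k' * e)" "k' * f = (\<qq> TYPE('p))\<^sup>2 *\<^sub>C (f * k')"
    "e * f = f * e + inverse (\<qq> TYPE('p) - inverse (\<qq> TYPE('p))) *\<^sub>C (k - k')"
proof -
  have k: "k ^ (2 * CARD('p)) = 1" using assms by (auto simp: uq_rep_def)
  have k': "k' = k ^ (2 * CARD('p) - 1)" by (rule power_card_inverse_unique[OF k assms(2), symmetric])
  show 1: "k' * k = 1" unfolding k' by (rule power_card_inverse[OF k])
  show "e * k' = (\<qq> TYPE('p))\<^sup>2 *\<^sub>C (k' * e)"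
    by (rule scale_commute_inverse[OF _ assms(2) 1]) (use assms in \<open>auto simp: uq_rep_def\<close>)
  have "k' * f = k' * (f * k) * k'" by (metis assms(2) mult.assoc mult_1_right)
  also have "f * k = (\<qq> TYPE('p))\<^sup>2 *\<^sub>C (k * f)" using assms by (auto simp: uq_rep_def)
  also have "k' * ((\<qq> TYPE('p))\<^sup>2 *\<^sub>C (k * f)) * k' = (\<qq> TYPE('p))\<^sup>2 *\<^sub>C ((k' * k) * f * k')"
    by (simp add: alg_simps mult.assoc)
  finally show "k' * f = (\<qq> TYPE('p))\<^sup>2 *\<^sub>C (f * k')" by (simp add: 1)
  show "e * f = f * e + inverse (\<qq> TYPE('p) - inverse (\<qq> TYPE('p))) *\<^sub>C (k - k')"
    using assms(1) unfolding uq_rep_def k' by (simp add: algebra_simps)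
qed

lemma uq_repI:
  assumes "k ^ (2 * CARD('p::finite)) = 1" "k * k' = 1" "k * e = (\<qq> TYPE('p))\<^sup>2 *\<^sub>C (e * k)"
    "f * k = (\<qq> TYPE('p))\<^sup>2 *\<^sub>C (k * f)"
    "e * f = f * e + inverse (\<qq> TYPE('p) - inverse (\<qq> TYPE('p))) *\<^sub>C (k - k')"
    "e ^ CARD('p) = 0" "f ^ CARD('p) = 0"
  shows "uq_rep TYPE('p) e k f"
  unfolding uq_rep_def power_card_inverse_unique[OF assms(1,2)]
  using assms by simp

lemma uq_relations:
  fixes E K F Kinv :: "'p::finite uq"
  defines "E \<equiv> uq_E" and "K \<equiv> uq_K" and "F \<equiv> uq_F" and "Kinv \<equiv> uq_Kinv"
  shows "K ^ (2 * CARD('p)) = 1" "K * Kinv = 1" "Kinv * K = 1"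
    "K * E = (\<qq> TYPE('p))\<^sup>2 *\<^sub>C (E * K)" "E * Kinv = (\<qq> TYPE('p))\<^sup>2 *\<^sub>C (Kinv * E)"
    "F * K = (\<qq> TYPE('p))\<^sup>2 *\<^sub>C (K * F)" "Kinv * F = (\<qq> TYPE('p))\<^sup>2 *\<^sub>C (F * Kinv)"
    "E * F = F * E + inverse (\<qq> TYPE('p) - inverse (\<qq> TYPE('p))) *\<^sub>C (K - Kinv)"
    "E ^ CARD('p) = 0" "F ^ CARD('p) = 0"
  using uq_rep_generators[where 'p='p] uq_rep_Kinv[OF uq_rep_generators[where 'p='p] uq_K_Kinv(1)]
  unfolding uq_rep_def assms by (auto simp: uq_K_Kinv)

section \<open>The Hopf algebra structure\<close>

lemma uq_comult_rep:
  "uq_rep TYPE('p::finite) (uq_E \<otimes>\<^sub>t uq_K + 1 \<otimes>\<^sub>t uq_E) (uq_K \<otimes>\<^sub>t uq_K)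
    (uq_F \<otimes>\<^sub>t 1 + uq_Kinv \<otimes>\<^sub>t uq_F :: ('p uq, 'p uq) tensor)"
proof (rule uq_repI[where k' = "uq_Kinv \<otimes>\<^sub>t uq_Kinv"])
  let ?q = "\<qq> TYPE('p)"
  note rel = uq_relations[where 'p='p]
  show "(uq_K \<otimes>\<^sub>t uq_K) ^ (2 * CARD('p)) = (1 :: ('p uq, 'p uq) tensor)"
    by (simp add: tensor_power rel(1) one_tensor_def)
  show "(uq_K \<otimes>\<^sub>t uq_K) * (uq_Kinv \<otimes>\<^sub>t uq_Kinv) = (1 :: ('p uq, 'p uq) tensor)"
    by (simp add: tensor_mult rel(2) one_tensor_def)
  show "(uq_K \<otimes>\<^sub>t uq_K) * (uq_E \<otimes>\<^sub>t uq_K + 1 \<otimes>\<^sub>t uq_E :: ('p uq, 'p uq) tensor) =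
      ?q\<^sup>2 *\<^sub>C ((uq_E \<otimes>\<^sub>t uq_K + 1 \<otimes>\<^sub>t uq_E) * (uq_K \<otimes>\<^sub>t uq_K))"
    by (simp add: alg_simps rel(4))
  show "(uq_F \<otimes>\<^sub>t 1 + uq_Kinv \<otimes>\<^sub>t uq_F :: ('p uq, 'p uq) tensor) * (uq_K \<otimes>\<^sub>t uq_K) =
      ?q\<^sup>2 *\<^sub>C ((uq_K \<otimes>\<^sub>t uq_K) * (uq_F \<otimes>\<^sub>t 1 + uq_Kinv \<otimes>\<^sub>t uq_F))"
    by (simp add: alg_simps rel(2,3,6))
  \<comment> \<open>The mixed terms cancel because E K^-1 = q^2 K^-1 E and F K = q^2 K F carry the
    same scalar. What remains is [E,F] \<otimes> K + K^-1 \<otimes> [E,F], which telescopes to K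
    \<otimes> K - K^-1 \<otimes> K^-1 over q - q^-1.\<close>
  show "(uq_E \<otimes>\<^sub>t uq_K + 1 \<otimes>\<^sub>t uq_E) * (uq_F \<otimes>\<^sub>t 1 + uq_Kinv \<otimes>\<^sub>t uq_F :: ('p uq, 'p uq) tensor) =
      (uq_F \<otimes>\<^sub>t 1 + uq_Kinv \<otimes>\<^sub>t uq_F) * (uq_E \<otimes>\<^sub>t uq_K + 1 \<otimes>\<^sub>t uq_E) +
      inverse (?q - inverse ?q) *\<^sub>C (uq_K \<otimes>\<^sub>t uq_K - uq_Kinv \<otimes>\<^sub>t uq_Kinv)"
    by (simp add: alg_simps rel(5,6,8))
  \<comment> \<open>The summands are exchanged: by K E = q^2 E K it is E \<otimes> K that moves past
    1 \<otimes> E with scalar q^2. For F the given order is already the right one.\<close>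
  have "(1 \<otimes>\<^sub>t uq_E + uq_E \<otimes>\<^sub>t uq_K) ^ CARD('p) = (0 :: ('p uq, 'p uq) tensor)"
    by (rule quantum_binomial_nilpotent[where w = "?q\<^sup>2"])
      (auto simp: qq_square_power_eq_1_iff tensor_power alg_simps rel(4,9) dest: dvd_imp_le)
  then show "(uq_E \<otimes>\<^sub>t uq_K + 1 \<otimes>\<^sub>t uq_E) ^ CARD('p) = (0 :: ('p uq, 'p uq) tensor)"
    by (simp add: add.commute)
  show "(uq_F \<otimes>\<^sub>t 1 + uq_Kinv \<otimes>\<^sub>t uq_F) ^ CARD('p) = (0 :: ('p uq, 'p uq) tensor)"
    by (rule quantum_binomial_nilpotent[where w = "?q\<^sup>2"])
      (auto simp: qq_square_power_eq_1_iff tensor_power alg_simps rel(7,10) dest: dvd_imp_le)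
qed

text \<open>Existence for the definite description comes from the universal property, uniqueness
  from agreement on generators.\<close>

lemma uq_comult:
  shows uq_comult_hom: "algebra_hom (uq_comult :: 'p::finite uq \<Rightarrow> _)"
    and uq_comult_E: "uq_comult (uq_E :: 'p uq) = uq_E \<otimes>\<^sub>t uq_K + 1 \<otimes>\<^sub>t uq_E"
    and uq_comult_K: "uq_comult (uq_K :: 'p uq) = uq_K \<otimes>\<^sub>t uq_K"
    and uq_comult_F: "uq_comult (uq_F :: 'p uq) = uq_F \<otimes>\<^sub>t 1 + uq_Kinv \<otimes>\<^sub>t uq_F"
proof -
  let ?P = "\<lambda>f :: 'p uq \<Rightarrow> _. algebra_hom f \<and> f uq_E = uq_E \<otimes>\<^sub>t uq_K + 1 \<otimes>\<^sub>t uq_E \<and>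
     f uq_K = uq_K \<otimes>\<^sub>t uq_K \<and> f uq_F = uq_F \<otimes>\<^sub>t 1 + uq_Kinv \<otimes>\<^sub>t uq_F"
  have "?P uq_comult"
    unfolding uq_comult_def
    by (rule theI[of ?P "uq_lift (uq_E \<otimes>\<^sub>t uq_K + 1 \<otimes>\<^sub>t uq_E) (uq_K \<otimes>\<^sub>t uq_K) (uq_F \<otimes>\<^sub>t 1 + uq_Kinv \<otimes>\<^sub>t uq_F)"])
      (simp_all add: uq_lift[OF uq_comult_rep] uq_hom_ext)
  then show "algebra_hom (uq_comult :: 'p uq \<Rightarrow> _)" "uq_comult (uq_E :: 'p uq) = uq_E \<otimes>\<^sub>t uq_K + 1 \<otimes>\<^sub>t uq_E"
    "uq_comult (uq_K :: 'p uq) = uq_K \<otimes>\<^sub>t uq_K" "uq_comult (uq_F :: 'p uq) = uq_F \<otimes>\<^sub>t 1 + uq_Kinv \<otimes>\<^sub>t uq_F"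
    by blast+
qed

lemma uq_comult_Kinv: "uq_comult (uq_Kinv :: 'p::finite uq) = uq_Kinv \<otimes>\<^sub>t uq_Kinv"
  by (rule uq_hom_Kinv_unique[OF uq_comult_hom])
    (simp add: uq_comult_K tensor_mult uq_K_Kinv one_tensor_def)

lemma uq_counit:
  shows uq_counit_hom: "algebra_hom (uq_counit :: 'p::finite uq \<Rightarrow> _)"
    and uq_counit_E: "uq_counit (uq_E :: 'p uq) = 0"
    and uq_counit_K: "uq_counit (uq_K :: 'p uq) = 1"
    and uq_counit_F: "uq_counit (uq_F :: 'p uq) = 0"
proof -
  have rep: "uq_rep TYPE('p) (0::complex) 1 0"
    by (rule uq_repI[where k' = 1]) simp_all
  let ?P = "\<lambda>f :: 'p uq \<Rightarrow> complex. algebra_hom f \<and> f uq_E = 0 \<and> f uq_K = 1 \<and> f uq_F = 0"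
  have "?P uq_counit"
    unfolding uq_counit_def
    by (rule theI[of ?P "uq_lift 0 1 0"]) (simp_all add: uq_lift[OF rep] uq_hom_ext)
  then show "algebra_hom (uq_counit :: 'p uq \<Rightarrow> _)" "uq_counit (uq_E :: 'p uq) = 0"
    "uq_counit (uq_K :: 'p uq) = 1" "uq_counit (uq_F :: 'p uq) = 0"
    by blast+
qed

lemma uq_counit_Kinv: "uq_counit (uq_Kinv :: 'p::finite uq) = 1"
  by (rule uq_hom_Kinv_unique[OF uq_counit_hom]) (simp add: uq_counit_K)

text \<open>Antihomomorphisms into an algebra are homomorphisms into its endomorphisms by right
  multiplications.\<close>

lift_definition right_mult :: "'a::complex_algebra_1 \<Rightarrow> 'a endo" is "\<lambda>a x. x * a"
  by (intro clinear_mult_right clinear_id)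

lemma right_mult_simps:
  "right_mult 1 = 1" "right_mult 0 = 0" "right_mult a * right_mult b = right_mult (b * a)"
  "right_mult a + right_mult b = right_mult (a + b)" "right_mult a - right_mult b = right_mult (a - b)"
  "c *\<^sub>C right_mult a = right_mult (c *\<^sub>C a)"
  by (transfer; simp add: fun_eq_iff algebra_simps mult_scaleC_right)+

lemma right_mult_power: "right_mult a ^ n = right_mult (a ^ n)"
  by (induction n) (simp_all add: right_mult_simps power_commutes)

text \<open>K^-1 E and E K^-1 differ by a scalar, so the power is a multiple of E^p K^-p.\<close>

lemma uq_E_Kinv_power: "(uq_E * uq_Kinv :: 'p::finite uq) ^ CARD('p) = 0"
proof -
  have "uq_Kinv * uq_E = inverse ((\<qq> TYPE('p))\<^sup>2) *\<^sub>C (uq_E * uq_Kinv :: 'p uq)"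
    by (simp add: uq_relations(5) scaleC_scaleC scaleC_one)
  from scale_commute_power_mult[OF this, of "CARD('p)"] show ?thesis
    by (auto simp: uq_relations(9))
qed

text \<open>Right multiplications compose in reverse order, so these are the relations for the
  images under S, read in the opposite algebra.\<close>

lemma uq_antipode_rep:
  "uq_rep TYPE('p::finite) (right_mult (- (uq_E * uq_Kinv))) (right_mult uq_Kinv)
     (right_mult (- (uq_K * uq_F) :: 'p uq))"
proof (rule uq_repI[where k' = "right_mult uq_K"], unfold right_mult_simps right_mult_power)
  let ?q = "\<qq> TYPE('p)"
  note rel = uq_relations[where 'p='p]
  have rel_assoc: "uq_K * (uq_Kinv * x) = x" "uq_Kinv * (uq_K * x) = x" for x :: "'p uq"
    by (simp_all add: rel(2,3) flip: mult.assoc)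
  have "(uq_Kinv :: 'p uq) ^ n * uq_K ^ n = 1" for n
  proof (induction n)
    case (Suc n)
    have "(uq_Kinv :: 'p uq) ^ Suc n * uq_K ^ Suc n = uq_Kinv ^ n * (uq_Kinv * uq_K) * uq_K ^ n"
      by (simp only: power_Suc2[of uq_Kinv] power_Suc[of uq_K] mult.assoc)
    with Suc show ?case by (simp only: rel(3) mult_1_right)
  qed simp
  from this[of "2 * CARD('p)"] have Kinv: "(uq_Kinv :: 'p uq) ^ (2 * CARD('p)) = 1"
    by (simp only: rel(1) mult_1_right)
  then show "right_mult ((uq_Kinv :: 'p uq) ^ (2 * CARD('p))) = 1"
    by (simp add: right_mult_simps)
  show "right_mult (uq_K * uq_Kinv :: 'p uq) = 1"
    by (simp add: rel right_mult_simps)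
  have "- (uq_E * uq_Kinv) * uq_Kinv = ?q\<^sup>2 *\<^sub>C (uq_Kinv * - (uq_E * uq_Kinv) :: 'p uq)"
    by (simp add: rel(5) alg_simps mult.assoc)
  then show "right_mult (- (uq_E * uq_Kinv) * uq_Kinv) = right_mult (?q\<^sup>2 *\<^sub>C (uq_Kinv * - (uq_E * uq_Kinv) :: 'p uq))"
    by (rule arg_cong)
  have "?q\<^sup>2 *\<^sub>C (uq_K * uq_F * uq_Kinv) = uq_K * (uq_Kinv * uq_F :: 'p uq)"
    by (simp add: rel(7) alg_simps mult.assoc)
  then have "uq_Kinv * - (uq_K * uq_F) = ?q\<^sup>2 *\<^sub>C (- (uq_K * uq_F) * uq_Kinv :: 'p uq)"
    by (simp add: rel_assoc)
  then show "right_mult (uq_Kinv * - (uq_K * uq_F)) = right_mult (?q\<^sup>2 *\<^sub>C (- (uq_K * uq_F) * uq_Kinv :: 'p uq))"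
    by (rule arg_cong)
  \<comment> \<open>K^-1 commutes with F E, since E and F have opposite weights. Hence S(F) S(E) = F
    E and S(E) S(F) = E F.\<close>
  have "uq_F * (uq_E * uq_Kinv) = uq_Kinv * (uq_F * uq_E :: 'p uq)"
    by (simp add: rel(5,7) alg_simps flip: mult.assoc)
  then have "- (uq_K * uq_F) * - (uq_E * uq_Kinv) = (uq_F * uq_E :: 'p uq)"
    by (simp add: rel_assoc mult.assoc)
  moreover have "- (uq_E * uq_Kinv) * - (uq_K * uq_F) = (uq_E * uq_F :: 'p uq)"
    by (simp add: rel_assoc mult.assoc)
  ultimately have "- (uq_K * uq_F) * - (uq_E * uq_Kinv) = - (uq_E * uq_Kinv) * - (uq_K * uq_F) +
      inverse (?q - inverse ?q) *\<^sub>C (uq_Kinv - uq_K :: 'p uq)"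
    by (simp add: rel(8) alg_simps)
  then show "right_mult (- (uq_K * uq_F) * - (uq_E * uq_Kinv)) = right_mult (- (uq_E * uq_Kinv) * - (uq_K * uq_F) +
      inverse (?q - inverse ?q) *\<^sub>C (uq_Kinv - uq_K :: 'p uq))"
    by (rule arg_cong)
  show "right_mult ((- (uq_E * uq_Kinv) :: 'p uq) ^ CARD('p)) = 0"
    by (simp add: power_uminus_scaleC[where 'a = "'p uq"] uq_E_Kinv_power right_mult_simps)
  from scale_commute_power_mult[OF rel(6), of "CARD('p)"]
  show "right_mult ((- (uq_K * uq_F) :: 'p uq) ^ CARD('p)) = 0"
    by (auto simp: power_uminus_scaleC[where 'a = "'p uq"] rel(10) right_mult_simps)
qed

lemma uq_antihom_ext:
  fixes \<phi> \<psi> :: "'p::finite uq \<Rightarrow> 'a::complex_algebra_1"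
  assumes "algebra_antihom \<phi>" "algebra_antihom \<psi>" "\<phi> uq_E = \<psi> uq_E" "\<phi> uq_K = \<psi> uq_K" "\<phi> uq_F = \<psi> uq_F"
  shows "\<phi> = \<psi>"
proof
  fix x
  show "\<phi> x = \<psi> x"
    using assms
    by (induction x rule: uq_induct) (auto simp: algebra_antihom_def clinear_add clinear_scale)
qed

lemma uq_antipode:
  shows uq_antipode_antihom: "algebra_antihom (uq_antipode :: 'p::finite uq \<Rightarrow> _)"
    and uq_antipode_E: "uq_antipode (uq_E :: 'p uq) = - (uq_E * uq_Kinv)"
    and uq_antipode_K: "uq_antipode (uq_K :: 'p uq) = uq_Kinv"
    and uq_antipode_F: "uq_antipode (uq_F :: 'p uq) = - (uq_K * uq_F)"
proof -
  define \<phi> :: "'p uq \<Rightarrow> 'p uq endo"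
    where "\<phi> = uq_lift (right_mult (- (uq_E * uq_Kinv))) (right_mult uq_Kinv) (right_mult (- (uq_K * uq_F)))"
  note \<phi> = uq_lift[OF uq_antipode_rep[where 'p='p], folded \<phi>_def]
  note \<phi>_hom = algebra_homD[OF \<phi>(1)]
  \<comment> \<open>If \<phi> h is right multiplication by some a, then a is its value at 1. That
    \<phi> h always has this form is \<open>right\<close>: it holds for generators and passes to
    products by \<open>step\<close>.\<close>
  define S where "S h = endo_apply (\<phi> h) 1" for h
  have lin: "clinear S"
    by (rule clinearI) (simp_all add: S_def clinear_add[OF \<phi>_hom(1)] clinear_scale[OF \<phi>_hom(1)] endo_apply_simps)
  have step: "endo_apply (\<phi> (g * h)) x = x * S (g * h)"
    if h: "\<And>x. endo_apply (\<phi> h) x = x * S h" and g: "\<And>x. endo_apply (\<phi> g) x = x * a" for g h a x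
  proof -
    have "endo_apply (\<phi> (g * h)) y = y * (S h * a)" for y
      by (simp only: \<phi>_hom(3) times_endo.rep_eq h g mult.assoc)
    then show ?thesis by (simp only: S_def mult_1_left)
  qed
  have right: "endo_apply (\<phi> h) x = x * S h" for h x
  proof (induction h arbitrary: x rule: uq_induct)
    case one
    then show ?case by (simp add: S_def \<phi>_hom endo_apply_simps)
  next
    case (add g h)
    then show ?case by (simp add: clinear_add[OF \<phi>_hom(1)] clinear_add[OF lin] endo_apply_simps distrib_left)
  next
    case (scale c h)
    then show ?case by (simp add: clinear_scale[OF \<phi>_hom(1)] clinear_scale[OF lin] endo_apply_simps mult_scaleC_right)
  qed (rule step, assumption, simp only: \<phi>(2-4) right_mult.rep_eq)+
  have "S (g * h) = S h * S g" for g h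
    unfolding right[symmetric] by (simp add: S_def \<phi>_hom endo_apply_simps)
  moreover have "S 1 = 1" "S uq_E = - (uq_E * uq_Kinv)" "S uq_K = uq_Kinv" "S uq_F = - (uq_K * uq_F)"
    by (simp_all add: S_def \<phi> \<phi>_hom endo_apply_simps right_mult.rep_eq)
  moreover note lin
  ultimately have S: "algebra_antihom S \<and> S uq_E = - (uq_E * uq_Kinv) \<and> S uq_K = uq_Kinv \<and> S uq_F = - (uq_K * uq_F)"
    by (auto simp: algebra_antihom_def)
  let ?P = "\<lambda>f :: 'p uq \<Rightarrow> 'p uq. algebra_antihom f \<and>
     f uq_E = - (uq_E * uq_Kinv) \<and> f uq_K = uq_Kinv \<and> f uq_F = - (uq_K * uq_F)"
  have "?P uq_antipode"
    unfolding uq_antipode_def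
    by (rule theI[of ?P, OF S]) (use S in \<open>auto intro!: uq_antihom_ext\<close>)
  then show "algebra_antihom (uq_antipode :: 'p::finite uq \<Rightarrow> _)" "uq_antipode (uq_E :: 'p uq) = - (uq_E * uq_Kinv)"
    "uq_antipode (uq_K :: 'p uq) = uq_Kinv" "uq_antipode (uq_F :: 'p uq) = - (uq_K * uq_F)"
    by blast+
qed

lemma uq_antipode_Kinv: "uq_antipode (uq_Kinv :: 'p::finite uq) = uq_K"
proof -
  have "uq_antipode (uq_Kinv * uq_K :: 'p uq) = uq_antipode uq_K * uq_antipode uq_Kinv"
    using uq_antipode_antihom unfolding algebra_antihom_def by blast
  moreover have "uq_antipode (1 :: 'p uq) = 1"
    using uq_antipode_antihom unfolding algebra_antihom_def by blast
  ultimately have "uq_Kinv * uq_antipode uq_Kinv = (1 :: 'p uq)"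
    by (simp add: uq_K_Kinv uq_antipode_K)
  then have "uq_K * (uq_Kinv * uq_antipode uq_Kinv) = (uq_K :: 'p uq)"
    by simp
  then show ?thesis
    by (simp only: mult.assoc[symmetric] uq_K_Kinv mult_1_left)
qed

section \<open>The Hopf algebra axioms\<close>

lemma cbilinear_functional_scaleC:
  "clinear \<epsilon> \<Longrightarrow> cbilinear (\<lambda>h x. \<epsilon> h *\<^sub>C x)" "clinear \<epsilon> \<Longrightarrow> cbilinear (\<lambda>x h. \<epsilon> h *\<^sub>C x)"
  by (rule cbilinearI; simp add: clinear_add clinear_scale alg_simps scaleC_complex_def mult.commute)+

text \<open>Contracting one tensor factor with a character is multiplicative; this turns the counit
  laws into equalities of homomorphisms.\<close>

lemma algebra_hom_tensor_lift_character:
  assumes "algebra_hom \<epsilon>"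
  shows "algebra_hom (tensor_lift (\<lambda>h x. \<epsilon> h *\<^sub>C x))" "algebra_hom (tensor_lift (\<lambda>x h. \<epsilon> h *\<^sub>C x))"
  by (rule algebra_hom_tensorI; simp add: tensor_lift_simps clinear_tensor_lift cbilinear_functional_scaleC
      algebra_homD[OF assms] alg_simps mult.commute)+

theorem uq_hopf_algebra: "hopf_algebra (uq_comult :: 'p::finite uq \<Rightarrow> _) uq_counit uq_antipode"
proof (rule hopf_algebra.intro)
  note \<Delta> = algebra_homD[OF uq_comult_hom[where 'p='p]] uq_comult[where 'p='p] uq_comult_Kinv[where 'p='p]
  note \<epsilon> = algebra_homD[OF uq_counit_hom[where 'p='p]] uq_counit[where 'p='p] uq_counit_Kinv[where 'p='p]
  note S_hom = uq_antipode_antihom[where 'p='p, unfolded algebra_antihom_def]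
  note S = uq_antipode[where 'p='p] uq_antipode_Kinv[where 'p='p]
  show "algebra_hom (uq_comult :: 'p uq \<Rightarrow> _)" "algebra_hom (uq_counit :: 'p uq \<Rightarrow> _)"
    by (rule uq_comult_hom uq_counit_hom)+
  show S_lin: "clinear (uq_antipode :: 'p uq \<Rightarrow> _)"
    using S_hom by blast
  have S_mult: "uq_antipode (g * h) = uq_antipode h * uq_antipode g" and S_one: "uq_antipode 1 = (1 :: 'p uq)" for g h :: "'p uq"
    using S_hom by blast+
  have id_hom: "algebra_hom (id :: 'p uq \<Rightarrow> _)" by (rule algebra_hom_id)
  note map_hom = algebra_hom_tensor_map[OF uq_comult_hom[where 'p='p] id_hom]
    algebra_hom_tensor_map[OF id_hom uq_comult_hom[where 'p='p]]
  have id_lin: "clinear (id :: 'p uq \<Rightarrow> _)" by (rule algebra_homD(1)[OF id_hom])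
  note map_simps = tensor_map_tensor[OF \<Delta>(1) id_lin] tensor_map_tensor[OF id_lin \<Delta>(1)]
    clinear_add[OF clinear_tensor_map[OF \<Delta>(1) id_lin]] clinear_add[OF clinear_tensor_map[OF id_lin \<Delta>(1)]]
    tensor_assoc_tensor clinear_add[OF clinear_tensor_assoc]
  show "tensor_assoc (tensor_map uq_comult id (uq_comult h)) = tensor_map id uq_comult (uq_comult h)"
    for h :: "'p uq"
  proof -
    have "(\<lambda>h. tensor_assoc (tensor_map uq_comult id (uq_comult h))) = (\<lambda>h :: 'p uq. tensor_map id uq_comult (uq_comult h))"
      by (rule uq_hom_ext)
        (simp_all add: algebra_hom_comp[OF algebra_hom_comp[OF uq_comult_hom map_hom(1)] algebra_hom_tensor_assoc]
          algebra_hom_comp[OF uq_comult_hom map_hom(2)] \<Delta> map_simps alg_simps one_tensor_def add.assoc)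
    then show ?thesis by (rule fun_cong)
  qed
  have cancel: "uq_Kinv * (uq_K * x) = x" "uq_K * (uq_Kinv * x) = x" for x :: "'p uq"
    by (simp_all add: uq_K_Kinv flip: mult.assoc)
  note eps = tensor_lift_simps[OF cbilinear_functional_scaleC(1)[OF \<epsilon>(1)]]
    tensor_lift_simps[OF cbilinear_functional_scaleC(2)[OF \<epsilon>(1)]]
  show "tensor_lift (\<lambda>h' h''. uq_counit h' *\<^sub>C h'') (uq_comult h) = h" for h :: "'p uq"
  proof -
    have "(\<lambda>h. tensor_lift (\<lambda>h' h''. uq_counit h' *\<^sub>C h'') (uq_comult h)) = (\<lambda>h :: 'p uq. h)"
      by (rule uq_hom_ext)
       (simp_all add: algebra_hom_comp[OF uq_comult_hom algebra_hom_tensor_lift_character(1)[OF uq_counit_hom]]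
          algebra_hom_id \<Delta> \<epsilon> eps alg_simps)
    then show ?thesis by (rule fun_cong)
  qed
  show "tensor_lift (\<lambda>h' h''. uq_counit h'' *\<^sub>C h') (uq_comult h) = h" for h :: "'p uq"
  proof -
    have "(\<lambda>h. tensor_lift (\<lambda>h' h''. uq_counit h'' *\<^sub>C h') (uq_comult h)) = (\<lambda>h :: 'p uq. h)"
      by (rule uq_hom_ext)
       (simp_all add: algebra_hom_comp[OF uq_comult_hom algebra_hom_tensor_lift_character(2)[OF uq_counit_hom]]
          algebra_hom_id \<Delta> \<epsilon> eps alg_simps)
    then show ?thesis by (rule fun_cong)
  qed
  have bil: "cbilinear (\<lambda>h' h'' :: 'p uq. uq_antipode h' * h'')" "cbilinear (\<lambda>h' h'' :: 'p uq. h' * uq_antipode h'')"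
    by (rule cbilinearI; simp add: clinear_add[OF S_lin] clinear_scale[OF S_lin] alg_simps)+
  show "tensor_lift (\<lambda>h' h''. uq_antipode h' * h'') (uq_comult h) = uq_counit h *\<^sub>C 1" for h :: "'p uq"
  proof -
    define M where "M = tensor_lift (\<lambda>h' h'' :: 'p uq. uq_antipode h' * h'')"
    have M: "clinear M" "M (g \<otimes>\<^sub>t h) = uq_antipode g * h" for g h
      unfolding M_def by (simp_all add: clinear_tensor_lift tensor_lift_simps bil)
    \<comment> \<open>M is not multiplicative, but S reverses products: \<Delta>(g) (a \<otimes> b)
      goes to S(a) S(g') g'' b, and for a generator g the middle factor is \<epsilon>(g).\<close>
    have E: "M (uq_comult uq_E * t) = 0" and K: "M (uq_comult uq_K * t) = M t" and F: "M (uq_comult uq_F * t) = 0" for t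
    proof -
      note lin = clinear_comp[OF clinear_mult_left[OF clinear_id] M(1)]
      show "M (uq_comult uq_E * t) = 0"
        by (rule clinear_tensor_ext[where t = t], rule lin, rule clinearI)
          (simp_all add: \<Delta> alg_simps M(2) clinear_add[OF M(1)] S S_mult mult.assoc uq_K_Kinv cancel)
      show "M (uq_comult uq_K * t) = M t"
        by (rule clinear_tensor_ext[where t = t], rule lin, rule M)
          (simp_all add: \<Delta> alg_simps M(2) clinear_add[OF M(1)] S S_mult mult.assoc uq_K_Kinv cancel)
      show "M (uq_comult uq_F * t) = 0"
        by (rule clinear_tensor_ext[where t = t], rule lin, rule clinearI)
          (simp_all add: \<Delta> alg_simps M(2) clinear_add[OF M(1)] S S_mult mult.assoc uq_K_Kinv cancel)
    qed
    have "M (uq_comult h) = uq_counit h *\<^sub>C 1"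
    proof (induction h rule: uq_induct)
      case one
      show ?case by (simp add: \<Delta> \<epsilon> one_tensor_def M S_one scaleC_one)
    qed (simp_all only: \<Delta>(3) E K F \<epsilon> mult_zero_left mult_1_left complex_space.scale_zero_left
        clinear_add[OF \<Delta>(1)] clinear_add[OF \<epsilon>(1)] clinear_add[OF M(1)] scaleC_add_left
        clinear_scale[OF \<Delta>(1)] clinear_scale[OF \<epsilon>(1)] clinear_scale[OF M(1)] scaleC_scaleC scaleC_complex_def)
    then show ?thesis by (simp only: M_def)
  qed
  show "tensor_lift (\<lambda>h' h''. h' * uq_antipode h'') (uq_comult h) = uq_counit h *\<^sub>C 1" for h :: "'p uq"
  proof -
    define M where "M = tensor_lift (\<lambda>h' h'' :: 'p uq. h' * uq_antipode h'')"
    have M: "clinear M" "M (g \<otimes>\<^sub>t h) = g * uq_antipode h" for g h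
      unfolding M_def by (simp_all add: clinear_tensor_lift tensor_lift_simps bil)
    \<comment> \<open>Here the inner factor is M t itself. In the induction t is \<Delta>(h), so M t
      is a scalar by hypothesis and passes through, leaving the antipode law for the
      generator.\<close>
    have M_mult: "M ((a \<otimes>\<^sub>t b) * t) = a * M t * uq_antipode b" for a b t
      by (rule clinear_tensor_ext[where t = t],
          intro clinear_comp[OF _ M(1)] clinear_mult_left clinear_id,
          intro clinear_mult_right clinear_mult_left M)
        (simp add: tensor_mult M S_mult mult.assoc)
    have "M (uq_comult h) = uq_counit h *\<^sub>C 1"
    proof (induction h rule: uq_induct)
      case one
      show ?case by (simp add: \<Delta> \<epsilon> one_tensor_def M S_one scaleC_one)
    qed (simp_all add: \<Delta> \<epsilon> distrib_right M_mult clinear_add[OF M(1)] clinear_scale[OF M(1)] alg_simps S S_one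
        uq_K_Kinv cancel mult.assoc clinear_add[OF \<Delta>(1)] clinear_add[OF \<epsilon>(1)]
        clinear_scale[OF \<Delta>(1)] clinear_scale[OF \<epsilon>(1)] scaleC_complex_def)
    then show ?thesis by (simp only: M_def)
  qed
qed

section \<open>Matrices as a quotient of the quantum Weyl algebra\<close>

lemma smat_nth_smat [simp]:
  "i < CARD('p::finite) \<Longrightarrow> j < CARD('p) \<Longrightarrow> smat_nth (smat f :: ('a, 'p) smat) i j = f i j"
  by transfer simp

lemma smat_eqI:
  fixes A B :: "('a, 'p::finite) smat"
  assumes "\<And>i j. i < CARD('p) \<Longrightarrow> j < CARD('p) \<Longrightarrow> smat_nth A i j = smat_nth B i j"
  shows "A = B"
  using assms by transfer (auto intro!: eq_matI)

lemma smat_nth_simps [simp]: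
  fixes A B :: "('a::complex_algebra_1, 'p::finite) smat"
  assumes "i < CARD('p)" "j < CARD('p)"
  shows "smat_nth (A + B) i j = smat_nth A i j + smat_nth B i j"
    "smat_nth (A - B) i j = smat_nth A i j - smat_nth B i j"
    "smat_nth (c *\<^sub>C A) i j = c *\<^sub>C smat_nth A i j"
    "smat_nth (0 :: ('a, 'p) smat) i j = 0"
    "smat_nth (1 :: ('a, 'p) smat) i j = (if i = j then 1 else 0)"
  using assms by (transfer; simp)+

lemma smat_nth_mult:
  fixes A B :: "('a::complex_algebra_1, 'p::finite) smat"
  assumes "i < CARD('p)" "j < CARD('p)"
  shows "smat_nth (A * B) i j = (\<Sum>k<CARD('p). smat_nth A i k * smat_nth B k j)"
  using assms by transfer (simp add: scalar_prod_def lessThan_atLeast0)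

lemma smat_nth_sum:
  assumes "i < CARD('p)" "j < CARD('p)"
  shows "smat_nth (\<Sum>k\<in>A. f k :: ('a::complex_algebra_1, 'p::finite) smat) i j = (\<Sum>k\<in>A. smat_nth (f k) i j)"
  using assms by (induction A rule: infinite_finite_induct) auto

lemma smat_nth_map_smat [simp]:
  "i < CARD('p::finite) \<Longrightarrow> j < CARD('p) \<Longrightarrow> smat_nth (map_smat f (A :: ('a, 'p) smat)) i j = f (smat_nth A i j)"
  by transfer auto

definition scalar_smat :: "'a::complex_algebra_1 \<Rightarrow> ('a, 'p::finite) smat" where
  "scalar_smat r = smat (\<lambda>i j. if i = j then r else 0)"

lemma smat_nth_scalar_smat [simp]:
  "i < CARD('p::finite) \<Longrightarrow> j < CARD('p) \<Longrightarrow> smat_nth (scalar_smat r :: ('a::complex_algebra_1, 'p) smat) i j = (if i = j then r else 0)"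
  by (simp add: scalar_smat_def)

lemma smat_nth_scalar_smat_mult [simp]:
  assumes "i < CARD('p)" "j < CARD('p)"
  shows "smat_nth (scalar_smat r * A :: ('a::complex_algebra_1, 'p::finite) smat) i j = r * smat_nth A i j"
    "smat_nth (A * scalar_smat r) i j = smat_nth A i j * r"
  using assms by (simp_all add: smat_nth_mult if_distrib if_distribR cong: if_cong)

lemma algebra_hom_scalar_smat: "algebra_hom (scalar_smat :: _ \<Rightarrow> ('a::complex_algebra_1, 'p::finite) smat)"
  by (auto intro!: algebra_homI clinearI smat_eqI)

lemma scalar_smat_commute: "scalar_smat r * A = A * scalar_smat r" for r :: "'a::{complex_algebra_1, comm_ring_1}"
  by (rule smat_eqI) (simp add: mult.commute)

section \<open>The matrices Z and D entrywise\<close>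

abbreviation qw :: "'p::finite itself \<Rightarrow> complex" where
  "qw p \<equiv> (inverse (\<qq> p))\<^sup>2"

text \<open>The entries of \<open>D\<close>: \<open>q_coeff n\<close> is \<open>(q - q\<^sup>-\<^sup>1) q\<^sup>1\<^sup>-\<^sup>n [n]\<close>.\<close>

definition q_coeff :: "'p::finite itself \<Rightarrow> nat \<Rightarrow> complex" where
  "q_coeff p n = \<qq> p * (1 - qw p ^ n)"

lemma q_coeff_0 [simp]: "q_coeff p 0 = 0"
  by (simp add: q_coeff_def)

lemma q_coeff_1: "q_coeff p 1 = \<qq> p - inverse (\<qq> p)"
  by (simp add: q_coeff_def right_diff_distrib power2_eq_square)

text \<open>A q-analogue of additivity: 1 - w^(k+m) = (1 - w^k) + w^k (1 - w^m). For k = 1 it is the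
  recursion behind the relation between D Z and Z D.\<close>

lemma q_coeff_add: "q_coeff p (k + m) = q_coeff p k + qw p ^ k * q_coeff p m"
  by (simp add: q_coeff_def algebra_simps power_add)

lemma q_coeff_nonzero: "0 < n \<Longrightarrow> n < CARD('p) \<Longrightarrow> q_coeff TYPE('p::finite) n \<noteq> 0"
  using qq_inverse_square_power_eq_1_iff[where 'p='p, of n] by (auto simp: q_coeff_def dest: dvd_imp_le)

text \<open>Since w^p = 1, the entry that D would have beyond its last column is zero.\<close>

lemma q_coeff_card [simp]: "q_coeff TYPE('p::finite) CARD('p) = 0"
  using qq_inverse_square_power_eq_1_iff[where 'p='p, of "CARD('p)"] by (simp add: q_coeff_def)

text \<open>q^-n (q^(n+1) - q^-(n+1)) equals q (1 - w^(n+1)), and p \<ge> 2 lets the denominator of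
  [n+1] cancel.\<close>

lemma q_coeff_qint:
  assumes "CARD('p::finite) \<ge> 2"
  shows "(\<qq> TYPE('p) - inverse (\<qq> TYPE('p))) * inverse (\<qq> TYPE('p)) ^ n * qint TYPE('p) (n + 1) = q_coeff TYPE('p) (n + 1)"
proof -
  let ?q = "\<qq> TYPE('p)" and ?r = "inverse (\<qq> TYPE('p))"
  have rq: "?r ^ n * ?q ^ n = 1"
    by (simp flip: power_mult_distrib)
  have "(?q - ?r) * ?r ^ n * qint TYPE('p) (n + 1) = ?r ^ n * (?q ^ (n + 1) - ?r ^ (n + 1))"
    using qq_diff_nonzero[OF assms] by (simp add: qint_def)
  also have "\<dots> = ?q * (?r ^ n * ?q ^ n) - ?q * (?r * ?r ^ n) * (?r * ?r ^ n)"
    by (simp add: algebra_simps)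
  also have "\<dots> = q_coeff TYPE('p) (n + 1)"
    by (simp only: rq) (simp add: q_coeff_def right_diff_distrib power2_eq_square power_mult_distrib mult_ac)
  finally show ?thesis .
qed

lemma smat_nth_mat_Z:
  "i < CARD('p::finite) \<Longrightarrow> j < CARD('p) \<Longrightarrow> smat_nth (mat_Z :: ('a::complex_algebra_1, 'p) smat) i j = (if i = j + 1 then 1 else 0)"
  by (simp add: mat_Z_def)

lemma smat_nth_mat_D:
  assumes "CARD('p::finite) \<ge> 2" "i < CARD('p)" "j < CARD('p)"
  shows "smat_nth (mat_D :: ('a::complex_algebra_1, 'p) smat) i j = (if j = i + 1 then q_coeff TYPE('p) j *\<^sub>C 1 else 0)"
  using assms q_coeff_qint[OF assms(1), of i] by (simp add: mat_D_def)

lemma smat_nth_mat_Z_mult: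
  assumes "i < CARD('p)" "j < CARD('p)"
  shows "smat_nth (mat_Z * A :: ('a::complex_algebra_1, 'p::finite) smat) i j = (if i = 0 then 0 else smat_nth A (i - 1) j)"
    "smat_nth (A * mat_Z) i j = (if j + 1 < CARD('p) then smat_nth A i (j + 1) else 0)"
proof -
  \<comment> \<open>In row 0 the truncated index i - 1 is 0, so the case i = 0 has to sit inside the
    summand.\<close>
  have "smat_nth (mat_Z * A) i j = (\<Sum>k<CARD('p). if k = i - 1 then (if i = 0 then 0 else smat_nth A k j) else 0)"
    unfolding smat_nth_mult[OF assms] by (rule sum.cong) (use assms in \<open>auto simp: smat_nth_mat_Z\<close>)
  then show "smat_nth (mat_Z * A) i j = (if i = 0 then 0 else smat_nth A (i - 1) j)"
    using assms by auto
  have "smat_nth (A * mat_Z) i j = (\<Sum>k<CARD('p). if k = j + 1 then smat_nth A i k else 0)"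
    unfolding smat_nth_mult[OF assms] by (rule sum.cong) (use assms in \<open>auto simp: smat_nth_mat_Z\<close>)
  then show "smat_nth (A * mat_Z) i j = (if j + 1 < CARD('p) then smat_nth A i (j + 1) else 0)"
    by simp
qed

lemma smat_nth_mat_D_mult:
  assumes "CARD('p::finite) \<ge> 2" "i < CARD('p)" "j < CARD('p)"
  shows "smat_nth (mat_D * A :: ('a::complex_algebra_1, 'p) smat) i j =
      (if i + 1 < CARD('p) then q_coeff TYPE('p) (i + 1) *\<^sub>C smat_nth A (i + 1) j else 0)"
    "smat_nth (A * mat_D) i j = (if j = 0 then 0 else q_coeff TYPE('p) j *\<^sub>C smat_nth A i (j - 1))"
proof -
  have "smat_nth (mat_D * A) i j = (\<Sum>k<CARD('p). if k = i + 1 then q_coeff TYPE('p) k *\<^sub>C smat_nth A k j else 0)"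
    unfolding smat_nth_mult[OF assms(2,3)] by (rule sum.cong) (use assms in \<open>auto simp: smat_nth_mat_D mult_scaleC_left\<close>)
  then show "smat_nth (mat_D * A) i j = (if i + 1 < CARD('p) then q_coeff TYPE('p) (i + 1) *\<^sub>C smat_nth A (i + 1) j else 0)"
    by simp
  have "smat_nth (A * mat_D) i j = (\<Sum>k<CARD('p). if k = j - 1 then (if j = 0 then 0 else q_coeff TYPE('p) j *\<^sub>C smat_nth A i k) else 0)"
    unfolding smat_nth_mult[OF assms(2,3)] by (rule sum.cong) (use assms in \<open>auto simp: smat_nth_mat_D mult_scaleC_right\<close>)
  then show "smat_nth (A * mat_D) i j = (if j = 0 then 0 else q_coeff TYPE('p) j *\<^sub>C smat_nth A i (j - 1))"
    using assms by auto
qed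

section \<open>The truncated quantum Weyl algebra and its vacuum element\<close>

definition weyl_pair :: "'p::finite itself \<Rightarrow> 'b::complex_algebra_1 \<Rightarrow> 'b \<Rightarrow> bool" where
  "weyl_pair p z d \<longleftrightarrow> z ^ CARD('p) = 0 \<and> d ^ CARD('p) = 0 \<and>
     d * z = qw p *\<^sub>C (z * d) + (\<qq> p - inverse (\<qq> p)) *\<^sub>C 1"

lemma weyl_pair_mat:
  assumes "CARD('p::finite) \<ge> 2"
  shows "weyl_pair TYPE('p) (mat_Z :: ('a::complex_algebra_1, 'p) smat) mat_D"
  unfolding weyl_pair_def
proof (intro conjI)
  note nth = smat_nth_mat_Z_mult smat_nth_mat_D_mult[OF assms]
  have "i < k \<Longrightarrow> smat_nth (mat_Z ^ k :: ('a, 'p) smat) i j = 0" if "i < CARD('p)" "j < CARD('p)" for i j k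
    using that by (induction k arbitrary: i) (auto simp: nth)
  then show "(mat_Z :: ('a, 'p) smat) ^ CARD('p) = 0"
    by (intro smat_eqI) simp
  have "i + k \<ge> CARD('p) \<Longrightarrow> smat_nth (mat_D ^ k :: ('a, 'p) smat) i j = 0" if "i < CARD('p)" "j < CARD('p)" for i j k
    using that by (induction k arbitrary: i) (auto simp: nth)
  then show "(mat_D :: ('a, 'p) smat) ^ CARD('p) = 0"
    by (intro smat_eqI) simp
  show "mat_D * mat_Z = qw TYPE('p) *\<^sub>C (mat_Z * mat_D :: ('a, 'p) smat) + (\<qq> TYPE('p) - inverse (\<qq> TYPE('p))) *\<^sub>C 1"
  proof (rule smat_eqI)
    fix i j assume ij: "i < CARD('p)" "j < CARD('p)"
    have c: "q_coeff TYPE('p) (Suc n) = \<qq> TYPE('p) - inverse (\<qq> TYPE('p)) + qw TYPE('p) * q_coeff TYPE('p) n" for n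
      using q_coeff_add[of "TYPE('p)" 1 n] q_coeff_1[where p = "TYPE('p)"] by simp
    \<comment> \<open>In the last row D Z has no nonzero entry, as there is no row p to fetch; the
      relation still holds because \<open>q_coeff\<close> vanishes at p.\<close>
    have last: "\<qq> TYPE('p) - inverse (\<qq> TYPE('p)) + qw TYPE('p) * q_coeff TYPE('p) i = 0" if "Suc i = CARD('p)"
      using c[of i] that by simp
    show "smat_nth (mat_D * mat_Z :: ('a, 'p) smat) i j =
      smat_nth (qw TYPE('p) *\<^sub>C (mat_Z * mat_D :: ('a, 'p) smat) + (\<qq> TYPE('p) - inverse (\<qq> TYPE('p))) *\<^sub>C 1) i j"
    proof (cases "Suc i < CARD('p)")
      case True
      then show ?thesis
        using ij by (cases i) (auto simp: nth smat_nth_mat_Z smat_nth_mat_D[OF assms] c scaleC_scaleC scaleC_add_left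
            scaleC_add_right complex_space.scale_left_diff_distrib complex_space.scale_right_diff_distrib
            distrib_left right_diff_distrib add.commute)
    next
      case False
      with ij have "Suc i = CARD('p)" by simp
      then show ?thesis
        using ij assms last
        by (cases "j = i"; cases i) (auto simp: nth smat_nth_mat_Z smat_nth_mat_D[OF assms] scaleC_scaleC add.commute
          simp flip: scaleC_add_left)
    qed
  qed
qed

text \<open>In a quotient of the quantum Weyl algebra, \<open>weyl_vacuum z d\<close> plays the role of the matrix unit
  \<open>E\<^sub>0\<^sub>0\<close>; the other matrix units are \<open>z\<^sup>i E\<^sub>0\<^sub>0 d\<^sup>j / q_coeff_fact j\<close>.\<close>

definition vacuum_coeff :: "'p::finite itself \<Rightarrow> nat \<Rightarrow> complex" where
  "vacuum_coeff p k = (\<Prod>i<k. - (qw p ^ i / q_coeff p (Suc i)))"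

definition q_coeff_fact :: "'p::finite itself \<Rightarrow> nat \<Rightarrow> complex" where
  "q_coeff_fact p k = (\<Prod>i<k. q_coeff p (Suc i))"

definition weyl_vacuum :: "'p::finite itself \<Rightarrow> 'b::complex_algebra_1 \<Rightarrow> 'b \<Rightarrow> 'b" where
  "weyl_vacuum p z d = (\<Sum>k<CARD('p). vacuum_coeff p k *\<^sub>C (z ^ k * d ^ k))"

lemma q_coeff_fact_nonzero: "n < CARD('p) \<Longrightarrow> q_coeff_fact TYPE('p::finite) n \<noteq> 0"
  using q_coeff_nonzero[where 'p='p] by (auto simp: q_coeff_fact_def)

text \<open>The recursion forced by annihilation by d: the coefficient of z^n d^(n+1) receives w^n
  times the n-th coefficient from moving d past z^n, and \<open>q_coeff\<close> times the next one
  from shortening z^(n+1).\<close>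

lemma vacuum_coeff_Suc:
  "Suc n < CARD('p) \<Longrightarrow> vacuum_coeff TYPE('p::finite) (Suc n) * q_coeff TYPE('p) (Suc n) = - (qw TYPE('p) ^ n * vacuum_coeff TYPE('p) n)"
  using q_coeff_nonzero[where 'p='p, of "Suc n"] by (simp add: vacuum_coeff_def)

text \<open>d acts on powers of z as a twisted derivation, taking z^n to \<open>q_coeff p n\<close>
  times z^(n-1).\<close>

lemma weyl_pair_d_z_power:
  assumes "weyl_pair p z d"
  shows "d * z ^ n = qw p ^ n *\<^sub>C (z ^ n * d) + q_coeff p n *\<^sub>C z ^ (n - 1)"
proof (induction n)
  case (Suc n)
  have dz: "d * z = qw p *\<^sub>C (z * d) + q_coeff p 1 *\<^sub>C 1"
    using assms unfolding weyl_pair_def q_coeff_1 by blast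
  \<comment> \<open>For n = 0 the exponent n - 1 truncates, but then the coefficient is 0.\<close>
  have zn: "q_coeff p n *\<^sub>C (z * z ^ (n - 1)) = q_coeff p n *\<^sub>C z ^ n"
    by (cases n) simp_all
  have "d * z ^ Suc n = (d * z) * z ^ n"
    by (simp add: mult.assoc)
  also have "\<dots> = qw p *\<^sub>C (z * (d * z ^ n)) + q_coeff p 1 *\<^sub>C z ^ n"
    unfolding dz by (simp add: distrib_right mult_scaleC_left mult.assoc)
  also have "z * (d * z ^ n) = qw p ^ n *\<^sub>C (z ^ Suc n * d) + q_coeff p n *\<^sub>C z ^ n"
    by (simp only: Suc distrib_left mult_scaleC_right zn power_Suc mult.assoc)
  also have "qw p *\<^sub>C (qw p ^ n *\<^sub>C (z ^ Suc n * d) + q_coeff p n *\<^sub>C z ^ n) + q_coeff p 1 *\<^sub>C z ^ n =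
      qw p ^ Suc n *\<^sub>C (z ^ Suc n * d) + (q_coeff p 1 + qw p ^ 1 * q_coeff p n) *\<^sub>C z ^ n"
    by (simp add: scaleC_add_right scaleC_add_left scaleC_scaleC add_ac)
  also have "q_coeff p 1 + qw p ^ 1 * q_coeff p n = q_coeff p (Suc n)"
    by (simp only: q_coeff_add[symmetric]) simp
  finally show ?case by simp
qed (simp add: scaleC_one)

text \<open>By the recursion of the coefficients each shortened term cancels the moved term before
  it; the one survivor contains d^p = 0.\<close>

lemma weyl_pair_d_vacuum:
  assumes "weyl_pair TYPE('p::finite) z d"
  shows "d * weyl_vacuum TYPE('p) z d = 0"
proof -
  obtain m where m: "CARD('p) = Suc m"
    using zero_less_card_finite[where 'a='p] by (cases "CARD('p)") auto
  define a where "a k = (vacuum_coeff TYPE('p) k * qw TYPE('p) ^ k) *\<^sub>C (z ^ k * d ^ Suc k)" for k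
  let ?b = "\<lambda>k. (vacuum_coeff TYPE('p) k * q_coeff TYPE('p) k) *\<^sub>C (z ^ (k - 1) * d ^ k)"
  have "d * (vacuum_coeff TYPE('p) k *\<^sub>C (z ^ k * d ^ k)) = a k + ?b k" for k
  proof -
    have "d * (vacuum_coeff TYPE('p) k *\<^sub>C (z ^ k * d ^ k)) = vacuum_coeff TYPE('p) k *\<^sub>C ((d * z ^ k) * d ^ k)"
      by (simp add: mult_scaleC_right mult.assoc)
    then show ?thesis
      unfolding weyl_pair_d_z_power[OF assms] a_def
      by (simp add: distrib_right mult_scaleC_left scaleC_add_right scaleC_scaleC mult.assoc)
  qed
  then have "d * weyl_vacuum TYPE('p) z d = (\<Sum>k<Suc m. a k) + (\<Sum>k<Suc m. ?b k)"
    unfolding weyl_vacuum_def m by (simp only: sum_distrib_left sum.distrib)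
  also have "(\<Sum>k<Suc m. ?b k) = (\<Sum>k<m. - a k)"
  proof -
    have "?b (Suc k) = - a k" if "k < m" for k
      using vacuum_coeff_Suc[where 'p='p, of k] that by (simp add: m a_def mult.commute)
    then show ?thesis
      unfolding sum.lessThan_Suc_shift by simp
  qed
  also have "(\<Sum>k<Suc m. a k) + (\<Sum>k<m. - a k) = a m"
    by (simp add: sum_negf)
  also have "a m = 0"
    using assms by (simp add: a_def weyl_pair_def m)
  finally show ?thesis .
qed

text \<open>The k-th vacuum coefficient is (-1)^k w^(k(k-1)/2) over \<open>q_coeff_fact p k\<close>.
  So this is the statement that two q-exponential series are inverse to each other, in degrees below
  p; it makes the recovered diagonal matrix units add up to 1.\<close>

lemma vacuum_coeff_convolution:
  assumes "0 < m" "m < CARD('p::finite)"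
  shows "(\<Sum>k\<le>m. vacuum_coeff TYPE('p) k / q_coeff_fact TYPE('p) (m - k)) = 0"
proof -
  let ?c = "vacuum_coeff TYPE('p)" and ?N = "q_coeff_fact TYPE('p)" and ?n = "q_coeff TYPE('p)" and ?w = "qw TYPE('p)"
  obtain l where l: "m = Suc l" using assms(1) by (cases m) auto
  define g where "g k = ?w ^ k * ?c k / ?N (l - k)" for k
  have 1: "?c (Suc k) * ?n (Suc k) / ?N (m - Suc k) = - g k" if "k \<le> l" for k
    using that assms(2) by (simp add: vacuum_coeff_Suc l g_def)
  have 2: "?w ^ k * ?c k * ?n (m - k) / ?N (m - k) = g k" if "k \<le> l" for k
  proof -
    have "?N (m - k) = ?N (l - k) * ?n (m - k)"
      using that by (simp add: l Suc_diff_le q_coeff_fact_def)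
    moreover have "?n (m - k) \<noteq> 0"
      by (rule q_coeff_nonzero) (use that l assms(2) in auto)
    ultimately show ?thesis by (simp add: g_def)
  qed
  \<comment> \<open>Splitting \<open>q_coeff\<close> of m as that of k plus w^k times that of m - k
    yields two sums that cancel after shifting k by one.\<close>
  have "?n m * (\<Sum>k\<le>m. ?c k / ?N (m - k)) = (\<Sum>k\<le>m. ?c k * ?n k / ?N (m - k) + ?w ^ k * ?c k * ?n (m - k) / ?N (m - k))"
    unfolding sum_distrib_left
  proof (rule sum.cong)
    fix k assume "k \<in> {..m}"
    then have "?n m = ?n k + ?w ^ k * ?n (m - k)"
      using q_coeff_add[of "TYPE('p)" k "m - k"] by simp
    then show "?n m * (?c k / ?N (m - k)) = ?c k * ?n k / ?N (m - k) + ?w ^ k * ?c k * ?n (m - k) / ?N (m - k)"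
      by (simp add: algebra_simps add_divide_distrib)
  qed simp
  also have "\<dots> = (\<Sum>k\<le>m. ?c k * ?n k / ?N (m - k)) + (\<Sum>k\<le>m. ?w ^ k * ?c k * ?n (m - k) / ?N (m - k))"
    by (rule sum.distrib)
  also have "(\<Sum>k\<le>m. ?c k * ?n k / ?N (m - k)) = (\<Sum>k\<le>l. - g k)"
    using 1 unfolding l sum.atMost_Suc_shift by (simp add: l)
  also have "(\<Sum>k\<le>m. ?w ^ k * ?c k * ?n (m - k) / ?N (m - k)) = (\<Sum>k\<le>l. g k)"
    using 2 unfolding l sum.atMost_Suc by (simp add: l)
  finally have "?n m * (\<Sum>k\<le>m. ?c k / ?N (m - k)) = 0"
    by (simp add: sum_negf)
  then show ?thesis
    using q_coeff_nonzero[OF assms] by simp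
qed

section \<open>Generation and presentation of the matrix algebra\<close>

definition weyl_row :: "'p::finite itself \<Rightarrow> ('r \<Rightarrow> 'b) \<Rightarrow> 'b::complex_algebra_1 \<Rightarrow> 'b \<Rightarrow> (nat \<Rightarrow> 'r) \<Rightarrow> 'b" where
  "weyl_row p ev z d f = (\<Sum>j<CARD('p). inverse (q_coeff_fact p j) *\<^sub>C (weyl_vacuum p z d * ev (f j) * d ^ j))"

text \<open>\<open>weyl_row\<close> is the candidate image of the matrix with row f on top and zeros
  below; multiplying it by z^i moves this row to position i. Grouping by rows lets left
  multiplication by Z and D act as a row shift.\<close>

definition smat_lift :: "('r \<Rightarrow> 'b) \<Rightarrow> 'b::complex_algebra_1 \<Rightarrow> 'b \<Rightarrow> ('r, 'p::finite) smat \<Rightarrow> 'b" where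
  "smat_lift ev z d X = (\<Sum>i<CARD('p). z ^ i * weyl_row TYPE('p) ev z d (smat_nth X i))"

text \<open>For the actual Z and D the vacuum element is the upper left matrix unit, so the formula
  reproduces X. In particular Z, D and the scalars generate all matrices.\<close>

lemma smat_lift_self:
  assumes "CARD('p::finite) \<ge> 2"
  shows "smat_lift scalar_smat mat_Z mat_D X = (X :: ('r::{complex_algebra_1, comm_ring_1}, 'p) smat)"
proof -
  let ?Z = "mat_Z :: ('r, 'p) smat" and ?D = "mat_D :: ('r, 'p) smat"
  let ?P = "weyl_vacuum TYPE('p) ?Z ?D"
  note nth = smat_nth_mat_Z_mult smat_nth_mat_D_mult[OF assms]
  have Zpow: "smat_nth (?Z ^ k * A) i j = (if k \<le> i then smat_nth A (i - k) j else 0)"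
    if "i < CARD('p)" "j < CARD('p)" for i j k A
    using that
  proof (induction k arbitrary: i)
    case (Suc k)
    then show ?case by (auto simp: mult.assoc nth)
  qed simp
  have vac: "smat_nth ?P i j = (if i = 0 \<and> j = 0 then 1 else 0)" if "i < CARD('p)" "j < CARD('p)" for i j
  proof (cases i)
    case 0
    \<comment> \<open>Row 0 of Z^k vanishes unless k = 0, so only the leading term
      contributes.\<close>
    have "smat_nth ?P i j = (\<Sum>k<CARD('p). if k = 0 then (if j = 0 then 1 else 0) else 0)"
      unfolding weyl_vacuum_def smat_nth_sum[OF that]
      by (rule sum.cong) (use that in \<open>auto simp: Zpow 0 vacuum_coeff_def scaleC_one\<close>)
    then show ?thesis using 0 by simp
  next
    case (Suc l)
    \<comment> \<open>D moves row i to row i - 1 with a nonzero factor and annihilates the vacuum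
      element, so all rows of the latter but the top one vanish.\<close>
    have "smat_nth (?D * ?P) l j = 0"
      using that Suc by (simp add: weyl_pair_d_vacuum[OF weyl_pair_mat[OF assms]])
    then show ?thesis
      using that Suc q_coeff_nonzero[where 'p='p, of i] by (simp add: nth)
  qed
  have Dpow: "smat_nth (?P * scalar_smat r * ?D ^ k) i j = (if i = 0 \<and> j = k then q_coeff_fact TYPE('p) k *\<^sub>C r else 0)"
    if "i < CARD('p)" "j < CARD('p)" for i j k r
    using that
  proof (induction k arbitrary: j)
    case 0
    then show ?case by (simp add: vac q_coeff_fact_def scaleC_one)
  next
    case (Suc k)
    have "smat_nth (?P * scalar_smat r * ?D ^ Suc k) i j = smat_nth ((?P * scalar_smat r * ?D ^ k) * ?D) i j"
      by (simp only: power_Suc2 mult.assoc)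
    with Suc show ?case
      by (auto simp: nth q_coeff_fact_def scaleC_scaleC mult.commute simp del: power_Suc)
  qed
  show ?thesis
  proof (rule smat_eqI)
    fix i j assume ij: "i < CARD('p)" "j < CARD('p)"
    have row: "smat_nth (weyl_row TYPE('p) scalar_smat ?Z ?D f) l j = (if l = 0 then f j else 0)"
      if "l < CARD('p)" for l f
    proof -
      have "smat_nth (weyl_row TYPE('p) scalar_smat ?Z ?D f) l j = (\<Sum>k<CARD('p). if k = j then (if l = 0 then f k else 0) else 0)"
        unfolding weyl_row_def smat_nth_sum[OF that ij(2)]
        by (rule sum.cong) (use that ij q_coeff_fact_nonzero[where 'p='p, of j] in \<open>auto simp: Dpow scaleC_scaleC scaleC_one\<close>)
      then show ?thesis using ij by simp
    qed
    have "smat_nth (smat_lift scalar_smat ?Z ?D X) i j = (\<Sum>k<CARD('p). if k = i then smat_nth X k j else 0)"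
      unfolding smat_lift_def smat_nth_sum[OF ij]
      by (rule sum.cong) (use ij in \<open>auto simp: Zpow row\<close>)
    then show "smat_nth (smat_lift scalar_smat ?Z ?D X) i j = smat_nth X i j"
      using ij by simp
  qed
qed

text \<open>Read off from \<open>smat_lift_self\<close>: reassociated, its expression is built from
  1 by sums and left multiplications alone.\<close>

lemma smat_induct [consumes 1, case_names one add scalar Z D]:
  fixes X :: "('r::{complex_algebra_1, comm_ring_1}, 'p::finite) smat"
  assumes p: "CARD('p) \<ge> 2"
    and one: "P 1" and add: "\<And>X Y. P X \<Longrightarrow> P Y \<Longrightarrow> P (X + Y)"
    and scalar: "\<And>r X. P X \<Longrightarrow> P (scalar_smat r * X)"
    and Z: "\<And>X. P X \<Longrightarrow> P (mat_Z * X)" and D: "\<And>X. P X \<Longrightarrow> P (mat_D * X)"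
  shows "P X"
proof -
  have 0: "P 0"
    using scalar[OF one, of 0] algebra_homD(1)[OF algebra_hom_scalar_smat[where 'a='r and 'p='p]]
    by (simp add: clinear_zero)
  have sum: "P (\<Sum>i\<in>A. f i)" if "\<And>i. P (f i)" for A :: "nat set" and f
    by (induction A rule: infinite_finite_induct) (simp_all add: 0 add that)
  have scale: "P (c *\<^sub>C X)" if "P X" for c X
    using scalar[OF that, of "c *\<^sub>C 1"] algebra_homD[OF algebra_hom_scalar_smat[where 'a='r and 'p='p]]
    by (simp add: clinear_scale mult_scaleC_left)
  have Zpow: "P (mat_Z ^ k * X)" and Dpow: "P (mat_D ^ k * X)" if "P X" for k X
    using that by (induction k) (simp_all add: mult.assoc Z D)
  have vac: "P (weyl_vacuum TYPE('p) mat_Z mat_D * X)" if "P X" for X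
    unfolding weyl_vacuum_def sum_distrib_right mult_scaleC_left mult.assoc
    by (intro sum scale Zpow Dpow that)
  have "P (mat_D ^ k)" for k using Dpow[OF one, of k] by simp
  then have "P (smat_lift scalar_smat mat_Z mat_D X)"
    unfolding smat_lift_def weyl_row_def mult.assoc by (intro sum Zpow scale vac scalar)
  then show ?thesis by (simp only: smat_lift_self[OF p])
qed

lemma smat_hom_ext:
  fixes \<phi> \<psi> :: "('r::{complex_algebra_1, comm_ring_1}, 'p::finite) smat \<Rightarrow> 'b::complex_algebra_1"
  assumes "CARD('p) \<ge> 2" "algebra_hom \<phi>" "algebra_hom \<psi>" "\<phi> mat_Z = \<psi> mat_Z" "\<phi> mat_D = \<psi> mat_D"
    and "\<And>r. \<phi> (scalar_smat r) = \<psi> (scalar_smat r)"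
  shows "\<phi> = \<psi>"
proof
  fix X
  show "\<phi> X = \<psi> X"
    using assms(1)
    by (induction X rule: smat_induct)
      (simp_all add: algebra_homD[OF assms(2)] algebra_homD[OF assms(3)] assms(4-6)
        clinear_add[OF algebra_homD(1)[OF assms(2)]] clinear_add[OF algebra_homD(1)[OF assms(3)]])
qed

lemma commute_power: "x * y = y * x \<Longrightarrow> x * y ^ n = y ^ n * x" for x y :: "'a::monoid_mult"
  by (rule power_commuting_commutes[symmetric]) simp

text \<open>The universal property of the presentation. The candidate map is linear, respects left
  multiplication by scalars, Z and D, and sends 1 to 1; induction on the left factor then gives
  multiplicativity, and relations between matrix units need not be checked.\<close>

lemma smat_lift:
  fixes ev :: "'r::{complex_algebra_1, comm_ring_1} \<Rightarrow> 'b::complex_algebra_1" and z d :: 'b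
  assumes p: "CARD('p::finite) \<ge> 2" and wp: "weyl_pair TYPE('p) z d" and ev: "algebra_hom ev"
    and comm: "\<And>r. ev r * z = z * ev r" "\<And>r. ev r * d = d * ev r"
  shows "algebra_hom (smat_lift ev z d :: ('r, 'p) smat \<Rightarrow> 'b)"
    "smat_lift ev z d (mat_Z :: ('r, 'p) smat) = z" "smat_lift ev z d (mat_D :: ('r, 'p) smat) = d"
    "smat_lift ev z d (scalar_smat r :: ('r, 'p) smat) = ev r"
proof -
  obtain m where m: "CARD('p) = Suc m"
    using zero_less_card_finite[where 'a='p] by (cases "CARD('p)") auto
  let ?P = "weyl_vacuum TYPE('p) z d"
  define \<rho> where "\<rho> = weyl_row TYPE('p) ev z d"
  define \<phi> where "\<phi> X = smat_lift ev z d X" for X :: "('r, 'p) smat"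
  have \<phi>: "\<phi> X = (\<Sum>i<CARD('p). z ^ i * \<rho> (smat_nth X i))" for X
    by (simp add: \<phi>_def \<rho>_def smat_lift_def)
  note ev_lin = algebra_homD(1)[OF ev]
  have \<rho>_add: "\<rho> (\<lambda>j. f j + g j) = \<rho> f + \<rho> g" and \<rho>_scale: "\<rho> (\<lambda>j. c *\<^sub>C f j) = c *\<^sub>C \<rho> f" for f g c
    by (simp_all add: \<rho>_def weyl_row_def clinear_add[OF ev_lin] clinear_scale[OF ev_lin] alg_simps
        distrib_left distrib_right sum.distrib complex_space.scale_sum_right mult.commute)
  have \<rho>_zero: "\<rho> (\<lambda>j. 0) = 0"
    by (simp add: \<rho>_def weyl_row_def clinear_zero[OF ev_lin])
  have \<rho>_cong: "\<rho> f = \<rho> g" if "\<And>j. j < CARD('p) \<Longrightarrow> f j = g j" for f g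
    using that by (simp add: \<rho>_def weyl_row_def)
  have evz: "ev r * z ^ n = z ^ n * ev r" and evd: "ev r * d ^ n = d ^ n * ev r" for r n
    by (rule commute_power, rule comm)+
  have ev_vac: "ev r * ?P = ?P * ev r" for r
    unfolding weyl_vacuum_def sum_distrib_left sum_distrib_right mult_scaleC_left mult_scaleC_right
  proof (rule sum.cong)
    fix k
    have "ev r * (z ^ k * d ^ k) = z ^ k * (ev r * d ^ k)" by (simp only: mult.assoc[symmetric] evz)
    then show "vacuum_coeff TYPE('p) k *\<^sub>C (ev r * (z ^ k * d ^ k)) = vacuum_coeff TYPE('p) k *\<^sub>C (z ^ k * d ^ k * ev r)"
      by (simp only: evd mult.assoc)
  qed simp
  have \<rho>_mult: "\<rho> (\<lambda>j. r * f j) = ev r * \<rho> f" for r f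
  proof -
    have "?P * ev (r * f j) * d ^ j = ev r * (?P * ev (f j) * d ^ j)" for j
      by (simp only: algebra_homD(3)[OF ev] mult.assoc[symmetric] ev_vac)
    then show ?thesis
      by (simp only: \<rho>_def weyl_row_def sum_distrib_left mult_scaleC_right)
  qed
  have d_\<rho>: "d * \<rho> f = 0" for f
    unfolding \<rho>_def weyl_row_def sum_distrib_left mult_scaleC_right mult.assoc[symmetric]
    by (simp add: weyl_pair_d_vacuum[OF wp])
  have lin: "clinear \<phi>"
  proof (rule clinearI)
    fix X Y :: "('r, 'p) smat" and c
    have "\<rho> (smat_nth (X + Y) i) = \<rho> (smat_nth X i) + \<rho> (smat_nth Y i)"
      "\<rho> (smat_nth (c *\<^sub>C X) i) = c *\<^sub>C \<rho> (smat_nth X i)" if "i < CARD('p)" for i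
      unfolding \<rho>_add[symmetric] \<rho>_scale[symmetric] by (rule \<rho>_cong, simp add: that)+
    then show "\<phi> (X + Y) = \<phi> X + \<phi> Y" "\<phi> (c *\<^sub>C X) = c *\<^sub>C \<phi> X"
      by (simp_all add: \<phi> distrib_left sum.distrib mult_scaleC_right complex_space.scale_sum_right)
  qed
  have \<phi>_scalar: "\<phi> (scalar_smat r * X) = ev r * \<phi> X" for r X
  proof -
    have "\<rho> (smat_nth (scalar_smat r * X) i) = ev r * \<rho> (smat_nth X i)" if "i < CARD('p)" for i
      unfolding \<rho>_mult[symmetric] by (rule \<rho>_cong) (simp add: that)
    then show ?thesis
      by (simp add: \<phi> sum_distrib_left evz flip: mult.assoc)
  qed
  have \<phi>_Z: "\<phi> (mat_Z * X) = z * \<phi> X" for X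
  proof -
    have row: "\<rho> (smat_nth (mat_Z * X) i) = (if i = 0 then 0 else \<rho> (smat_nth X (i - 1)))" if "i < Suc m" for i
    proof -
      have "\<rho> (smat_nth (mat_Z * X) i) = \<rho> (if i = 0 then (\<lambda>j. 0) else smat_nth X (i - 1))"
        by (rule \<rho>_cong) (use that in \<open>simp add: m smat_nth_mat_Z_mult\<close>)
      then show ?thesis by (simp add: \<rho>_zero)
    qed
    \<comment> \<open>The last row of X is lost in Z X; correspondingly its contribution to z
      \<phi>(X) carries z^p = 0.\<close>
    have "z ^ Suc m = 0" using wp by (simp add: weyl_pair_def m)
    then have "z * (z ^ m * x) = 0" for x by (simp flip: mult.assoc)
    then have "z * \<phi> X = (\<Sum>i<m. z ^ Suc i * \<rho> (smat_nth X i))"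
      unfolding \<phi> m by (simp add: distrib_left sum_distrib_left mult.assoc)
    also have "\<dots> = \<phi> (mat_Z * X)"
      unfolding \<phi> m sum.lessThan_Suc_shift by (simp add: row)
    finally show ?thesis by simp
  qed
  have \<phi>_D: "\<phi> (mat_D * X) = d * \<phi> X" for X
  proof -
    have row: "\<rho> (smat_nth (mat_D * X) i) = (if i < m then q_coeff TYPE('p) (Suc i) *\<^sub>C \<rho> (smat_nth X (Suc i)) else 0)" if "i < Suc m" for i
    proof -
      have "\<rho> (smat_nth (mat_D * X) i) = \<rho> (if i < m then (\<lambda>j. q_coeff TYPE('p) (Suc i) *\<^sub>C smat_nth X (Suc i) j) else (\<lambda>j. 0))"
        by (rule \<rho>_cong) (use that in \<open>simp add: m smat_nth_mat_D_mult[OF p]\<close>)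
      then show ?thesis by (simp add: \<rho>_zero \<rho>_scale)
    qed
    \<comment> \<open>As d annihilates \<rho> f, only the derivative term of d z^i survives; at i =
      0 its coefficient is 0.\<close>
    have "d * (z ^ i * \<rho> f) = q_coeff TYPE('p) i *\<^sub>C (z ^ (i - 1) * \<rho> f)" for i f
    proof -
      have "d * (z ^ i * \<rho> f) = (d * z ^ i) * \<rho> f" by (simp only: mult.assoc)
      then show ?thesis
        unfolding weyl_pair_d_z_power[OF wp] by (simp add: distrib_right mult_scaleC_left mult.assoc d_\<rho>)
    qed
    then have "d * \<phi> X = (\<Sum>i<Suc m. q_coeff TYPE('p) i *\<^sub>C (z ^ (i - 1) * \<rho> (smat_nth X i)))"
      unfolding \<phi> m by (simp only: sum_distrib_left)
    also have "\<dots> = (\<Sum>i<m. z ^ i * \<rho> (smat_nth (mat_D * X) i))"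
      unfolding sum.lessThan_Suc_shift by (simp add: row mult_scaleC_right)
    also have "\<dots> = \<phi> (mat_D * X)"
      unfolding \<phi> m by (simp add: row)
    finally show ?thesis by simp
  qed
  have \<phi>_1: "\<phi> 1 = 1"
  proof -
    let ?c = "vacuum_coeff TYPE('p)" and ?N = "q_coeff_fact TYPE('p)"
    \<comment> \<open>Expanding the vacuum element makes \<phi> 1 a sum of multiples of z^n d^n with
      n = i + k. Terms with n \<ge> p vanish by nilpotency, and for 0 < n < p the coefficients add
      up to the vanishing convolution.\<close>
    define b where "b i k = (?c k / ?N i) *\<^sub>C (z ^ (i + k) * d ^ (i + k))" for i k
    have b0: "b i k = 0" if "i + k \<ge> CARD('p)" for i k
    proof -
      have "z ^ (i + k) = z ^ CARD('p) * z ^ (i + k - CARD('p))"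
        using that by (simp flip: power_add)
      then show ?thesis using wp by (simp add: b_def weyl_pair_def)
    qed
    have "z ^ i * \<rho> (smat_nth (1 :: ('r, 'p) smat) i) = (\<Sum>k<CARD('p). b i k)" if i: "i < CARD('p)" for i
    proof -
      have "\<rho> (smat_nth (1 :: ('r, 'p) smat) i) = (\<Sum>j<CARD('p). if j = i then inverse (?N i) *\<^sub>C (?P * d ^ i) else 0)"
        unfolding \<rho>_def weyl_row_def
        by (rule sum.cong) (use i in \<open>auto simp: algebra_homD[OF ev] clinear_zero[OF ev_lin]\<close>)
      also have "\<dots> = inverse (?N i) *\<^sub>C (?P * d ^ i)"
        using i by simp
      also have "z ^ i * \<dots> = (\<Sum>k<CARD('p). b i k)"
        unfolding weyl_vacuum_def sum_distrib_left sum_distrib_right complex_space.scale_sum_right mult_scaleC_right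
      proof (rule sum.cong)
        fix k
        have "d ^ k * d ^ i = d ^ (i + k)" by (simp add: add.commute flip: power_add)
        then show "inverse (?N i) *\<^sub>C (z ^ i * (?c k *\<^sub>C (z ^ k * d ^ k) * d ^ i)) = b i k"
          by (simp add: b_def mult_scaleC_left mult_scaleC_right scaleC_scaleC mult.assoc power_add divide_inverse mult.commute[of "?c k"])
      qed simp
      finally show ?thesis .
    qed
    then have "\<phi> 1 = (\<Sum>i<CARD('p). \<Sum>k<CARD('p). b i k)"
      by (simp add: \<phi>)
    also have "\<dots> = (\<Sum>(i, k)\<in>{..<CARD('p)} \<times> {..<CARD('p)}. b i k)"
      by (rule sum.cartesian_product)
    also have "\<dots> = (\<Sum>(i, k)\<in>{(i, k). i + k < CARD('p)}. b i k)"
      by (rule sum.mono_neutral_right) (auto intro: b0)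
    also have "\<dots> = (\<Sum>n<CARD('p). \<Sum>i\<le>n. b i (n - i))"
      by (rule sum.triangle_reindex)
    also have "\<dots> = (\<Sum>n<CARD('p). if n = 0 then 1 else 0)"
    proof (rule sum.cong)
      fix n assume n: "n \<in> {..<CARD('p)}"
      have "(\<Sum>i\<le>n. b i (n - i)) = (\<Sum>k\<le>n. b (n - k) k)"
        by (rule sum.reindex_bij_witness[of _ "\<lambda>k. n - k" "\<lambda>k. n - k"]) auto
      also have "\<dots> = (\<Sum>k\<le>n. ?c k / ?N (n - k)) *\<^sub>C (z ^ n * d ^ n)"
        by (simp add: b_def complex_space.scale_sum_left)
      also have "\<dots> = (if n = 0 then 1 else 0)"
        using n vacuum_coeff_convolution[where 'p='p, of n]
        by (auto simp: vacuum_coeff_def q_coeff_fact_def scaleC_one)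
      finally show "(\<Sum>i\<le>n. b i (n - i)) = (if n = 0 then 1 else 0)" .
    qed simp
    also have "\<dots> = 1" by simp
    finally show ?thesis .
  qed
  have gens: "\<phi> mat_Z = z" "\<phi> mat_D = d" "\<phi> (scalar_smat r) = ev r" for r
    using \<phi>_Z[of 1] \<phi>_D[of 1] \<phi>_scalar[of r 1] by (simp_all add: \<phi>_1)
  have mult: "\<phi> (X * Y) = \<phi> X * \<phi> Y" for X Y
    using p
    by (induction X rule: smat_induct)
      (simp_all add: \<phi>_1 distrib_right clinear_add[OF lin] \<phi>_scalar \<phi>_Z \<phi>_D mult.assoc)
  show "algebra_hom (smat_lift ev z d :: ('r, 'p) smat \<Rightarrow> 'b)"
    using algebra_homI[OF lin \<phi>_1 mult] by (simp add: \<phi>_def[abs_def])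
  show "smat_lift ev z d (mat_Z :: ('r, 'p) smat) = z" "smat_lift ev z d (mat_D :: ('r, 'p) smat) = d"
    "smat_lift ev z d (scalar_smat r :: ('r, 'p) smat) = ev r"
    using gens by (simp_all add: \<phi>_def)
qed

section \<open>The action and the coaction on matrices\<close>

lift_definition left_mult :: "'a::complex_algebra_1 \<Rightarrow> 'a endo" is "\<lambda>a x. a * x"
  by (intro clinear_mult_left clinear_id)

lemma left_mult_simps:
  "left_mult 1 = 1" "left_mult 0 = 0" "left_mult a * left_mult b = left_mult (a * b)"
  "left_mult a + left_mult b = left_mult (a + b)" "left_mult a - left_mult b = left_mult (a - b)"
  "c *\<^sub>C left_mult a = left_mult (c *\<^sub>C a)"
  by (transfer; simp add: fun_eq_iff algebra_simps mult_scaleC_left)+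

lemma left_mult_power: "left_mult a ^ n = left_mult (a ^ n)"
  by (induction n) (simp_all add: left_mult_simps)

lemma right_left_mult: "right_mult b * left_mult a = left_mult a * right_mult b"
  by transfer (simp add: mult.assoc)

lemma qq_powi_period: "(\<qq> TYPE('p::finite) powi k) ^ (2 * CARD('p)) = 1"
proof -
  have "(\<qq> TYPE('p) powi k) ^ (2 * CARD('p)) = (\<qq> TYPE('p) ^ (2 * CARD('p))) powi k"
    by (simp only: power_int_power power_int_power' mult.commute)
  then show ?thesis by (simp only: qq_power power_int_1_left)
qed

abbreviation qsq :: "'p::finite itself \<Rightarrow> complex" where
  "qsq p \<equiv> (\<qq> p)\<^sup>2"

abbreviation qdiff :: "'p::finite itself \<Rightarrow> complex" where
  "qdiff p \<equiv> \<qq> p - inverse (\<qq> p)"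

lemma q_cancel: "(\<qq> p)\<^sup>2 * qw p = 1" "qw p * (\<qq> p)\<^sup>2 = 1"
  by (simp_all add: power_inverse)

section \<open>The action as a homomorphism into the endomorphisms\<close>

definition K_action :: "('r::complex_algebra_1 \<Rightarrow> 'r) \<Rightarrow> ('r, 'p::finite) smat \<Rightarrow> ('r, 'p) smat" where
  "K_action \<sigma> X = smat (\<lambda>i j. (\<qq> TYPE('p) powi (2 * (int i - int j))) *\<^sub>C \<sigma> (smat_nth X i j))"

definition is_matrix_action ::
  "('r::complex_algebra_1 \<Rightarrow> 'r) \<Rightarrow> ('p::finite uq \<Rightarrow> ('r, 'p) smat \<Rightarrow> ('r, 'p) smat) \<Rightarrow> bool" where
  "is_matrix_action \<sigma> act \<longleftrightarrow> is_module_action act \<and>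
    (let c = inverse (\<qq> TYPE('p) - inverse (\<qq> TYPE('p))) in
     \<forall>X. act uq_K X = K_action \<sigma> X \<and>
         act uq_E X = c *\<^sub>C (X * mat_Z - mat_Z * act uq_K X) \<and>
         act uq_F X = c *\<^sub>C (mat_D * X - act uq_Kinv X * mat_D))"

definition is_matrix_coaction ::
  "(('r::complex_algebra_1, 'p::finite) smat \<Rightarrow> ('p uq, ('r, 'p) smat) tensor) \<Rightarrow> bool" where
  "is_matrix_coaction \<delta> \<longleftrightarrow> algebra_hom \<delta> \<and>
    (let s = \<qq> TYPE('p) - inverse (\<qq> TYPE('p)) in
     (\<forall>r. \<delta> (scalar_smat r) = 1 \<otimes>\<^sub>t scalar_smat r) \<and>
     \<delta> mat_Z = uq_Kinv \<otimes>\<^sub>t mat_Z - s *\<^sub>C ((uq_E * uq_Kinv) \<otimes>\<^sub>t 1) \<and>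
     \<delta> mat_D = uq_Kinv \<otimes>\<^sub>t mat_D + s *\<^sub>C (uq_F \<otimes>\<^sub>t 1))"

text \<open>The period 2p of \<sigma> is what K^(2p) = 1 demands of the coefficients.\<close>

locale scalar_automorphism =
  fixes \<sigma> :: "'r::{complex_algebra_1, comm_ring_1} \<Rightarrow> 'r" and p :: "'p::finite itself"
  assumes card: "CARD('p) \<ge> 2" and \<sigma>_hom: "algebra_hom \<sigma>" and \<sigma>_period: "(\<sigma> ^^ (2 * CARD('p))) r = r"
begin

abbreviation Z :: "('r, 'p) smat" where "Z \<equiv> mat_Z"
abbreviation D :: "('r, 'p) smat" where "D \<equiv> mat_D"
lemma qdiff_nonzero: "qdiff TYPE('p) \<noteq> 0"
  by (rule qq_diff_nonzero[OF card])

lemma D_Z: "D * Z = qw TYPE('p) *\<^sub>C (Z * D) + qdiff TYPE('p) *\<^sub>C 1" and Z_power: "Z ^ CARD('p) = 0" and D_power: "D ^ CARD('p) = 0"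
  using weyl_pair_mat[where 'p='p and 'a='r, OF card] unfolding weyl_pair_def by blast+

lemma smat_nth_K_action:
  "i < CARD('p) \<Longrightarrow> j < CARD('p) \<Longrightarrow>
    smat_nth (K_action \<sigma> X :: ('r, 'p) smat) i j = (\<qq> TYPE('p) powi (2 * (int i - int j))) *\<^sub>C \<sigma> (smat_nth X i j)"
  by (simp add: K_action_def)

text \<open>K acts by \<sigma> on the entries followed by conjugation with the diagonal matrix of
  powers of q^2; in entries, q^(2(i-j)) factors through every intermediate index k.\<close>

lemma K_action_hom: "algebra_hom (K_action \<sigma> :: ('r, 'p) smat \<Rightarrow> _)"
proof (intro algebra_homI clinearI)
  note \<sigma> = algebra_homD[OF \<sigma>_hom] clinear_add[OF algebra_homD(1)[OF \<sigma>_hom]]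
    clinear_scale[OF algebra_homD(1)[OF \<sigma>_hom]] clinear_zero[OF algebra_homD(1)[OF \<sigma>_hom]]
    clinear_sum_apply[OF algebra_homD(1)[OF \<sigma>_hom]]
  fix X Y :: "('r, 'p) smat" and c
  show "K_action \<sigma> (X + Y) = K_action \<sigma> X + K_action \<sigma> Y"
    by (rule smat_eqI) (simp add: smat_nth_K_action \<sigma> scaleC_add_right)
  show "K_action \<sigma> (c *\<^sub>C X) = c *\<^sub>C K_action \<sigma> X"
    by (rule smat_eqI) (simp add: smat_nth_K_action \<sigma> scaleC_scaleC mult.commute)
  show "K_action \<sigma> 1 = (1 :: ('r, 'p) smat)"
    by (rule smat_eqI) (simp add: smat_nth_K_action \<sigma> scaleC_one)
  show "K_action \<sigma> (X * Y) = K_action \<sigma> X * K_action \<sigma> Y"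
  proof (rule smat_eqI)
    fix i j assume ij: "i < CARD('p)" "j < CARD('p)"
    have "\<qq> TYPE('p) powi (2 * (int i - int j)) =
        \<qq> TYPE('p) powi (2 * (int k - int j)) * \<qq> TYPE('p) powi (2 * (int i - int k))" for k
      by (subst power_int_add[symmetric]) (simp_all add: algebra_simps)
    then show "smat_nth (K_action \<sigma> (X * Y)) i j = smat_nth (K_action \<sigma> X * K_action \<sigma> Y) i j"
      using ij by (auto simp: smat_nth_K_action smat_nth_mult \<sigma> complex_space.scale_sum_right
          mult_scaleC_left mult_scaleC_right scaleC_scaleC intro!: sum.cong)
  qed
qed

lemma K_action_Z: "K_action \<sigma> Z = qsq TYPE('p) *\<^sub>C Z"
  by (rule smat_eqI)
    (auto simp: smat_nth_K_action smat_nth_mat_Z algebra_homD[OF \<sigma>_hom] clinear_zero[OF algebra_homD(1)[OF \<sigma>_hom]])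

lemma K_action_D: "K_action \<sigma> D = qw TYPE('p) *\<^sub>C D"
  by (rule smat_eqI)
    (auto simp: smat_nth_K_action smat_nth_mat_D[OF card] algebra_homD[OF \<sigma>_hom] scaleC_scaleC
      clinear_scale[OF algebra_homD(1)[OF \<sigma>_hom]] clinear_zero[OF algebra_homD(1)[OF \<sigma>_hom]] power_int_minus power_inverse)

lemma K_action_scalar: "K_action \<sigma> (scalar_smat r :: ('r, 'p) smat) = scalar_smat (\<sigma> r)"
  by (rule smat_eqI) (auto simp: smat_nth_K_action scaleC_one clinear_zero[OF algebra_homD(1)[OF \<sigma>_hom]])

lemma K_action_period: "(K_action \<sigma> ^^ (2 * CARD('p))) X = (X :: ('r, 'p) smat)"
proof (rule smat_eqI)
  fix i j assume ij: "i < CARD('p)" "j < CARD('p)"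
  have "smat_nth ((K_action \<sigma> ^^ n) X) i j = (\<qq> TYPE('p) powi (2 * (int i - int j))) ^ n *\<^sub>C (\<sigma> ^^ n) (smat_nth X i j)" for n
    by (induction n)
      (use ij in \<open>simp_all add: smat_nth_K_action scaleC_one clinear_scale[OF algebra_homD(1)[OF \<sigma>_hom]] scaleC_scaleC\<close>)
  then show "smat_nth ((K_action \<sigma> ^^ (2 * CARD('p))) X) i j = smat_nth X i j"
    by (simp only: qq_powi_period \<sigma>_period scaleC_one)
qed

definition T :: "('r, 'p) smat endo" where "T = Endo (K_action \<sigma>)"
definition T' :: "('r, 'p) smat endo" where "T' = T ^ (2 * CARD('p) - 1)"

lemma T_apply: "endo_apply T = K_action \<sigma>"
  unfolding T_def by (rule endo_apply_Endo[OF algebra_homD(1)[OF K_action_hom]])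

lemma T_period: "T ^ (2 * CARD('p)) = 1"
  by (rule endo_eqI) (simp only: endo_apply_power T_apply K_action_period one_endo.rep_eq)

lemma T_T': "T * T' = 1" "T' * T = 1"
  unfolding T'_def by (rule power_card_inverse[OF T_period])+

text \<open>T is an automorphism with Z and D as eigenvectors, of eigenvalues q^2 and q^-2; so it
  passes the multiplications by them up to these scalars.\<close>

lemma T_commute:
  "T * left_mult Z = qsq TYPE('p) *\<^sub>C (left_mult Z * T)" "T * right_mult Z = qsq TYPE('p) *\<^sub>C (right_mult Z * T)"
  "T * left_mult D = qw TYPE('p) *\<^sub>C (left_mult D * T)" "T * right_mult D = qw TYPE('p) *\<^sub>C (right_mult D * T)"
  by (rule endo_eqI, simp add: endo_apply_simps T_apply left_mult.rep_eq right_mult.rep_eq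
      algebra_homD[OF K_action_hom] K_action_Z K_action_D mult_scaleC_left mult_scaleC_right)+

lemma T'_commute:
  "T' * left_mult Z = qw TYPE('p) *\<^sub>C (left_mult Z * T')" "T' * right_mult Z = qw TYPE('p) *\<^sub>C (right_mult Z * T')"
  "T' * left_mult D = qsq TYPE('p) *\<^sub>C (left_mult D * T')" "T' * right_mult D = qsq TYPE('p) *\<^sub>C (right_mult D * T')"
  using T_commute[THEN scale_commute_inverse, OF T_T']
  by (simp_all add: scaleC_scaleC q_cancel scaleC_one)

lemma matrix_rep:
  "uq_rep TYPE('p) (inverse (qdiff TYPE('p)) *\<^sub>C (right_mult Z - left_mult Z * T)) T
    (inverse (qdiff TYPE('p)) *\<^sub>C (left_mult D - right_mult D * T'))" (is "uq_rep _ ?e T ?f")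
proof (rule uq_repI[OF T_period T_T'(1)])
  have assoc: "T * (left_mult Z * x) = qsq TYPE('p) *\<^sub>C (left_mult Z * (T * x))" "T * (right_mult D * x) = qw TYPE('p) *\<^sub>C (right_mult D * (T * x))"
    "T * (left_mult D * x) = qw TYPE('p) *\<^sub>C (left_mult D * (T * x))"
    "T' * (left_mult Z * x) = qw TYPE('p) *\<^sub>C (left_mult Z * (T' * x))" "T' * (right_mult D * x) = qsq TYPE('p) *\<^sub>C (right_mult D * (T' * x))"
    "T' * (right_mult Z * x) = qw TYPE('p) *\<^sub>C (right_mult Z * (T' * x))" for x
    by (simp_all only: mult.assoc[symmetric] T_commute T'_commute mult_scaleC_left)
  show "T * ?e = qsq TYPE('p) *\<^sub>C (?e * T)"
    by (simp add: alg_simps left_diff_distrib right_diff_distrib mult.assoc T_commute assoc mult.commute)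
  show "?f * T = qsq TYPE('p) *\<^sub>C (T * ?f)"
    by (simp add: alg_simps left_diff_distrib right_diff_distrib mult.assoc T_commute assoc T_T' mult.left_commute[of "qsq TYPE('p)"] q_cancel)
  have lr: "right_mult b * (left_mult a * x) = left_mult a * (right_mult b * x)" for a b x
    by (simp only: mult.assoc[symmetric] right_left_mult)
  have l: "left_mult D * left_mult Z = qw TYPE('p) *\<^sub>C (left_mult Z * left_mult D) + qdiff TYPE('p) *\<^sub>C 1"
    by (simp only: left_mult_simps(3-6) left_mult_simps(1)[symmetric] D_Z)
  have r: "right_mult Z * right_mult D = qw TYPE('p) *\<^sub>C (right_mult D * right_mult Z) + qdiff TYPE('p) *\<^sub>C 1"
    by (simp only: right_mult_simps(3-6) right_mult_simps(1)[symmetric] D_Z)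
  have l': "left_mult D * (left_mult Z * x) = qw TYPE('p) *\<^sub>C (left_mult Z * (left_mult D * x)) + qdiff TYPE('p) *\<^sub>C x"
    and r': "right_mult Z * (right_mult D * x) = qw TYPE('p) *\<^sub>C (right_mult D * (right_mult Z * x)) + qdiff TYPE('p) *\<^sub>C x" for x
    by (simp_all only: mult.assoc[symmetric] l r distrib_right mult_scaleC_left mult_1_left)
  \<comment> \<open>Products of a left with a right multiplication cancel in the commutator. The two
    other pairs are instances of the Weyl relation, for left multiplications next to T and for right
    multiplications next to T', and contribute q - q^-1 times T and -T'.\<close>
  have "(right_mult Z - left_mult Z * T) * (left_mult D - right_mult D * T') =
      (left_mult D - right_mult D * T') * (right_mult Z - left_mult Z * T) + qdiff TYPE('p) *\<^sub>C (T - T')"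
    by (simp add: distrib_left distrib_right left_diff_distrib right_diff_distrib mult.assoc mult_scaleC_left mult_scaleC_right
        T_commute T'_commute assoc T_T' right_left_mult lr l' r' complex_space.scale_right_diff_distrib)
  then show "?e * ?f = ?f * ?e + inverse (qdiff TYPE('p)) *\<^sub>C (T - T')"
    using qdiff_nonzero by (simp add: mult_scaleC_left mult_scaleC_right scaleC_scaleC scaleC_add_right)
  have "(right_mult Z + - (left_mult Z * T)) ^ CARD('p) = 0"
  proof (rule quantum_binomial_nilpotent[where w = "qsq TYPE('p)"])
    show "- (left_mult Z * T) * right_mult Z = qsq TYPE('p) *\<^sub>C (right_mult Z * - (left_mult Z * T))"
      by (simp add: mult.assoc T_commute lr mult_scaleC_right)
    show "right_mult Z ^ CARD('p) = 0"
      by (simp add: right_mult_power Z_power right_mult_simps)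
    show "(- (left_mult Z * T)) ^ CARD('p) = 0"
      using scale_commute_power_mult[OF T_commute(1), of "CARD('p)"]
      by (auto simp: power_uminus_scaleC[where 'a = "('r, 'p) smat endo"] left_mult_power Z_power left_mult_simps)
  qed (auto simp: qq_square_power_eq_1_iff dest: dvd_imp_le)
  then show "?e ^ CARD('p) = 0"
    by (simp add: power_scaleC)
  have "(left_mult D + - (right_mult D * T')) ^ CARD('p) = 0"
  proof (rule quantum_binomial_nilpotent[where w = "qsq TYPE('p)"])
    show "- (right_mult D * T') * left_mult D = qsq TYPE('p) *\<^sub>C (left_mult D * - (right_mult D * T'))"
      by (simp add: mult.assoc T'_commute lr mult_scaleC_right)
    show "left_mult D ^ CARD('p) = 0"
      by (simp add: left_mult_power D_power left_mult_simps)
    show "(- (right_mult D * T')) ^ CARD('p) = 0"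
      using scale_commute_power_mult[OF T'_commute(4), of "CARD('p)"]
      by (auto simp: power_uminus_scaleC[where 'a = "('r, 'p) smat endo"] right_mult_power D_power right_mult_simps)
  qed (auto simp: qq_square_power_eq_1_iff dest: dvd_imp_le)
  then show "?f ^ CARD('p) = 0"
    by (simp add: power_scaleC)
qed

definition matrix_action :: "'p uq \<Rightarrow> ('r, 'p) smat \<Rightarrow> ('r, 'p) smat" where
  "matrix_action h = endo_apply (uq_lift (inverse (qdiff TYPE('p)) *\<^sub>C (right_mult Z - left_mult Z * T)) T
    (inverse (qdiff TYPE('p)) *\<^sub>C (left_mult D - right_mult D * T')) h)"

lemma is_matrix_action: "is_matrix_action \<sigma> matrix_action"
proof -
  note \<phi> = uq_lift[OF matrix_rep]
  note hom = algebra_homD[OF \<phi>(1)] clinear_add[OF algebra_homD(1)[OF \<phi>(1)]] clinear_scale[OF algebra_homD(1)[OF \<phi>(1)]]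
  have "cbilinear matrix_action"
    by (rule cbilinearI) (simp_all add: matrix_action_def hom endo_apply_simps
        clinear_add[OF clinear_endo_apply] clinear_scale[OF clinear_endo_apply])
  moreover have "matrix_action 1 X = X" "matrix_action (g * h) X = matrix_action g (matrix_action h X)" for g h X
    by (simp_all add: matrix_action_def hom endo_apply_simps)
  moreover have Kinv: "matrix_action uq_Kinv X = endo_apply T' X" for X
    unfolding matrix_action_def
    by (subst uq_hom_Kinv_unique[OF \<phi>(1), of T']) (simp_all add: \<phi> T_T')
  moreover have "matrix_action uq_K X = K_action \<sigma> X" for X
    by (simp add: matrix_action_def \<phi> T_apply)
  ultimately show ?thesis
    unfolding is_matrix_action_def is_module_action_def Let_def
    by (simp add: matrix_action_def \<phi> endo_apply_simps T_apply left_mult.rep_eq right_mult.rep_eq)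
qed

end

section \<open>Uniqueness of the action; existence and uniqueness of the coaction\<close>

lemma is_module_action_power:
  "is_module_action act \<Longrightarrow> act (h ^ n) x = (act h ^^ n) x"
  by (induction n) (auto simp: is_module_action_def)

text \<open>K is prescribed, K^-1 is a power of K, and the formulas for E and F refer to these two
  only; the generators then decide the rest.\<close>

lemma is_matrix_action_unique:
  fixes act act' :: "'p::finite uq \<Rightarrow> ('r::complex_algebra_1, 'p) smat \<Rightarrow> ('r, 'p) smat"
  assumes "is_matrix_action \<sigma> act" "is_matrix_action \<sigma> act'"
  shows "act = act'"
proof (intro ext)
  fix h X
  have mod: "is_module_action act" "is_module_action act'"
    using assms by (simp_all add: is_matrix_action_def)
  have K: "act uq_K = act' uq_K"
    using assms by (simp add: is_matrix_action_def Let_def fun_eq_iff)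
  then have "act uq_Kinv = act' uq_Kinv"
    unfolding uq_Kinv_def by (intro ext) (simp only: is_module_action_power[OF mod(1)] is_module_action_power[OF mod(2)])
  with K have gens: "act uq_E = act' uq_E" "act uq_F = act' uq_F"
    using assms unfolding is_matrix_action_def Let_def by (simp_all add: fun_eq_iff)
  have bil: "cbilinear act" "cbilinear act'" and one: "act 1 X = X" "act' 1 X = X"
    and mult: "act (g * h) X = act g (act h X)" "act' (g * h) X = act' g (act' h X)" for g h X
    using mod by (auto simp: is_module_action_def)
  show "act h X = act' h X"
    by (induction h arbitrary: X rule: uq_induct) (simp_all add: one mult K gens cbilinearD[OF bil(1)] cbilinearD[OF bil(2)])
qed

text \<open>The mixed terms obey the scalar q^-2 on their own. The Weyl relation of Z and D leaves s
  K^-2 \<otimes> 1, and commuting F past E K^-1 leaves s (1 - K^-2) \<otimes> 1; together these are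
  s times the unit.\<close>

lemma coaction_weyl_pair:
  fixes Z D :: "'x::complex_algebra_1"
  defines "s \<equiv> \<qq> TYPE('p::finite) - inverse (\<qq> TYPE('p))"
  assumes card: "CARD('p) \<ge> 2" and ZD: "weyl_pair TYPE('p) Z D"
  shows "weyl_pair TYPE('p) (uq_Kinv \<otimes>\<^sub>t Z - s *\<^sub>C ((uq_E * uq_Kinv) \<otimes>\<^sub>t 1) :: ('p uq, 'x) tensor)
     (uq_Kinv \<otimes>\<^sub>t D + s *\<^sub>C (uq_F \<otimes>\<^sub>t 1))"
proof -
  let ?Q = "(\<qq> TYPE('p))\<^sup>2" and ?W = "qw TYPE('p)"
  define u where "u = (uq_Kinv :: 'p uq)"
  define x where "x = (uq_E * uq_Kinv :: 'p uq)"
  define F where "F = (uq_F :: 'p uq)"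
  note rel = uq_relations[where 'p='p]
  have "s \<noteq> 0" unfolding s_def by (rule qq_diff_nonzero[OF card])
  have DZ: "D * Z = ?W *\<^sub>C (Z * D) + s *\<^sub>C 1" and Zp: "Z ^ CARD('p) = 0" and Dp: "D ^ CARD('p) = 0"
    using ZD by (auto simp: weyl_pair_def s_def)
  have xu: "x * u = ?Q *\<^sub>C (u * x)"
    by (simp add: x_def u_def rel(5) mult_scaleC_left mult_scaleC_right mult.assoc)
  then have ux: "u * x = ?W *\<^sub>C (x * u)"
    by (simp add: scaleC_scaleC q_cancel scaleC_one)
  have uF: "u * F = ?Q *\<^sub>C (F * u)"
    unfolding u_def F_def by (rule rel(7))
  then have Fu: "F * u = ?W *\<^sub>C (u * F)"
    by (simp add: scaleC_scaleC q_cancel scaleC_one)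
  have EF: "s *\<^sub>C (uq_E * F) = s *\<^sub>C (F * uq_E) + (uq_K - u)"
    using \<open>s \<noteq> 0\<close> unfolding F_def u_def rel(8) by (simp add: scaleC_add_right scaleC_scaleC scaleC_one flip: s_def)
  \<comment> \<open>Multiplying s [E,F] = K - K^-1 by K^-1 from the right gives 1 - K^-2, up to the
    scalar for moving K^-1 past F.\<close>
  have "?W *\<^sub>C (s *\<^sub>C (x * F)) = (s *\<^sub>C (uq_E * F)) * u"
    unfolding x_def u_def[symmetric] mult.assoc uF
    by (simp add: mult_scaleC_left mult_scaleC_right scaleC_scaleC q_cancel mult.assoc mult.left_commute[of ?W] mult.commute[of s])
  also have "\<dots> = s *\<^sub>C (F * x) + (1 - u * u)"
    unfolding EF by (simp add: distrib_right left_diff_distrib mult_scaleC_left mult.assoc x_def u_def rel(2))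
  finally have Fx: "s *\<^sub>C (F * x) = ?W *\<^sub>C (s *\<^sub>C (x * F)) - 1 + u * u"
    by simp
  have "(u \<otimes>\<^sub>t D + s *\<^sub>C (F \<otimes>\<^sub>t 1)) * (u \<otimes>\<^sub>t Z - s *\<^sub>C (x \<otimes>\<^sub>t 1)) =
      (u * u) \<otimes>\<^sub>t (D * Z) - s *\<^sub>C ((u * x) \<otimes>\<^sub>t D) + s *\<^sub>C ((F * u) \<otimes>\<^sub>t Z) - s *\<^sub>C ((s *\<^sub>C (F * x)) \<otimes>\<^sub>t 1)"
    by (simp add: alg_simps)
  also have "\<dots> = ?W *\<^sub>C ((u \<otimes>\<^sub>t Z - s *\<^sub>C (x \<otimes>\<^sub>t 1)) * (u \<otimes>\<^sub>t D + s *\<^sub>C (F \<otimes>\<^sub>t 1))) + s *\<^sub>C (1 \<otimes>\<^sub>t 1)"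
    unfolding DZ ux Fu Fx by (simp add: alg_simps mult_ac)
  finally have "(u \<otimes>\<^sub>t D + s *\<^sub>C (F \<otimes>\<^sub>t 1)) * (u \<otimes>\<^sub>t Z - s *\<^sub>C (x \<otimes>\<^sub>t 1)) =
      ?W *\<^sub>C ((u \<otimes>\<^sub>t Z - s *\<^sub>C (x \<otimes>\<^sub>t 1)) * (u \<otimes>\<^sub>t D + s *\<^sub>C (F \<otimes>\<^sub>t 1))) + s *\<^sub>C 1"
    by (simp only: one_tensor_def)
  moreover have "(u \<otimes>\<^sub>t Z + (- s) *\<^sub>C (x \<otimes>\<^sub>t 1)) ^ CARD('p) = 0"
  proof (rule quantum_binomial_nilpotent[where w = ?Q])
    show "((- s) *\<^sub>C (x \<otimes>\<^sub>t 1)) * (u \<otimes>\<^sub>t Z) = ?Q *\<^sub>C ((u \<otimes>\<^sub>t Z) * ((- s) *\<^sub>C (x \<otimes>\<^sub>t 1)))"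
      by (simp add: mult_scaleC_left mult_scaleC_right tensor_mult xu tensor_scale_left scaleC_scaleC)
    show "(u \<otimes>\<^sub>t Z) ^ CARD('p) = 0"
      by (simp add: tensor_power Zp alg_simps)
    show "((- s) *\<^sub>C (x \<otimes>\<^sub>t (1 :: 'x))) ^ CARD('p) = 0"
      unfolding power_scaleC tensor_power by (simp add: x_def uq_E_Kinv_power alg_simps)
  qed (auto simp: qq_square_power_eq_1_iff dest: dvd_imp_le)
  moreover have "(s *\<^sub>C (F \<otimes>\<^sub>t 1) + u \<otimes>\<^sub>t D) ^ CARD('p) = 0"
  proof (rule quantum_binomial_nilpotent[where w = ?Q])
    show "(u \<otimes>\<^sub>t D) * (s *\<^sub>C (F \<otimes>\<^sub>t 1)) = ?Q *\<^sub>C (s *\<^sub>C (F \<otimes>\<^sub>t 1) * (u \<otimes>\<^sub>t D))"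
      by (simp add: mult_scaleC_left mult_scaleC_right tensor_mult uF tensor_scale_left scaleC_scaleC mult.commute)
    show "(u \<otimes>\<^sub>t D) ^ CARD('p) = 0"
      by (simp add: tensor_power Dp alg_simps)
    show "(s *\<^sub>C (F \<otimes>\<^sub>t (1 :: 'x))) ^ CARD('p) = 0"
      by (simp add: power_scaleC tensor_power F_def rel(10) alg_simps)
  qed (auto simp: qq_square_power_eq_1_iff dest: dvd_imp_le)
  ultimately show ?thesis
    unfolding weyl_pair_def u_def x_def F_def s_def[symmetric] by (simp add: add.commute)
qed

lemma is_matrix_coaction_ex:
  assumes card: "CARD('p::finite) \<ge> 2"
  shows "\<exists>\<delta>. is_matrix_coaction (\<delta> :: ('r::{complex_algebra_1, comm_ring_1}, 'p) smat \<Rightarrow> _)"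
proof -
  let ?s = "\<qq> TYPE('p) - inverse (\<qq> TYPE('p))"
  let ?ev = "\<lambda>r :: 'r. (1 :: 'p uq) \<otimes>\<^sub>t (scalar_smat r :: ('r, 'p) smat)"
  have ev: "algebra_hom ?ev"
    by (rule algebra_homI, intro clinear_cbilinear2[OF cbilinear_tensor] algebra_homD(1)[OF algebra_hom_scalar_smat])
      (simp_all add: algebra_homD[OF algebra_hom_scalar_smat] one_tensor_def tensor_mult)
  note \<delta> = smat_lift[OF card coaction_weyl_pair[OF card weyl_pair_mat[OF card]] ev]
  have "is_matrix_coaction (smat_lift ?ev (uq_Kinv \<otimes>\<^sub>t mat_Z - ?s *\<^sub>C ((uq_E * uq_Kinv) \<otimes>\<^sub>t 1)) (uq_Kinv \<otimes>\<^sub>t mat_D + ?s *\<^sub>C (uq_F \<otimes>\<^sub>t 1)))"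
    unfolding is_matrix_coaction_def Let_def
    by (intro conjI allI \<delta>)
      (simp_all add: distrib_left distrib_right left_diff_distrib right_diff_distrib mult_scaleC_left mult_scaleC_right
        tensor_mult scalar_smat_commute)
  then show ?thesis by blast
qed

lemma is_matrix_coaction_unique:
  fixes \<delta> \<delta>' :: "('r::{complex_algebra_1, comm_ring_1}, 'p::finite) smat \<Rightarrow> _"
  assumes "CARD('p) \<ge> 2" "is_matrix_coaction \<delta>" "is_matrix_coaction \<delta>'"
  shows "\<delta> = \<delta>'"
  using assms by (intro smat_hom_ext) (simp_all add: is_matrix_coaction_def Let_def)

section \<open>The Yetter--Drinfeld module algebra\<close>

text \<open>Brings the inner lift in the Yetter--Drinfeld axiom into the form of a product in the
  tensor algebra.\<close>

lemma tensor_lift_mult_right: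
  "tensor_lift (\<lambda>g z. (g * h) \<otimes>\<^sub>t z) u = u * (h \<otimes>\<^sub>t (1 :: 'x::complex_algebra_1))" for h :: "'h::complex_algebra_1"
proof -
  have bil: "cbilinear (\<lambda>g (z :: 'x). (g * h) \<otimes>\<^sub>t z)"
    by (rule cbilinearI) (simp_all add: alg_simps distrib_right)
  show ?thesis
    by (rule clinear_tensor_ext[where t = u], rule clinear_tensor_lift[OF bil], rule clinear_mult_right[OF clinear_id])
      (simp add: tensor_lift_simps[OF bil] tensor_mult)
qed

locale matrix_yetter_drinfeld = scalar_automorphism \<sigma> p
  for \<sigma> :: "'r::{complex_algebra_1, comm_ring_1} \<Rightarrow> 'r" and p :: "'p::finite itself" +
  fixes act :: "'p uq \<Rightarrow> ('r, 'p) smat \<Rightarrow> ('r, 'p) smat"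
    and \<delta> :: "('r, 'p) smat \<Rightarrow> ('p uq, ('r, 'p) smat) tensor"
  assumes action: "is_matrix_action \<sigma> act" and coaction: "is_matrix_coaction \<delta>"
begin

abbreviation E :: "'p uq" where "E \<equiv> uq_E"
abbreviation F :: "'p uq" where "F \<equiv> uq_F"
abbreviation K :: "'p uq" where "K \<equiv> uq_K"
abbreviation K' :: "'p uq" where "K' \<equiv> uq_Kinv"

lemma act_bilinear: "cbilinear act" and act_1: "act 1 X = X" and act_act: "act (g * h) X = act g (act h X)"
  using action by (auto simp: is_matrix_action_def is_module_action_def)

lemmas act_simps = cbilinearD[OF act_bilinear]

lemma act_lin: "clinear (act h)" "clinear (\<lambda>h. act h X)"
  using act_bilinear by (auto simp: cbilinear_def)

lemma act_K: "act K X = K_action \<sigma> X"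
  and act_E: "act E X = inverse (qdiff TYPE('p)) *\<^sub>C (X * Z - Z * act K X)"
  and act_F: "act F X = inverse (qdiff TYPE('p)) *\<^sub>C (D * X - act K' X * D)"
  using action unfolding is_matrix_action_def Let_def by blast+

lemma act_K_hom: "algebra_hom (act K)"
  using K_action_hom by (simp add: act_K[abs_def])

lemma act_K_K': "act K (act K' X) = X" "act K' (act K X) = X"
  by (simp_all add: uq_K_Kinv act_1 flip: act_act)

lemma act_K'_mult: "act K' (X * Y) = act K' X * act K' Y"
  using algebra_homD(3)[OF act_K_hom, of "act K' X" "act K' Y"] by (metis act_K_K')

lemma act_K'_1: "act K' 1 = 1"
  using algebra_homD(2)[OF act_K_hom] by (metis act_K_K'(2))

lemma \<delta>_hom: "algebra_hom \<delta>"
  and \<delta>_scalar: "\<delta> (scalar_smat r) = 1 \<otimes>\<^sub>t scalar_smat r"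
  and \<delta>_Z: "\<delta> Z = K' \<otimes>\<^sub>t Z - qdiff TYPE('p) *\<^sub>C ((E * K') \<otimes>\<^sub>t 1)"
  and \<delta>_D: "\<delta> D = K' \<otimes>\<^sub>t D + qdiff TYPE('p) *\<^sub>C (F \<otimes>\<^sub>t 1)"
  using coaction unfolding is_matrix_coaction_def Let_def by blast+

lemmas \<delta>_simps = algebra_homD[OF \<delta>_hom] clinear_add[OF algebra_homD(1)[OF \<delta>_hom]]
  clinear_diff[OF algebra_homD(1)[OF \<delta>_hom]] clinear_scale[OF algebra_homD(1)[OF \<delta>_hom]]

lemmas uq_hom_simps = algebra_homD[OF uq_comult_hom[where 'p='p]] clinear_add[OF algebra_homD(1)[OF uq_comult_hom[where 'p='p]]]
  clinear_scale[OF algebra_homD(1)[OF uq_comult_hom[where 'p='p]]]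
  algebra_homD[OF uq_counit_hom[where 'p='p]] clinear_add[OF algebra_homD(1)[OF uq_counit_hom[where 'p='p]]]
  clinear_scale[OF algebra_homD(1)[OF uq_counit_hom[where 'p='p]]]
  uq_comult[where 'p='p] uq_counit[where 'p='p] uq_comult_Kinv[where 'p='p] uq_counit_Kinv[where 'p='p]

subsection \<open>Module algebra\<close>

text \<open>The right side of the module algebra law with \<Delta>(h) replaced by an arbitrary
  tensor, so that \<Delta>(g) \<Delta>(h) can be taken apart in the induction.\<close>

definition act2 :: "('r, 'p) smat \<Rightarrow> ('r, 'p) smat \<Rightarrow> ('p uq, 'p uq) tensor \<Rightarrow> ('r, 'p) smat" where
  "act2 X Y = tensor_lift (\<lambda>g h. act g X * act h Y)"

lemma act2_bilinear: "cbilinear (\<lambda>g h. act g X * act h Y)"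
  by (rule cbilinearI) (simp_all add: act_simps alg_simps distrib_left distrib_right)

lemma act2_lin: "clinear (act2 X Y)" and act2_tensor: "act2 X Y (g \<otimes>\<^sub>t h) = act g X * act h Y"
  unfolding act2_def by (simp_all add: clinear_tensor_lift tensor_lift_simps act2_bilinear)

lemma act2_mult_tensor: "act2 X Y (t * (g \<otimes>\<^sub>t h)) = act2 (act g X) (act h Y) t"
  by (rule clinear_tensor_ext[where t = t], rule clinear_comp[OF clinear_mult_right[OF clinear_id] act2_lin], rule act2_lin)
    (simp add: tensor_mult act2_tensor act_act)

text \<open>The law for one g and all X, Y pulls \<Delta>(g) out of \<open>act2\<close>; with t =
  \<Delta>(h) this is the induction step from h to g h.\<close>

lemma act2_comult_mult:
  assumes "\<And>X Y. act g (X * Y) = act2 X Y (uq_comult g)"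
  shows "act2 X Y (uq_comult g * t) = act g (act2 X Y t)"
  by (rule clinear_tensor_ext[where t = t], rule clinear_comp[OF clinear_mult_left[OF clinear_id] act2_lin],
      rule clinear_comp[OF act2_lin act_lin(1)])
    (simp add: act2_mult_tensor act2_tensor assms)

lemma act_mult: "act h (X * Y) = act2 X Y (uq_comult h)"
proof -
  let ?c = "inverse (qdiff TYPE('p))"
  have K: "act K (X * Y) = act2 X Y (uq_comult K)" for X Y
    by (simp add: uq_hom_simps act2_tensor algebra_homD[OF act_K_hom])
  \<comment> \<open>X Y Z - Z K(X Y) = X (Y Z - Z K(Y)) + (X Z - Z K(X)) K(Y), which mirrors E
    \<otimes> K + 1 \<otimes> E. The case of F is the reflected identity with K^-1.\<close>
  have E: "act E (X * Y) = act2 X Y (uq_comult E)" for X Y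
    by (simp add: uq_hom_simps act2_tensor clinear_add[OF act2_lin] act_1 act_E[of X] act_E[of Y] act_E[of "X * Y"]
        algebra_homD[OF act_K_hom] mult_scaleC_left mult_scaleC_right left_diff_distrib right_diff_distrib mult.assoc
        flip: scaleC_add_right)
  have F: "act F (X * Y) = act2 X Y (uq_comult F)" for X Y
    by (simp add: uq_hom_simps act2_tensor clinear_add[OF act2_lin] act_1 act_F[of X] act_F[of Y] act_F[of "X * Y"]
        act_K'_mult mult_scaleC_left mult_scaleC_right left_diff_distrib right_diff_distrib mult.assoc
        flip: scaleC_add_right)
  show ?thesis
    by (induction h arbitrary: X Y rule: uq_induct)
      (simp_all add: uq_hom_simps(3,4,5) act_act act_simps act_1 act2_comult_mult[OF E] act2_comult_mult[OF K] act2_comult_mult[OF F]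
        clinear_add[OF act2_lin] clinear_scale[OF act2_lin] uq_hom_simps(2) one_tensor_def act2_tensor)
qed

lemma act_unit: "act h 1 = uq_counit h *\<^sub>C 1"
proof (induction h rule: uq_induct)
  case (E h)
  then show ?case by (simp add: act_act act_simps act_E algebra_homD[OF act_K_hom] uq_hom_simps)
next
  case (K h)
  then show ?case by (simp add: act_act act_simps algebra_homD[OF act_K_hom] uq_hom_simps)
next
  case (F h)
  then show ?case by (simp add: act_act act_simps act_F act_K'_1 uq_hom_simps)
qed (simp_all add: act_1 act_simps uq_hom_simps alg_simps scaleC_complex_def)

subsection \<open>Comodule algebra\<close>

lemma \<delta>_coassoc: "tensor_assoc (tensor_map uq_comult id (\<delta> X)) = tensor_map id \<delta> (\<delta> X)"
proof -
  have id1: "algebra_hom (id :: 'p uq \<Rightarrow> _)" and id2: "algebra_hom (id :: ('r, 'p) smat \<Rightarrow> _)"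
    by (rule algebra_hom_id)+
  note lin = algebra_homD(1)[OF id1] algebra_homD(1)[OF id2] algebra_homD(1)[OF uq_comult_hom[where 'p='p]] algebra_homD(1)[OF \<delta>_hom]
  note map = clinear_tensor_map[OF lin(3,2)] clinear_tensor_map[OF lin(1,4)]
  have "(\<lambda>X. tensor_assoc (tensor_map uq_comult id (\<delta> X))) = (\<lambda>X. tensor_map id \<delta> (\<delta> X))"
  proof (rule smat_hom_ext[OF card])
    show "algebra_hom (\<lambda>X. tensor_assoc (tensor_map uq_comult id (\<delta> X)))"
      by (intro algebra_hom_comp[OF algebra_hom_comp[OF \<delta>_hom algebra_hom_tensor_map[OF uq_comult_hom id2]] algebra_hom_tensor_assoc])
    show "algebra_hom (\<lambda>X. tensor_map id \<delta> (\<delta> X))"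
      by (rule algebra_hom_comp[OF \<delta>_hom algebra_hom_tensor_map[OF id1 \<delta>_hom]])
  qed (simp_all add: \<delta>_Z \<delta>_D \<delta>_scalar \<delta>_simps(2) uq_hom_simps tensor_map_tensor lin clinear_add[OF map(1)] clinear_add[OF map(2)]
      clinear_diff[OF map(1)] clinear_diff[OF map(2)] clinear_scale[OF map(1)] clinear_scale[OF map(2)]
      clinear_add[OF clinear_tensor_assoc] clinear_diff[OF clinear_tensor_assoc] clinear_scale[OF clinear_tensor_assoc]
      tensor_assoc_tensor alg_simps distrib_right uq_K_Kinv one_tensor_def)
  then show ?thesis by (rule fun_cong)
qed

lemma \<delta>_counit: "tensor_lift (\<lambda>g z. uq_counit g *\<^sub>C z) (\<delta> X) = X"
proof -
  have hom: "algebra_hom (tensor_lift (\<lambda>g (z :: ('r, 'p) smat). uq_counit (g :: 'p uq) *\<^sub>C z))"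
    by (rule algebra_hom_tensor_lift_character(1)[OF uq_counit_hom])
  have bil: "cbilinear (\<lambda>g (z :: ('r, 'p) smat). uq_counit (g :: 'p uq) *\<^sub>C z)"
    by (rule cbilinear_functional_scaleC(1)[OF algebra_homD(1)[OF uq_counit_hom]])
  have "(\<lambda>X. tensor_lift (\<lambda>g z. uq_counit g *\<^sub>C z) (\<delta> X)) = (\<lambda>X. X)"
    by (rule smat_hom_ext[OF card algebra_hom_comp[OF \<delta>_hom hom] algebra_hom_id(1)])
      (simp_all add: \<delta>_Z \<delta>_D \<delta>_scalar tensor_lift_simps[OF bil] uq_hom_simps scaleC_one)
  then show ?thesis by (rule fun_cong)
qed

subsection \<open>The Yetter--Drinfeld condition\<close>

text \<open>One side of the Yetter--Drinfeld condition for an arbitrary tensor in place of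
  \<Delta>(h). In the other side, \<open>yd_right\<close>, an arbitrary tensor also replaces
  \<delta>(x), so that it can be iterated.\<close>

definition yd_left :: "('r, 'p) smat \<Rightarrow> ('p uq, 'p uq) tensor \<Rightarrow> ('p uq, ('r, 'p) smat) tensor" where
  "yd_left X = tensor_lift (\<lambda>g h. \<delta> (act g X) * (h \<otimes>\<^sub>t 1))"

definition yd_map :: "'p uq \<Rightarrow> 'p uq \<Rightarrow> ('p uq, ('r, 'p) smat) tensor \<Rightarrow> ('p uq, ('r, 'p) smat) tensor" where
  "yd_map g h = tensor_map ((*) g) (act h)"

definition yd_right :: "('p uq, ('r, 'p) smat) tensor \<Rightarrow> ('p uq, 'p uq) tensor \<Rightarrow> ('p uq, ('r, 'p) smat) tensor" where
  "yd_right u = tensor_lift (\<lambda>g h. yd_map g h u)"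

lemma yd_left_bilinear: "cbilinear (\<lambda>g h. \<delta> (act g X) * (h \<otimes>\<^sub>t 1))"
  by (rule cbilinearI) (simp_all add: act_simps \<delta>_simps alg_simps distrib_left distrib_right)

lemma yd_left_lin: "clinear (yd_left X)" and yd_left_tensor: "yd_left X (g \<otimes>\<^sub>t h) = \<delta> (act g X) * (h \<otimes>\<^sub>t 1)"
  unfolding yd_left_def by (simp_all add: clinear_tensor_lift tensor_lift_simps yd_left_bilinear)

lemma mult_lin: "clinear ((*) (g :: 'p uq))"
  by (rule clinear_mult_left[OF clinear_id])

lemma yd_map_lin: "clinear (yd_map g h)" and yd_map_tensor: "yd_map g h (a \<otimes>\<^sub>t X) = (g * a) \<otimes>\<^sub>t act h X"
  unfolding yd_map_def by (simp_all add: clinear_tensor_map tensor_map_tensor mult_lin act_lin)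

lemma yd_map_bilinear: "cbilinear (\<lambda>g h. yd_map g h u)"
  by (rule cbilinearI; induction u rule: tensor_induct)
    (simp_all add: yd_map_tensor clinear_add[OF yd_map_lin] act_simps alg_simps distrib_right)

lemma yd_right_lin: "clinear (yd_right u)" and yd_right_tensor: "yd_right u (g \<otimes>\<^sub>t h) = yd_map g h u"
  unfolding yd_right_def by (simp_all add: clinear_tensor_lift tensor_lift_simps yd_map_bilinear)

lemma yd_map_mult: "yd_map (g * g') (h * h') u = yd_map g h (yd_map g' h' u)"
  by (rule clinear_tensor_ext[where t = u], rule yd_map_lin, rule clinear_comp[OF yd_map_lin yd_map_lin])
    (simp add: yd_map_tensor mult.assoc act_act)

lemma yd_map_mult_right: "yd_map g h (u * (a \<otimes>\<^sub>t 1)) = yd_map g h u * (a \<otimes>\<^sub>t 1)"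
  by (rule clinear_tensor_ext[where t = u], rule clinear_comp[OF clinear_mult_right[OF clinear_id] yd_map_lin],
      rule clinear_mult_right[OF yd_map_lin])
    (simp add: yd_map_tensor tensor_mult mult.assoc)

lemma yd_right_lin2: "clinear (\<lambda>u. yd_right u t)"
proof (rule clinearI; induction t rule: tensor_induct)
qed (simp_all add: yd_right_tensor clinear_add[OF yd_map_lin] clinear_scale[OF yd_map_lin] clinear_add[OF yd_right_lin] scaleC_add_right)

text \<open>\<open>yd_right\<close> is a module structure over the tensor square of the quantum
  group: the first leg multiplies, the second one acts on matrices.\<close>

lemma yd_right_mult: "yd_right u (s * t) = yd_right (yd_right u t) s"
proof (rule clinear_tensor_ext[where t = t])
  show "clinear (\<lambda>t. yd_right u (s * t))"
    by (rule clinear_comp[OF clinear_mult_left[OF clinear_id] yd_right_lin])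
  show "clinear (\<lambda>t. yd_right (yd_right u t) s)"
    by (rule clinear_comp[OF yd_right_lin yd_right_lin2])
  show "yd_right u (s * (g \<otimes>\<^sub>t h)) = yd_right (yd_right u (g \<otimes>\<^sub>t h)) s" for g h
    by (rule clinear_tensor_ext[where t = s], rule clinear_comp[OF clinear_mult_right[OF clinear_id] yd_right_lin],
        rule yd_right_lin)
      (simp add: tensor_mult yd_right_tensor yd_map_mult)
qed

lemma yd_right_mult_right: "yd_right (u * (a \<otimes>\<^sub>t 1)) s = yd_right u s * (a \<otimes>\<^sub>t 1)"
  by (rule clinear_tensor_ext[where t = s], rule yd_right_lin, rule clinear_mult_right[OF yd_right_lin])
    (simp add: yd_right_tensor yd_map_mult_right)

lemma yd_left_mult_tensor: "yd_left X (s * (g \<otimes>\<^sub>t h)) = yd_left (act g X) s * (h \<otimes>\<^sub>t 1)"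
  by (rule clinear_tensor_ext[where t = s], rule clinear_comp[OF clinear_mult_right[OF clinear_id] yd_left_lin],
      rule clinear_mult_right[OF yd_left_lin])
    (simp add: tensor_mult yd_left_tensor act_act mult.assoc)

text \<open>If g satisfies the condition for every X, then \<Delta>(g) leaves the left side as the
  operator \<open>yd_right\<close>; with t = \<Delta>(h) this carries the condition from h to g
  h.\<close>

lemma yd_left_comult_mult:
  assumes "\<And>X. yd_left X (uq_comult g) = yd_right (\<delta> X) (uq_comult g)"
  shows "yd_left X (uq_comult g * t) = yd_right (yd_left X t) (uq_comult g)"
  by (rule clinear_tensor_ext[where t = t], rule clinear_comp[OF clinear_mult_left[OF clinear_id] yd_left_lin],
      rule clinear_comp[OF yd_left_lin yd_right_lin2])
    (simp add: yd_left_mult_tensor yd_left_tensor yd_right_mult_right assms)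

lemma yd_map_split: "yd_map (g * g') h u = (g \<otimes>\<^sub>t 1) * yd_map g' h u"
  by (rule clinear_tensor_ext[where t = u], rule yd_map_lin, rule clinear_mult_left[OF yd_map_lin])
    (simp add: yd_map_tensor tensor_mult mult.assoc)

lemma yd_map_left: "yd_map g h u = (g \<otimes>\<^sub>t 1) * yd_map 1 h u"
  using yd_map_split[of g 1 h u] by simp

lemma yd_map_1_1: "yd_map 1 1 u = u"
  by (rule clinear_tensor_ext[where t = u], rule yd_map_lin, rule clinear_id) (simp add: yd_map_tensor act_1)

text \<open>K is group-like and invertible, so its condition says that \<delta> intertwines K with
  conjugation by K on the first leg and the action of K on the second. Both sides are homomorphisms
  in X, and generators suffice.\<close>

lemma \<delta>_act_K: "\<delta> (act K X) = yd_map K K (\<delta> X) * (K' \<otimes>\<^sub>t 1)"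
proof -
  have "\<delta> \<circ> act K = (\<lambda>X. yd_map K K (\<delta> X) * (K' \<otimes>\<^sub>t 1))"
  proof (rule smat_hom_ext[OF card])
    show "algebra_hom (\<delta> \<circ> act K)"
      using algebra_hom_comp[OF act_K_hom \<delta>_hom] by (simp add: comp_def)
    have cancel: "K' * (K * x) = x" for x
      by (simp add: uq_K_Kinv flip: mult.assoc)
    have "algebra_hom (\<lambda>u. yd_map K K u * (K' \<otimes>\<^sub>t 1))"
      by (rule algebra_hom_tensorI, rule clinear_mult_right[OF yd_map_lin])
        (simp_all add: yd_map_tensor algebra_homD[OF act_K_hom] tensor_mult uq_K_Kinv one_tensor_def mult.assoc cancel)
    from algebra_hom_comp[OF \<delta>_hom this] show "algebra_hom (\<lambda>X. yd_map K K (\<delta> X) * (K' \<otimes>\<^sub>t 1))" .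
    note rel = uq_relations[where 'p='p]
    have K'E: "K * (E * K') = qsq TYPE('p) *\<^sub>C E"
      by (simp add: rel(5) mult_scaleC_right cancel flip: mult.assoc) (simp add: rel(2))
    have KF: "K * F = qw TYPE('p) *\<^sub>C (F * K)"
      by (simp add: rel(6) scaleC_scaleC q_cancel scaleC_one)
    note lin = clinear_add[OF yd_map_lin] clinear_diff[OF yd_map_lin] clinear_scale[OF yd_map_lin]
    have one: "K_action \<sigma> (1 :: ('r, 'p) smat) = 1"
      by (rule algebra_homD(2)[OF K_action_hom])
    show "(\<delta> \<circ> act K) Z = yd_map K K (\<delta> Z) * (K' \<otimes>\<^sub>t 1)"
      by (simp add: act_K K_action_Z \<delta>_simps \<delta>_Z lin yd_map_tensor one K'E alg_simps
          left_diff_distrib uq_K_Kinv mult_ac)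
    show "(\<delta> \<circ> act K) D = yd_map K K (\<delta> D) * (K' \<otimes>\<^sub>t 1)"
      by (simp add: act_K K_action_D \<delta>_simps \<delta>_D lin yd_map_tensor one KF alg_simps
          distrib_right uq_K_Kinv mult_ac)
    show "(\<delta> \<circ> act K) (scalar_smat r) = yd_map K K (\<delta> (scalar_smat r)) * (K' \<otimes>\<^sub>t 1)" for r
      by (simp add: act_K K_action_scalar \<delta>_scalar yd_map_tensor tensor_mult uq_K_Kinv)
  qed
  then show ?thesis by (metis comp_apply)
qed

lemma K_tensor_cancel:
  "(K' \<otimes>\<^sub>t 1) * (K \<otimes>\<^sub>t 1) = (1 :: ('p uq, ('r, 'p) smat) tensor)" "(K \<otimes>\<^sub>t 1) * (K' \<otimes>\<^sub>t 1) = (1 :: ('p uq, ('r, 'p) smat) tensor)"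
  by (simp_all add: tensor_mult uq_K_Kinv one_tensor_def)

lemma yd_K: "\<delta> (act K X) * (K \<otimes>\<^sub>t 1) = (K \<otimes>\<^sub>t 1) * yd_map 1 K (\<delta> X)"
  by (simp add: \<delta>_act_K mult.assoc K_tensor_cancel flip: yd_map_left)

text \<open>Deduced from the case of K at K^-1 X, transported by K^-1 on the second leg, instead of
  a second check on generators.\<close>

lemma yd_K': "\<delta> (act K' X) * (K' \<otimes>\<^sub>t 1) = (K' \<otimes>\<^sub>t 1) * yd_map 1 K' (\<delta> X)"
proof -
  let ?k = "K \<otimes>\<^sub>t (1 :: ('r, 'p) smat)" and ?k' = "K' \<otimes>\<^sub>t (1 :: ('r, 'p) smat)"
  have "yd_map 1 K' (\<delta> X) * ?k = yd_map 1 K' (\<delta> (act K (act K' X)) * ?k)"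
    by (simp only: act_K_K' yd_map_mult_right)
  also have "\<dots> = yd_map 1 K' (yd_map K K (\<delta> (act K' X)))"
    by (simp only: yd_K yd_map_left[of K])
  also have "\<dots> = yd_map K 1 (\<delta> (act K' X))"
    by (simp add: uq_K_Kinv flip: yd_map_mult)
  also have "\<dots> = ?k * \<delta> (act K' X)"
    by (simp add: yd_map_left[of K] yd_map_1_1)
  finally have *: "yd_map 1 K' (\<delta> X) * ?k = ?k * \<delta> (act K' X)" .
  have "\<delta> (act K' X) * ?k' = ?k' * (?k * \<delta> (act K' X)) * ?k'"
    by (simp add: K_tensor_cancel flip: mult.assoc)
  also have "\<dots> = ?k' * yd_map 1 K' (\<delta> X) * (?k * ?k')"
    by (simp only: *[symmetric] mult.assoc)
  finally show ?thesis by (simp add: K_tensor_cancel)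
qed

text \<open>The form in which \<delta>(Z) enters the condition for E: the summand E \<otimes> K of
  the coproduct supplies the factor K \<otimes> 1, which cancels K^-1.\<close>

lemma \<delta>_Z_split: "\<delta> Z * (K \<otimes>\<^sub>t 1) = 1 \<otimes>\<^sub>t Z - qdiff TYPE('p) *\<^sub>C (E \<otimes>\<^sub>t 1)"
  by (simp add: \<delta>_Z left_diff_distrib mult_scaleC_left tensor_mult uq_K_Kinv mult.assoc)

lemma \<delta>_D_split: "\<delta> D = (K' \<otimes>\<^sub>t 1) * (1 \<otimes>\<^sub>t D) + qdiff TYPE('p) *\<^sub>C (F \<otimes>\<^sub>t 1)"
  by (simp add: \<delta>_D tensor_mult)

lemma yd_map_1_E: "yd_map 1 E u = inverse (qdiff TYPE('p)) *\<^sub>C (u * (1 \<otimes>\<^sub>t Z) - (1 \<otimes>\<^sub>t Z) * yd_map 1 K u)"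
  by (rule clinear_tensor_ext[where t = u], rule yd_map_lin,
      intro clinear_scaleC clinear_minus clinear_mult_right clinear_mult_left clinear_id yd_map_lin)
    (simp add: yd_map_tensor act_E alg_simps)

lemma yd_map_1_F: "yd_map 1 F u = inverse (qdiff TYPE('p)) *\<^sub>C ((1 \<otimes>\<^sub>t D) * u - yd_map 1 K' u * (1 \<otimes>\<^sub>t D))"
  by (rule clinear_tensor_ext[where t = u], rule yd_map_lin,
      intro clinear_scaleC clinear_minus clinear_mult_right clinear_mult_left clinear_id yd_map_lin)
    (simp add: yd_map_tensor act_F alg_simps)

lemma yd_left_K: "yd_left X (uq_comult K) = yd_right (\<delta> X) (uq_comult K)"
  by (simp add: uq_hom_simps yd_left_tensor yd_right_tensor yd_K flip: yd_map_left)

text \<open>Direct for all X at once. After inserting the formula for the action of E, the part of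
  \<delta>(Z) with 1 \<otimes> Z reassembles into E acting on the second leg. The part with E
  \<otimes> 1 gives the term of E \<otimes> K on the right side and that of 1 \<otimes> E on the
  left side, its coefficient cancelling the denominator.\<close>

lemma yd_left_E: "yd_left X (uq_comult E) = yd_right (\<delta> X) (uq_comult E)"
proof -
  let ?s = "qdiff TYPE('p)" and ?v = "yd_map 1 K (\<delta> X)"
  have "\<delta> (act E X) * (K \<otimes>\<^sub>t 1) = inverse ?s *\<^sub>C (\<delta> X * (\<delta> Z * (K \<otimes>\<^sub>t 1)) - \<delta> Z * (\<delta> (act K X) * (K \<otimes>\<^sub>t 1)))"
    by (simp only: act_E \<delta>_simps mult_scaleC_left left_diff_distrib mult.assoc)
  also have "\<dots> = inverse ?s *\<^sub>C (\<delta> X * (\<delta> Z * (K \<otimes>\<^sub>t 1)) - (\<delta> Z * (K \<otimes>\<^sub>t 1)) * ?v)"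
    by (simp only: yd_K mult.assoc)
  also have "\<dots> = inverse ?s *\<^sub>C ((\<delta> X * (1 \<otimes>\<^sub>t Z) - (1 \<otimes>\<^sub>t Z) * ?v) + ?s *\<^sub>C ((E \<otimes>\<^sub>t 1) * ?v - \<delta> X * (E \<otimes>\<^sub>t 1)))"
    unfolding \<delta>_Z_split
    by (simp add: left_diff_distrib right_diff_distrib mult_scaleC_left mult_scaleC_right complex_space.scale_right_diff_distrib algebra_simps)
  also have "\<dots> = yd_map 1 E (\<delta> X) + ((E \<otimes>\<^sub>t 1) * ?v - \<delta> X * (E \<otimes>\<^sub>t 1))"
    using qdiff_nonzero by (simp add: yd_map_1_E scaleC_add_right scaleC_scaleC scaleC_one)
  finally have "\<delta> (act E X) * (K \<otimes>\<^sub>t 1) + \<delta> X * (E \<otimes>\<^sub>t 1) = yd_map 1 E (\<delta> X) + yd_map E K (\<delta> X)"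
    by (simp add: yd_map_left[of E])
  then show ?thesis
    by (simp add: uq_hom_simps clinear_add[OF yd_left_lin] clinear_add[OF yd_right_lin] yd_left_tensor yd_right_tensor act_1 add.commute)
qed

text \<open>The mechanism used for E, now with \<open>yd_K'\<close>; \<delta>(F X) carries no extra
  factor because its summand of the coproduct is F \<otimes> 1.\<close>

lemma yd_left_F: "yd_left X (uq_comult F) = yd_right (\<delta> X) (uq_comult F)"
proof -
  let ?s = "qdiff TYPE('p)" and ?v = "yd_map 1 K' (\<delta> X)"
  have alg: "inverse s *\<^sub>C ((k * a + s *\<^sub>C b) - (k * c + s *\<^sub>C d)) = k * (inverse s *\<^sub>C (a - c)) + (b - d)"
    if "s \<noteq> 0" for s and k a b c d :: "('p uq, ('r, 'p) smat) tensor"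
    using that by (simp add: scaleC_add_right scaleC_scaleC scaleC_one complex_space.scale_right_diff_distrib
        mult_scaleC_right right_diff_distrib)
  have "\<delta> (act F X) = inverse ?s *\<^sub>C (\<delta> D * \<delta> X - \<delta> (act K' X) * \<delta> D)"
    by (simp only: act_F \<delta>_simps)
  also have "\<delta> D * \<delta> X = (K' \<otimes>\<^sub>t 1) * ((1 \<otimes>\<^sub>t D) * \<delta> X) + ?s *\<^sub>C ((F \<otimes>\<^sub>t 1) * \<delta> X)"
    by (simp only: \<delta>_D_split distrib_right mult.assoc mult_scaleC_left)
  also have "\<delta> (act K' X) * \<delta> D = (\<delta> (act K' X) * (K' \<otimes>\<^sub>t 1)) * (1 \<otimes>\<^sub>t D) + ?s *\<^sub>C (\<delta> (act K' X) * (F \<otimes>\<^sub>t 1))"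
    by (simp only: \<delta>_D_split distrib_left mult.assoc mult_scaleC_right)
  also have "(\<delta> (act K' X) * (K' \<otimes>\<^sub>t 1)) * (1 \<otimes>\<^sub>t D) = (K' \<otimes>\<^sub>t 1) * (?v * (1 \<otimes>\<^sub>t D))"
    by (simp only: yd_K' mult.assoc)
  also have "inverse ?s *\<^sub>C ((K' \<otimes>\<^sub>t 1) * ((1 \<otimes>\<^sub>t D) * \<delta> X) + ?s *\<^sub>C ((F \<otimes>\<^sub>t 1) * \<delta> X) -
        ((K' \<otimes>\<^sub>t 1) * (?v * (1 \<otimes>\<^sub>t D)) + ?s *\<^sub>C (\<delta> (act K' X) * (F \<otimes>\<^sub>t 1)))) =
      (K' \<otimes>\<^sub>t 1) * yd_map 1 F (\<delta> X) + ((F \<otimes>\<^sub>t 1) * \<delta> X - \<delta> (act K' X) * (F \<otimes>\<^sub>t 1))"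
    unfolding yd_map_1_F by (rule alg[OF qdiff_nonzero])
  finally have "\<delta> (act F X) + \<delta> (act K' X) * (F \<otimes>\<^sub>t 1) = yd_map F 1 (\<delta> X) + yd_map K' F (\<delta> X)"
    by (simp add: yd_map_left[of F] yd_map_left[of K'] yd_map_1_1)
  then show ?thesis
    by (simp add: uq_hom_simps clinear_add[OF yd_left_lin] clinear_add[OF yd_right_lin] yd_left_tensor yd_right_tensor
        flip: one_tensor_def)
qed

lemma yd_condition: "yd_left X (uq_comult h) = yd_right (\<delta> X) (uq_comult h)"
  by (induction h rule: uq_induct)
    (simp_all add: uq_hom_simps(2-5) one_tensor_def yd_left_tensor yd_right_tensor act_1 yd_map_1_1
      yd_left_comult_mult[OF yd_left_E] yd_left_comult_mult[OF yd_left_K] yd_left_comult_mult[OF yd_left_F] yd_right_mult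
      clinear_add[OF yd_left_lin] clinear_add[OF yd_right_lin] clinear_scale[OF yd_left_lin] clinear_scale[OF yd_right_lin],
     simp flip: one_tensor_def)

subsection \<open>Braided commutativity\<close>

definition braid :: "('r, 'p) smat \<Rightarrow> ('p uq, ('r, 'p) smat) tensor \<Rightarrow> ('r, 'p) smat" where
  "braid X = tensor_lift (\<lambda>g z. act g X * z)"

lemma braid_bilinear: "cbilinear (\<lambda>g z. act g X * z)"
  by (rule cbilinearI) (simp_all add: act_simps alg_simps distrib_left distrib_right)

lemma braid_lin: "clinear (braid X)" and braid_tensor: "braid X (g \<otimes>\<^sub>t z) = act g X * z"
  unfolding braid_def by (simp_all add: clinear_tensor_lift tensor_lift_simps braid_bilinear)

lemma braid_mult_tensor: "braid X (u * (g \<otimes>\<^sub>t z)) = braid (act g X) u * z"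
  by (rule clinear_tensor_ext[where t = u], rule clinear_comp[OF clinear_mult_right[OF clinear_id] braid_lin],
      rule clinear_mult_right[OF braid_lin])
    (simp add: tensor_mult braid_tensor act_act mult.assoc)

text \<open>On a pure tensor g \<otimes> z the law for Y is applied to g X in place of X; hence it
  is assumed for all X.\<close>

lemma braid_mult:
  assumes "\<And>X. Y * X = braid X (\<delta> Y)"
  shows "braid X (\<delta> Y * t) = Y * braid X t"
  by (rule clinear_tensor_ext[where t = t], rule clinear_comp[OF clinear_mult_left[OF clinear_id] braid_lin],
      rule clinear_mult_left[OF braid_lin])
    (simp add: braid_mult_tensor braid_tensor mult.assoc flip: assms)

lemma braided_commutative: "Y * X = braid X (\<delta> Y)"
proof -
  \<comment> \<open>E applied to K^-1 X is (K^-1(X) Z - Z X) / (q - q^-1), so the second term of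
    \<delta>(Z) turns K^-1(X) Z into Z X.\<close>
  have Z: "Z * X = braid X (\<delta> Z)" for X
    using qdiff_nonzero
    by (simp add: \<delta>_Z clinear_diff[OF braid_lin] clinear_scale[OF braid_lin] braid_tensor act_act act_E act_K_K'
        scaleC_scaleC scaleC_one)
  have D: "D * X = braid X (\<delta> D)" for X
    using qdiff_nonzero
    by (simp add: \<delta>_D clinear_add[OF braid_lin] clinear_scale[OF braid_lin] braid_tensor act_F scaleC_scaleC scaleC_one)
  \<comment> \<open>Scalars are coinvariant, so for them the law says that they are central.\<close>
  have scalar: "scalar_smat r * X = braid X (\<delta> (scalar_smat r))" for r X
    by (simp add: \<delta>_scalar braid_tensor act_1 scalar_smat_commute)
  show ?thesis
    using card
    by (induction Y rule: smat_induct)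
      (simp_all add: \<delta>_simps clinear_add[OF braid_lin] braid_mult[OF Z] braid_mult[OF D] braid_mult[OF scalar] distrib_right mult.assoc,
       simp add: one_tensor_def braid_tensor act_1)
qed

theorem yetter_drinfeld:
  "braided_commutative_yetter_drinfeld_module_algebra uq_comult uq_counit uq_antipode act \<delta>"
proof (intro braided_commutative_yetter_drinfeld_module_algebra.intro yetter_drinfeld_module_algebra.intro
    uq_hopf_algebra yetter_drinfeld_module_algebra_axioms.intro braided_commutative_yetter_drinfeld_module_algebra_axioms.intro)
  show "is_module_action act"
    using action by (simp add: is_matrix_action_def)
  show "act h (X * Y) = tensor_lift (\<lambda>h' h''. act h' X * act h'' Y) (uq_comult h)" for h X Y
    unfolding act_mult act2_def ..
  show "tensor_lift (\<lambda>h' h''. tensor_lift (\<lambda>g z. (g * h'') \<otimes>\<^sub>t z) (\<delta> (act h' X))) (uq_comult h) =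
     tensor_lift (\<lambda>h' h''. tensor_lift (\<lambda>g z. (h' * g) \<otimes>\<^sub>t act h'' z) (\<delta> X)) (uq_comult h)" for h X
    using yd_condition[of X h] unfolding yd_left_def yd_right_def yd_map_def tensor_map_def tensor_lift_mult_right .
  show "Y * X = tensor_lift (\<lambda>g z. act g X * z) (\<delta> Y)" for X Y
    using braided_commutative[of Y X] unfolding braid_def .
qed (rule act_unit \<delta>_hom \<delta>_coassoc \<delta>_counit)+

end

section \<open>Polynomials modulo \<open>\<lambda>\<^sup>2\<^sup>p - 1\<close>\<close>

lemma lam_abs_cases: obtains r where "x = abs_lam_poly r"
  using Quotient3_abs_rep[OF Quotient3_lam_poly, of x] by metis

lemma lam_shift_hom: "algebra_hom (lam_shift :: 'p::finite lam_poly \<Rightarrow> _)"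
proof (intro algebra_homI clinearI)
  fix x y :: "'p lam_poly" and c
  show "lam_shift (x + y) = lam_shift x + lam_shift y"
    by transfer (simp add: pcompose_add)
  show "lam_shift (c *\<^sub>C x) = c *\<^sub>C lam_shift x"
    by transfer (simp add: pcompose_smult)
  show "lam_shift (1 :: 'p lam_poly) = 1"
    by transfer (simp add: pcompose_1)
  show "lam_shift (x * y) = lam_shift x * lam_shift y"
    by transfer (simp add: pcompose_mult)
qed

text \<open>n shifts rescale \<lambda> by q^-n, and q^(2p) = 1.\<close>

lemma lam_shift_period: "(lam_shift ^^ (2 * CARD('p))) (x :: 'p::finite lam_poly) = x"
proof -
  obtain r where x: "x = abs_lam_poly r" by (rule lam_abs_cases)
  let ?c = "inverse (\<qq> TYPE('p))"
  have "(lam_shift ^^ n) x = abs_lam_poly (r \<circ>\<^sub>p [:0, ?c ^ n:])" for n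
  proof (induction n)
    case 0
    show ?case by (simp add: x pcompose_idR)
  next
    case (Suc n)
    have "(r \<circ>\<^sub>p [:0, ?c ^ n:]) \<circ>\<^sub>p [:0, ?c:] = r \<circ>\<^sub>p ([:0, ?c ^ n:] \<circ>\<^sub>p [:0, ?c:])"
      by (rule pcompose_assoc[symmetric])
    also have "[:0, ?c ^ n:] \<circ>\<^sub>p [:0, ?c:] = [:0, ?c ^ Suc n:]"
      by (simp add: pcompose_pCons mult.commute)
    finally show ?case
      by (simp add: Suc lam_shift.abs_eq)
  qed
  from this[of "2 * CARD('p)"] have "(lam_shift ^^ (2 * CARD('p))) x = abs_lam_poly (r \<circ>\<^sub>p [:0, 1:])"
    by (simp only: power_inverse qq_power inverse_1)
  then show ?thesis by (simp add: pcompose_idR x)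
qed

lemma lam_poly_induct [case_names const add lam]:
  fixes x :: "'p::finite lam_poly"
  assumes const: "\<And>c. P (c *\<^sub>C 1)" and add: "\<And>x y. P x \<Longrightarrow> P y \<Longrightarrow> P (x + y)" and lam: "\<And>x. P x \<Longrightarrow> P (lam * x)"
  shows "P x"
proof -
  have "P (abs_lam_poly r)" for r
  proof (induction r rule: pCons_induct)
    case 0
    then show ?case using const[of 0] by (simp add: zero_lam_poly.abs_eq)
  next
    case (pCons a r)
    have "abs_lam_poly (pCons a r) = a *\<^sub>C 1 + lam * (abs_lam_poly r :: 'p lam_poly)"
      by (simp add: one_lam_poly.abs_eq lam.abs_eq scaleC_lam_poly.abs_eq times_lam_poly.abs_eq plus_lam_poly.abs_eq)
    with const add lam pCons show ?case by simp
  qed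
  then show ?thesis by (metis lam_abs_cases)
qed

lemma mat_lam_eq: "mat_lam = scalar_smat lam"
  by (simp add: mat_lam_def scalar_smat_def)

lemma is_uq_action_iff: "is_uq_action act \<longleftrightarrow> is_matrix_action lam_shift act"
  by (simp add: is_uq_action_def is_matrix_action_def K_action_def Let_def)

text \<open>\<lambda> generates the coefficients, so the value of a homomorphism there fixes it on
  all scalars.\<close>

lemma is_uq_coaction_iff: "is_uq_coaction \<delta> \<longleftrightarrow> is_matrix_coaction \<delta>"
proof
  assume "is_matrix_coaction \<delta>"
  then show "is_uq_coaction \<delta>"
    by (simp add: is_uq_coaction_def is_matrix_coaction_def Let_def mat_lam_eq)
next
  assume \<delta>: "is_uq_coaction \<delta>"
  then have hom: "algebra_hom \<delta>" and lam: "\<delta> (scalar_smat lam) = 1 \<otimes>\<^sub>t scalar_smat lam"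
    by (simp_all add: is_uq_coaction_def Let_def mat_lam_eq)
  have "\<delta> (scalar_smat r) = 1 \<otimes>\<^sub>t scalar_smat r" for r
    by (induction r rule: lam_poly_induct)
      (simp_all add: algebra_homD[OF algebra_hom_scalar_smat] clinear_add[OF algebra_homD(1)[OF algebra_hom_scalar_smat]]
        clinear_scale[OF algebra_homD(1)[OF algebra_hom_scalar_smat]] algebra_homD[OF hom] clinear_add[OF algebra_homD(1)[OF hom]]
        clinear_scale[OF algebra_homD(1)[OF hom]] lam alg_simps one_tensor_def)
  with \<delta> show "is_matrix_coaction \<delta>"
    by (simp add: is_uq_coaction_def is_matrix_coaction_def Let_def)
qed

section \<open>Restriction to constant matrices\<close>

lemma const_mat_hom: "algebra_hom (const_mat :: (complex, 'p::finite) smat \<Rightarrow> _)"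
  using algebra_homD[OF algebra_hom_scalar[where 'a="'p lam_poly"]]
  by (auto intro!: algebra_homI clinearI smat_eqI simp: const_mat_def smat_nth_mult clinear_sum_apply scaleC_add_left
      scaleC_scaleC scaleC_complex_def mult_scaleC_left mult_scaleC_right scaleC_one complex_space.scale_sum_left mult.commute
      intro!: sum.cong)

lemma const_mat_Z: "const_mat (mat_Z :: (complex, 'p::finite) smat) = mat_Z"
  by (rule smat_eqI) (simp add: const_mat_def smat_nth_mat_Z scaleC_one)

lemma const_mat_D: "CARD('p::finite) \<ge> 2 \<Longrightarrow> const_mat (mat_D :: (complex, 'p) smat) = mat_D"
  by (rule smat_eqI) (simp add: const_mat_def smat_nth_mat_D scaleC_complex_def)

lemma const_mat_scalar: "const_mat (scalar_smat c :: (complex, 'p::finite) smat) = scalar_smat (c *\<^sub>C 1)"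
  by (rule smat_eqI) (simp add: const_mat_def)

lemma const_mat_K_action:
  "const_mat (K_action (\<lambda>c. c) X) = K_action lam_shift (const_mat X :: ('p lam_poly, 'p::finite) smat)"
  using algebra_homD[OF lam_shift_hom[where 'p='p]]
  by (intro smat_eqI) (simp add: const_mat_def K_action_def clinear_scale scaleC_scaleC scaleC_complex_def)

text \<open>The action on constant matrices is built independently, with the identity automorphism.
  Compatibility holds for K because the shift of \<lambda> fixes constants, then for K^-1, E and F,
  and passes to products.\<close>

lemma const_mat_action:
  fixes act :: "'p::finite uq \<Rightarrow> ('p lam_poly, 'p) smat \<Rightarrow> _"
  assumes p: "CARD('p) \<ge> 2" and act: "is_matrix_action lam_shift act" and act0: "is_matrix_action (\<lambda>c. c) act0"
  shows "const_mat (act0 h X) = act h (const_mat X)"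
proof -
  note hom = algebra_homD[OF const_mat_hom[where 'p='p]]
  note lin = clinear_add[OF hom(1)] clinear_diff[OF hom(1)] clinear_scale[OF hom(1)]
  have mod: "is_module_action act0" "is_module_action act"
    using act act0 by (simp_all add: is_matrix_action_def)
  have bil: "cbilinear act0" "cbilinear act" and one: "act0 1 Y = Y" "act 1 X = X"
    and mult: "act0 (g * h) Y = act0 g (act0 h Y)" "act (g * h) X = act g (act h X)" for g h X Y
    using mod by (auto simp: is_module_action_def)
  have K: "const_mat (act0 uq_K Y) = act uq_K (const_mat Y)" for Y
    using act act0 by (simp add: is_matrix_action_def Let_def const_mat_K_action)
  have "const_mat ((act0 uq_K ^^ n) Y) = (act uq_K ^^ n) (const_mat Y)" for n Y
    by (induction n) (simp_all add: K)
  then have Kinv: "const_mat (act0 uq_Kinv Y) = act uq_Kinv (const_mat Y)" for Y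
    unfolding uq_Kinv_def by (simp only: is_module_action_power[OF mod(1)] is_module_action_power[OF mod(2)])
  have E: "const_mat (act0 uq_E Y) = act uq_E (const_mat Y)" for Y
    using act act0 unfolding is_matrix_action_def Let_def by (simp only: hom lin const_mat_Z const_mat_K_action)
  have F: "const_mat (act0 uq_F Y) = act uq_F (const_mat Y)" for Y
    using act act0 unfolding is_matrix_action_def Let_def by (simp only: hom lin const_mat_D[OF p] flip: Kinv)
  show ?thesis
    by (induction h arbitrary: X rule: uq_induct)
      (simp_all add: one mult K E F cbilinearD[OF bil(1)] cbilinearD[OF bil(2)] lin)
qed

text \<open>Both sides are algebra homomorphisms on the constant matrices, so Z, D and the scalars
  decide.\<close>

lemma const_mat_coaction:
  fixes \<delta> :: "('p lam_poly, 'p::finite) smat \<Rightarrow> _"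
  assumes p: "CARD('p) \<ge> 2" and \<delta>: "is_matrix_coaction \<delta>" and \<delta>0: "is_matrix_coaction \<delta>0"
  shows "tensor_map id const_mat (\<delta>0 X) = \<delta> (const_mat X)"
proof -
  have id_hom: "algebra_hom (id :: 'p uq \<Rightarrow> _)" by (rule algebra_hom_id)
  note c = const_mat_hom[where 'p='p]
  note lin = algebra_homD(1)[OF id_hom] algebra_homD(1)[OF c]
  note map = clinear_tensor_map[OF lin]
  have hom: "algebra_hom \<delta>" "algebra_hom \<delta>0"
    using \<delta> \<delta>0 by (simp_all add: is_matrix_coaction_def)
  have "(\<lambda>X. tensor_map id const_mat (\<delta>0 X)) = (\<lambda>X. \<delta> (const_mat X))"
  proof (rule smat_hom_ext[OF p])
    show "algebra_hom (\<lambda>X. tensor_map id const_mat (\<delta>0 X))"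
      by (rule algebra_hom_comp[OF hom(2) algebra_hom_tensor_map[OF id_hom c]])
    show "algebra_hom (\<lambda>X. \<delta> (const_mat X))"
      by (rule algebra_hom_comp[OF c hom(1)])
  qed (use \<delta> \<delta>0 in \<open>simp_all add: is_matrix_coaction_def Let_def tensor_map_tensor lin clinear_add[OF map] clinear_diff[OF map]
        clinear_scale[OF map] const_mat_Z const_mat_D[OF p] const_mat_scalar algebra_homD(2)[OF c]\<close>)
  then show ?thesis by (rule fun_cong)
qed

theorem theorem1p5p3:
  assumes "CARD('p::finite) \<ge> 2"
  shows
    "(\<exists>!act. is_uq_action (act :: 'p uq \<Rightarrow> ('p lam_poly, 'p) smat \<Rightarrow> ('p lam_poly, 'p) smat)) \<and>
     (\<exists>!\<delta>. is_uq_coaction (\<delta> :: ('p lam_poly, 'p) smat \<Rightarrow> ('p uq, ('p lam_poly, 'p) smat) tensor)) \<and>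
     (\<forall>(act :: 'p uq \<Rightarrow> ('p lam_poly, 'p) smat \<Rightarrow> ('p lam_poly, 'p) smat) \<delta>.
        is_uq_action act \<and> is_uq_coaction \<delta> \<longrightarrow>
        braided_commutative_yetter_drinfeld_module_algebra uq_comult uq_counit uq_antipode act \<delta> \<and>
        (\<exists>act\<^sub>0 \<delta>\<^sub>0.
           (\<forall>h X. const_mat (act\<^sub>0 h X) = act h (const_mat X)) \<and>
           (\<forall>X. tensor_map id const_mat (\<delta>\<^sub>0 X) = \<delta> (const_mat X)) \<and>
           braided_commutative_yetter_drinfeld_module_algebra uq_comult uq_counit uq_antipode act\<^sub>0 \<delta>\<^sub>0))"
  unfolding is_uq_action_iff is_uq_coaction_iff
proof (intro conjI allI impI)
  interpret poly: scalar_automorphism "lam_shift :: 'p lam_poly \<Rightarrow> _" "TYPE('p)"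
    by unfold_locales (rule assms lam_shift_hom lam_shift_period)+
  \<comment> \<open>Constants do not see the shift of \<lambda>, so the same theory is instantiated
    a second time with the identity.\<close>
  interpret const: scalar_automorphism "\<lambda>c :: complex. c" "TYPE('p)"
    by unfold_locales (simp_all add: assms algebra_hom_id flip: id_def)
  show "\<exists>!act. is_matrix_action lam_shift (act :: 'p uq \<Rightarrow> ('p lam_poly, 'p) smat \<Rightarrow> ('p lam_poly, 'p) smat)"
    using poly.is_matrix_action is_matrix_action_unique by blast
  show "\<exists>!\<delta>. is_matrix_coaction (\<delta> :: ('p lam_poly, 'p) smat \<Rightarrow> ('p uq, ('p lam_poly, 'p) smat) tensor)"
    using is_matrix_coaction_ex[OF assms] is_matrix_coaction_unique[OF assms] by blast
  fix act :: "'p uq \<Rightarrow> ('p lam_poly, 'p) smat \<Rightarrow> ('p lam_poly, 'p) smat"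
    and \<delta> :: "('p lam_poly, 'p) smat \<Rightarrow> ('p uq, ('p lam_poly, 'p) smat) tensor"
  assume act_\<delta>: "is_matrix_action lam_shift act \<and> is_matrix_coaction \<delta>"
  then interpret matrix_yetter_drinfeld lam_shift "TYPE('p)" act \<delta>
    by unfold_locales blast+
  show "braided_commutative_yetter_drinfeld_module_algebra uq_comult uq_counit uq_antipode act \<delta>"
    by (rule yetter_drinfeld)
  obtain \<delta>0 where \<delta>0: "is_matrix_coaction (\<delta>0 :: (complex, 'p) smat \<Rightarrow> ('p uq, (complex, 'p) smat) tensor)"
    using is_matrix_coaction_ex[OF assms] by blast
  interpret const: matrix_yetter_drinfeld "\<lambda>c. c" "TYPE('p)" const.matrix_action \<delta>0
    by unfold_locales (rule const.is_matrix_action \<delta>0)+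
  show "\<exists>act\<^sub>0 \<delta>\<^sub>0. (\<forall>h X. const_mat (act\<^sub>0 h X) = act h (const_mat X)) \<and>
      (\<forall>X. tensor_map id const_mat (\<delta>\<^sub>0 X) = \<delta> (const_mat X)) \<and>
      braided_commutative_yetter_drinfeld_module_algebra uq_comult uq_counit uq_antipode act\<^sub>0 \<delta>\<^sub>0"
    using act_\<delta> const_mat_action[OF assms _ const.is_matrix_action] const_mat_coaction[OF assms _ \<delta>0] const.yetter_drinfeld
    by blast
qed

end
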